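(* Let $(\Omega,\sigma)$ be a multivariable dynamical system and let $\mathcal{T}^+(\Omega,\sigma)$ be its tensor algebra. Then every approximately local left multiplier on $\mathcal{T}^+(\Omega,\sigma)$ is a left multiplier.
   Context: A multivariable dynamical system $(\Omega,\sigma)$ is a $\sigma$-compact locally compact Hausdorff space $\Omega$ together with finitely many proper continuous self maps $\sigma=(\sigma_1,\dots,\sigma_n)$ of $\Omega$. A $C^*$-correspondence $(X,A,\phi)$ consists of a $C^*$-algebra $A$, a right Hilbert $A$-module $X$ and a $*$-homomorphism $\phi:A\to\mathcal{L}(X)$ into the adjointable operators. A (Toeplitz) representation of it into a $C^*$-algebra $B$ is a pair $(\pi,t)$ of a $*$-homomorphism $\pi:A\to B$ and a linear map $t:X\to B$ with $\pi(a)t(\xi)=t(\phi(a)\xi)$ and $t(\xi)^*t(\eta)=\pi(\langle\xi,\eta\rangle)$. Let $(\pi_\infty,t_\infty)$ be the universal Toeplitz representation and $\mathcal{T}_X$ the $C^*$-algebra generated by all $\pi_\infty(a)$, $t_\infty(\xi)$. The tensor algebra $\mathcal{T}_X^+$ is the norm-closed subalgebra of $\mathcal{T}_X$ generated by all $\pi_\infty(a)$, $t_\infty(\xi)$, $a\in A$, $\xi\in X$. $\mathcal{T}^+(\Omega,\sigma)$ is the tensor algebra of the topological graph with vertex space $\Omega$, edge space $\{1,\dots,n\}\times\Omega$, source map $s(i,x)=x$ and range map $r(i,x)=\sigma_i(x)$; that is, $\mathcal{T}^+(\Omega,\sigma)=\mathcal{T}_X^+$ for the $C^*$-correspondence $X=C_0(\{1,\dots,n\}\times\Omega)$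 over $C_0(\Omega)$ with $(fFg)(i,x)=f(\sigma_i(x))F(i,x)g(x)$ and $\langle F,G\rangle(x)=\sum_{i=1}^n\overline{F(i,x)}G(i,x)$. All linear maps are bounded. For a Banach algebra $\mathcal{A}$, a left multiplier on $\mathcal{A}$ is a bounded linear map $S:\mathcal{A}\to\mathcal{A}$ with $S(AB)=S(A)B$ for all $A,B\in\mathcal{A}$. An approximately local left multiplier on $\mathcal{A}$ is a bounded linear map $S:\mathcal{A}\to\mathcal{A}$ such that for every $A\in\mathcal{A}$ there is a sequence $\{X_{A,n}\}_n$ in $\mathcal{A}$ with $S(A)=\lim_n X_{A,n}A$. *)

theory Defs
  imports "HOL-Analysis.Analysis" "HOL-Algebra.Module"
begin

section \<open>Banach algebras and multipliers\<close>

text \<open>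
  Algebras are carrier-based, since the universal property below quantifies over C*-algebras.
  Vector spaces are modules over the following ring in the sense of HOL-Algebra. Banach algebras
  need not be unital: the field \<open>one\<close> of the underlying ring record is never used.
\<close>

definition complex_ring :: "complex ring" where
  "complex_ring = \<lparr>carrier = UNIV, mult = (*), one = 1, zero = 0, add = (+)\<rparr>"

record 'b banach_algebra = "(complex, 'b) module" +
  vnorm :: "'b \<Rightarrow> real"

text \<open>A metric in the sense of \<open>Metric_space\<close> must be non-negative off its carrier, too.\<close>

definition vdist :: "('b, 'm) banach_algebra_scheme \<Rightarrow> 'b \<Rightarrow> 'b \<Rightarrow> real" where
  "vdist B x y =
     (if x \<in> carrier B \<and> y \<in> carrier B then vnorm B (x \<ominus>\<^bsub>B\<^esub> y) else 0)"

abbreviation vtopology :: "('b, 'm) banach_algebra_scheme \<Rightarrow> 'b topology" where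
  "vtopology B \<equiv> Metric_space.mtopology (carrier B) (vdist B)"

locale banach_algebra = M?: Module.module complex_ring B
  for B :: "('b, 'm) banach_algebra_scheme" (structure) +
  assumes mult_closed: "\<lbrakk>x \<in> carrier B; y \<in> carrier B\<rbrakk> \<Longrightarrow> x \<otimes> y \<in> carrier B"
    and mult_assoc: "\<lbrakk>x \<in> carrier B; y \<in> carrier B; z \<in> carrier B\<rbrakk>
      \<Longrightarrow> (x \<otimes> y) \<otimes> z = x \<otimes> (y \<otimes> z)"
    and mult_distr_left: "\<lbrakk>x \<in> carrier B; y \<in> carrier B; z \<in> carrier B\<rbrakk>
      \<Longrightarrow> (x \<oplus> y) \<otimes> z = x \<otimes> z \<oplus> y \<otimes> z"
    and mult_distr_right: "\<lbrakk>x \<in> carrier B; y \<in> carrier B; z \<in> carrier B\<rbrakk>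
      \<Longrightarrow> x \<otimes> (y \<oplus> z) = x \<otimes> y \<oplus> x \<otimes> z"
    and smult_mult_left: "\<lbrakk>x \<in> carrier B; y \<in> carrier B\<rbrakk>
      \<Longrightarrow> (c \<odot> x) \<otimes> y = c \<odot> (x \<otimes> y)"
    and smult_mult_right: "\<lbrakk>x \<in> carrier B; y \<in> carrier B\<rbrakk>
      \<Longrightarrow> x \<otimes> (c \<odot> y) = c \<odot> (x \<otimes> y)"
    and vnorm_eq_zero: "x \<in> carrier B \<Longrightarrow> vnorm B x = 0 \<longleftrightarrow> x = \<zero>"
    and vnorm_triangle: "\<lbrakk>x \<in> carrier B; y \<in> carrier B\<rbrakk>
      \<Longrightarrow> vnorm B (x \<oplus> y) \<le> vnorm B x + vnorm B y"
    and vnorm_smult: "x \<in> carrier B \<Longrightarrow> vnorm B (c \<odot> x) = cmod c * vnorm B x"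
    and vnorm_mult: "\<lbrakk>x \<in> carrier B; y \<in> carrier B\<rbrakk>
      \<Longrightarrow> vnorm B (x \<otimes> y) \<le> vnorm B x * vnorm B y"
    and vcomplete: "Metric_space.mcomplete (carrier B) (vdist B)"

definition linear_on ::
    "(complex, 'a, 'm) module_scheme \<Rightarrow> (complex, 'b, 'k) module_scheme \<Rightarrow> ('a \<Rightarrow> 'b) \<Rightarrow> bool" where
  "linear_on V W f \<longleftrightarrow>
     (\<forall>x\<in>carrier V. f x \<in> carrier W) \<and>
     (\<forall>x\<in>carrier V. \<forall>y\<in>carrier V. f (x \<oplus>\<^bsub>V\<^esub> y) = f x \<oplus>\<^bsub>W\<^esub> f y) \<and>
     (\<forall>c. \<forall>x\<in>carrier V. f (c \<odot>\<^bsub>V\<^esub> x) = c \<odot>\<^bsub>W\<^esub> f x)"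

definition bounded_linear_on :: "('b, 'm) banach_algebra_scheme \<Rightarrow> ('b \<Rightarrow> 'b) \<Rightarrow> bool" where
  "bounded_linear_on B S \<longleftrightarrow>
     linear_on B B S \<and> (\<exists>K. \<forall>x\<in>carrier B. vnorm B (S x) \<le> K * vnorm B x)"

definition left_multiplier :: "('b, 'm) banach_algebra_scheme \<Rightarrow> ('b \<Rightarrow> 'b) \<Rightarrow> bool" where
  "left_multiplier B S \<longleftrightarrow>
     bounded_linear_on B S \<and>
     (\<forall>x\<in>carrier B. \<forall>y\<in>carrier B. S (x \<otimes>\<^bsub>B\<^esub> y) = S x \<otimes>\<^bsub>B\<^esub> y)"

definition approx_local_left_multiplier ::
    "('b, 'm) banach_algebra_scheme \<Rightarrow> ('b \<Rightarrow> 'b) \<Rightarrow> bool" where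
  "approx_local_left_multiplier B S \<longleftrightarrow>
     bounded_linear_on B S \<and>
     (\<forall>a\<in>carrier B. \<exists>x :: nat \<Rightarrow> 'b. range x \<subseteq> carrier B \<and>
        limitin (vtopology B) (\<lambda>n. x n \<otimes>\<^bsub>B\<^esub> a) (S a) sequentially)"

definition closed_subalgebra :: "('b, 'm) banach_algebra_scheme \<Rightarrow> 'b set \<Rightarrow> bool" where
  "closed_subalgebra B C \<longleftrightarrow>
     closedin (vtopology B) C \<and> \<zero>\<^bsub>B\<^esub> \<in> C \<and>
     (\<forall>x\<in>C. \<forall>y\<in>C. x \<oplus>\<^bsub>B\<^esub> y \<in> C \<and> x \<otimes>\<^bsub>B\<^esub> y \<in> C) \<and>
     (\<forall>c. \<forall>x\<in>C. c \<odot>\<^bsub>B\<^esub> x \<in> C)"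


section \<open>C*-algebras and C*-correspondences\<close>

record 'b cstar_algebra = "'b banach_algebra" +
  star :: "'b \<Rightarrow> 'b"

locale cstar_algebra = banach_algebra B
  for B :: "('b, 'm) cstar_algebra_scheme" (structure) +
  assumes star_closed: "x \<in> carrier B \<Longrightarrow> star B x \<in> carrier B"
    and star_star: "x \<in> carrier B \<Longrightarrow> star B (star B x) = x"
    and star_add: "\<lbrakk>x \<in> carrier B; y \<in> carrier B\<rbrakk>
      \<Longrightarrow> star B (x \<oplus> y) = star B x \<oplus> star B y"
    and star_smult: "x \<in> carrier B \<Longrightarrow> star B (c \<odot> x) = cnj c \<odot> star B x"
    and star_mult: "\<lbrakk>x \<in> carrier B; y \<in> carrier B\<rbrakk>
      \<Longrightarrow> star B (x \<otimes> y) = star B y \<otimes> star B x"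
    and cstar_identity: "x \<in> carrier B \<Longrightarrow> vnorm B (star B x \<otimes> x) = (vnorm B x)\<^sup>2"

definition closed_star_subalgebra :: "('b, 'm) cstar_algebra_scheme \<Rightarrow> 'b set \<Rightarrow> bool" where
  "closed_star_subalgebra B C \<longleftrightarrow> closed_subalgebra B C \<and> (\<forall>x\<in>C. star B x \<in> C)"

definition star_hom ::
    "('a, 'm) cstar_algebra_scheme \<Rightarrow> ('b, 'k) cstar_algebra_scheme \<Rightarrow> ('a \<Rightarrow> 'b) \<Rightarrow> bool" where
  "star_hom A B f \<longleftrightarrow>
     linear_on A B f \<and>
     (\<forall>x\<in>carrier A. \<forall>y\<in>carrier A. f (x \<otimes>\<^bsub>A\<^esub> y) = f x \<otimes>\<^bsub>B\<^esub> f y) \<and>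
     (\<forall>x\<in>carrier A. f (star A x) = star B (f x))"

text \<open>\<open>lact X a\<close> is the operator \<open>\<phi>(a)\<close>.\<close>

record ('a, 'x) correspondence = "(complex, 'x) module" +
  ract :: "'x \<Rightarrow> 'a \<Rightarrow> 'x"
  inner_prod :: "'x \<Rightarrow> 'x \<Rightarrow> 'a"
  lact :: "'a \<Rightarrow> 'x \<Rightarrow> 'x"

definition hilbert_dist ::
    "('a, 'm) cstar_algebra_scheme \<Rightarrow> ('a, 'x, 'k) correspondence_scheme \<Rightarrow> 'x \<Rightarrow> 'x \<Rightarrow> real" where
  "hilbert_dist A X x y =
     (if x \<in> carrier X \<and> y \<in> carrier X
      then sqrt (vnorm A (inner_prod X (x \<ominus>\<^bsub>X\<^esub> y) (x \<ominus>\<^bsub>X\<^esub> y))) else 0)"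

text \<open>
  Linearity and boundedness of \<open>lact X a\<close>, as well as its compatibility with the right action,
  are consequences of adjointability.
\<close>

locale cstar_correspondence = A?: cstar_algebra A + X?: Module.module complex_ring X
  for A :: "('a, 'm) cstar_algebra_scheme" and X :: "('a, 'x, 'k) correspondence_scheme" +
  assumes ract_closed: "\<lbrakk>x \<in> carrier X; a \<in> carrier A\<rbrakk> \<Longrightarrow> ract X x a \<in> carrier X"
    and ract_add_left: "\<lbrakk>x \<in> carrier X; y \<in> carrier X; a \<in> carrier A\<rbrakk>
      \<Longrightarrow> ract X (x \<oplus>\<^bsub>X\<^esub> y) a = ract X x a \<oplus>\<^bsub>X\<^esub> ract X y a"
    and ract_add_right: "\<lbrakk>x \<in> carrier X; a \<in> carrier A; b \<in> carrier A\<rbrakk>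
      \<Longrightarrow> ract X x (a \<oplus>\<^bsub>A\<^esub> b) = ract X x a \<oplus>\<^bsub>X\<^esub> ract X x b"
    and ract_smult_left: "\<lbrakk>x \<in> carrier X; a \<in> carrier A\<rbrakk>
      \<Longrightarrow> ract X (c \<odot>\<^bsub>X\<^esub> x) a = c \<odot>\<^bsub>X\<^esub> ract X x a"
    and ract_smult_right: "\<lbrakk>x \<in> carrier X; a \<in> carrier A\<rbrakk>
      \<Longrightarrow> ract X x (c \<odot>\<^bsub>A\<^esub> a) = c \<odot>\<^bsub>X\<^esub> ract X x a"
    and ract_mult: "\<lbrakk>x \<in> carrier X; a \<in> carrier A; b \<in> carrier A\<rbrakk>
      \<Longrightarrow> ract X x (a \<otimes>\<^bsub>A\<^esub> b) = ract X (ract X x a) b"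
    and inner_closed: "\<lbrakk>x \<in> carrier X; y \<in> carrier X\<rbrakk> \<Longrightarrow> inner_prod X x y \<in> carrier A"
    and inner_add_right: "\<lbrakk>x \<in> carrier X; y \<in> carrier X; z \<in> carrier X\<rbrakk>
      \<Longrightarrow> inner_prod X x (y \<oplus>\<^bsub>X\<^esub> z) = inner_prod X x y \<oplus>\<^bsub>A\<^esub> inner_prod X x z"
    and inner_smult_right: "\<lbrakk>x \<in> carrier X; y \<in> carrier X\<rbrakk>
      \<Longrightarrow> inner_prod X x (c \<odot>\<^bsub>X\<^esub> y) = c \<odot>\<^bsub>A\<^esub> inner_prod X x y"
    and inner_ract: "\<lbrakk>x \<in> carrier X; y \<in> carrier X; a \<in> carrier A\<rbrakk>
      \<Longrightarrow> inner_prod X x (ract X y a) = inner_prod X x y \<otimes>\<^bsub>A\<^esub> a"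
    and inner_star: "\<lbrakk>x \<in> carrier X; y \<in> carrier X\<rbrakk>
      \<Longrightarrow> star A (inner_prod X x y) = inner_prod X y x"
    and inner_pos: "x \<in> carrier X \<Longrightarrow> \<exists>a\<in>carrier A. inner_prod X x x = star A a \<otimes>\<^bsub>A\<^esub> a"
    and inner_eq_zero: "x \<in> carrier X \<Longrightarrow> inner_prod X x x = \<zero>\<^bsub>A\<^esub> \<longleftrightarrow> x = \<zero>\<^bsub>X\<^esub>"
    and inner_complete: "Metric_space.mcomplete (carrier X) (hilbert_dist A X)"
    and lact_closed: "\<lbrakk>a \<in> carrier A; x \<in> carrier X\<rbrakk> \<Longrightarrow> lact X a x \<in> carrier X"
    and lact_adjoint: "\<lbrakk>a \<in> carrier A; x \<in> carrier X; y \<in> carrier X\<rbrakk>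
      \<Longrightarrow> inner_prod X (lact X a x) y = inner_prod X x (lact X (star A a) y)"
    and lact_add: "\<lbrakk>a \<in> carrier A; b \<in> carrier A; x \<in> carrier X\<rbrakk>
      \<Longrightarrow> lact X (a \<oplus>\<^bsub>A\<^esub> b) x = lact X a x \<oplus>\<^bsub>X\<^esub> lact X b x"
    and lact_smult: "\<lbrakk>a \<in> carrier A; x \<in> carrier X\<rbrakk>
      \<Longrightarrow> lact X (c \<odot>\<^bsub>A\<^esub> a) x = c \<odot>\<^bsub>X\<^esub> lact X a x"
    and lact_mult: "\<lbrakk>a \<in> carrier A; b \<in> carrier A; x \<in> carrier X\<rbrakk>
      \<Longrightarrow> lact X (a \<otimes>\<^bsub>A\<^esub> b) x = lact X a (lact X b x)"


section \<open>Toeplitz representations and tensor algebras\<close>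

definition toeplitz_rep ::
    "'a cstar_algebra \<Rightarrow> ('a, 'x) correspondence \<Rightarrow> 'b cstar_algebra
      \<Rightarrow> ('a \<Rightarrow> 'b) \<Rightarrow> ('x \<Rightarrow> 'b) \<Rightarrow> bool" where
  "toeplitz_rep A X B \<pi> t \<longleftrightarrow>
     star_hom A B \<pi> \<and> linear_on X B t \<and>
     (\<forall>a\<in>carrier A. \<forall>x\<in>carrier X. \<pi> a \<otimes>\<^bsub>B\<^esub> t x = t (lact X a x)) \<and>
     (\<forall>x\<in>carrier X. \<forall>y\<in>carrier X. star B (t x) \<otimes>\<^bsub>B\<^esub> t y = \<pi> (inner_prod X x y))"

text \<open>
  HOL formulas cannot quantify over types, so the C*-algebras in the universal property are those
  carried by a subset of the following type. This is no restriction: the C*-algebra generated by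
  any Toeplitz representation \<open>(\<pi>, t)\<close> consists of limits of sequences of finite sums of words in
  the elements \<open>\<pi>(a)\<close>, \<open>t(x)\<close> and \<open>t(x)\<^sup>*\<close>, hence is the image of a subset of this type under a map
  and has an isomorphic copy carried by a subset of it.
\<close>

type_synonym ('a, 'x) rep_universe = "nat \<Rightarrow> ('a + 'x + 'x) list list"

definition universal_toeplitz_rep ::
    "'a cstar_algebra \<Rightarrow> ('a, 'x) correspondence \<Rightarrow> 'b cstar_algebra
      \<Rightarrow> ('a \<Rightarrow> 'b) \<Rightarrow> ('x \<Rightarrow> 'b) \<Rightarrow> bool" where
  "universal_toeplitz_rep A X T \<pi> t \<longleftrightarrow>
     cstar_algebra T \<and> toeplitz_rep A X T \<pi> t \<and>
     closed_star_subalgebra T hull (\<pi> ` carrier A \<union> t ` carrier X) = carrier T \<and>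
     (\<forall>(B :: ('a, 'x) rep_universe cstar_algebra) \<pi>' t'.
        cstar_algebra B \<and> toeplitz_rep A X B \<pi>' t' \<longrightarrow>
        (\<exists>\<rho>. star_hom T B \<rho> \<and>
             (\<forall>a\<in>carrier A. \<rho> (\<pi> a) = \<pi>' a) \<and> (\<forall>x\<in>carrier X. \<rho> (t x) = t' x)))"

definition tensor_algebra ::
    "'a cstar_algebra \<Rightarrow> ('a, 'x) correspondence \<Rightarrow> 'b cstar_algebra
      \<Rightarrow> ('a \<Rightarrow> 'b) \<Rightarrow> ('x \<Rightarrow> 'b) \<Rightarrow> 'b banach_algebra" where
  "tensor_algebra A X T \<pi> t = banach_algebra.truncate
     (T\<lparr>carrier := closed_subalgebra T hull (\<pi> ` carrier A \<union> t ` carrier X)\<rparr>)"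


section \<open>Multivariable dynamical systems\<close>

definition sigma_compact_space :: "'a topology \<Rightarrow> bool" where
  "sigma_compact_space \<Omega> \<longleftrightarrow>
     (\<exists>K :: nat \<Rightarrow> 'a set. (\<forall>k. compactin \<Omega> (K k)) \<and> topspace \<Omega> = (\<Union>k. K k))"

definition multivariable_dynamical_system ::
    "'a topology \<Rightarrow> nat \<Rightarrow> (nat \<Rightarrow> 'a \<Rightarrow> 'a) \<Rightarrow> bool" where
  "multivariable_dynamical_system \<Omega> n \<sigma> \<longleftrightarrow>
     sigma_compact_space \<Omega> \<and> locally_compact_space \<Omega> \<and> Hausdorff_space \<Omega> \<and>
     (\<forall>i\<in>{1..n}. continuous_map \<Omega> \<Omega> (\<sigma> i) \<and> proper_map \<Omega> \<Omega> (\<sigma> i))"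

text \<open>
  Functions on a space are extended by zero, so that equality of functions is equality on the
  space; the supremum defining the norm may then be taken over the whole type.
\<close>

definition C0 :: "'a topology \<Rightarrow> ('a \<Rightarrow> complex) set" where
  "C0 \<Omega> = {f. continuous_map \<Omega> euclidean f \<and>
     (\<forall>e>0. compactin \<Omega> {x \<in> topspace \<Omega>. e \<le> cmod (f x)}) \<and>
     (\<forall>x. x \<notin> topspace \<Omega> \<longrightarrow> f x = 0)}"

definition C0_algebra :: "'a topology \<Rightarrow> ('a \<Rightarrow> complex) cstar_algebra" where
  "C0_algebra \<Omega> =
     \<lparr>carrier = C0 \<Omega>, mult = (\<lambda>f g x. f x * g x), one = undefined,
      zero = (\<lambda>x. 0), add = (\<lambda>f g x. f x + g x), smult = (\<lambda>c f x. c * f x),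
      vnorm = (\<lambda>f. SUP x. cmod (f x)), star = (\<lambda>f x. cnj (f x))\<rparr>"

abbreviation edge_space :: "nat \<Rightarrow> 'a topology \<Rightarrow> (nat \<times> 'a) topology" where
  "edge_space n \<Omega> \<equiv> prod_topology (discrete_topology {1..n}) \<Omega>"

text \<open>A correspondence has no product; the fields \<open>mult\<close> and \<open>one\<close> of its record are junk.\<close>

definition dyn_correspondence ::
    "'a topology \<Rightarrow> nat \<Rightarrow> (nat \<Rightarrow> 'a \<Rightarrow> 'a)
      \<Rightarrow> ('a \<Rightarrow> complex, nat \<times> 'a \<Rightarrow> complex) correspondence" where
  "dyn_correspondence \<Omega> n \<sigma> =
     \<lparr>carrier = C0 (edge_space n \<Omega>),
      mult = undefined, one = undefined,
      zero = (\<lambda>p. 0), add = (\<lambda>F G p. F p + G p), smult = (\<lambda>c F p. c * F p),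
      ract = (\<lambda>F g (i, x). F (i, x) * g x),
      inner_prod = (\<lambda>F G x. \<Sum>i = 1..n. cnj (F (i, x)) * G (i, x)),
      lact = (\<lambda>f F (i, x). f (\<sigma> i x) * F (i, x))\<rparr>"


section \<open>The data above form a C*-correspondence\<close>

lemma C0I:
  assumes "continuous_map T euclidean f" "\<And>x. x \<notin> topspace T \<Longrightarrow> f x = 0"
    and small: "\<And>e. e > 0 \<Longrightarrow> \<exists>K. compactin T K \<and> (\<forall>x. x \<notin> K \<longrightarrow> cmod (f x) < e)"
  shows "f \<in> C0 T"
proof -
  have "compactin T {x \<in> topspace T. e \<le> cmod (f x)}" if e: "e > 0" for e
  proof -
    obtain K where K: "compactin T K" "\<forall>x. x \<notin> K \<longrightarrow> cmod (f x) < e" using small[OF e] by blast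
    have "closedin T {x \<in> topspace T. cmod (f x) \<in> {e..}}"
      by (rule closedin_continuous_map_preimage[OF continuous_map_norm[OF assms(1)]]) auto
    then show ?thesis using K by (intro closed_compactin[OF K(1)]) (force simp: not_le)+
  qed
  with assms show ?thesis by (auto simp: C0_def)
qed

lemma C0D:
  assumes "f \<in> C0 T"
  shows C0_cont: "continuous_map T euclidean f" and C0_zero: "x \<notin> topspace T \<Longrightarrow> f x = 0"
    and C0_small: "e > 0 \<Longrightarrow> \<exists>K. compactin T K \<and> (\<forall>x. x \<notin> K \<longrightarrow> cmod (f x) < e)"
proof -
  show "continuous_map T euclidean f" and z: "x \<notin> topspace T \<Longrightarrow> f x = 0" for x
    using assms by (auto simp: C0_def)
  assume e: "e > 0"
  show "\<exists>K. compactin T K \<and> (\<forall>x. x \<notin> K \<longrightarrow> cmod (f x) < e)"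
    by (rule exI[of _ "{x \<in> topspace T. e \<le> cmod (f x)}"])
       (use assms e z in \<open>fastforce simp: C0_def\<close>)
qed

lemma C0_bdd: assumes "f \<in> C0 T" obtains B where "B > 0" "\<And>x. cmod (f x) \<le> B"
proof -
  obtain K where K: "compactin T K" "\<forall>x. x \<notin> K \<longrightarrow> cmod (f x) < 1"
    using C0_small[OF assms, of 1] by auto
  have "compactin euclidean (f ` K)" using image_compactin[OF K(1) C0_cont[OF assms]] .
  then have "bounded (f ` K)" by (auto intro: compact_imp_bounded)
  then obtain b where b: "\<And>x. x \<in> K \<Longrightarrow> cmod (f x) \<le> b" by (auto simp: bounded_iff)
  show ?thesis by (rule that[of "max 1 b"]) (use b K(2) in \<open>force simp: le_max_iff_disj\<close>)+
qed

lemma continuous_map_complex_mult: "continuous_map T euclidean f \<Longrightarrow> continuous_map T euclidean g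
   \<Longrightarrow> continuous_map T euclidean (\<lambda>x. f x * g x)" for f g :: "_ \<Rightarrow> complex"
  by (simp add: continuous_map_atin tendsto_mult)

lemma C0_mult_bdd:
  assumes f: "f \<in> C0 T" and g: "continuous_map T euclidean g" and b: "\<And>x. x \<in> topspace T \<Longrightarrow> cmod (g x) \<le> b"
  shows "(\<lambda>x. g x * f x) \<in> C0 T"
proof (rule C0I)
  show "continuous_map T euclidean (\<lambda>x. g x * f x)" by (intro continuous_map_complex_mult g C0_cont[OF f])
  show "x \<notin> topspace T \<Longrightarrow> g x * f x = 0" for x using C0_zero[OF f] by simp
  fix e :: real assume e: "e > 0"
  define B where "B = max 1 b"
  have B: "B > 0" "\<And>x. x \<in> topspace T \<Longrightarrow> cmod (g x) \<le> B" using b by (auto simp: B_def le_max_iff_disj)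
  obtain K where K: "compactin T K" "\<forall>x. x \<notin> K \<longrightarrow> cmod (f x) < e / B"
    using C0_small[OF f, of "e/B"] e B by auto
  have "cmod (g x * f x) < e" if "x \<notin> K" for x
  proof (cases "x \<in> topspace T")
    case True
    have "cmod (g x * f x) \<le> B * cmod (f x)" using B(2)[OF True] by (simp add: norm_mult mult_right_mono)
    also have "\<dots> < e" using K(2) that B(1) by (simp add: pos_less_divide_eq mult.commute)
    finally show ?thesis .
  qed (use C0_zero[OF f] e in auto)
  then show "\<exists>K. compactin T K \<and> (\<forall>x. x \<notin> K \<longrightarrow> cmod (g x * f x) < e)" using K by blast
qed

lemma C0_mult: "f \<in> C0 T \<Longrightarrow> g \<in> C0 T \<Longrightarrow> (\<lambda>x. f x * g x) \<in> C0 T"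
  by (rule C0_bdd[of f], assumption) (rule C0_mult_bdd, auto intro: C0_cont)

lemma C0_smult: "f \<in> C0 T \<Longrightarrow> (\<lambda>x. c * f x) \<in> C0 T"
  by (rule C0_mult_bdd[where b = "cmod c"]) auto

lemma C0_zero_fun: "(\<lambda>x. 0) \<in> C0 T"
  by (rule C0I) (auto intro: exI[of _ "{}"])

lemma C0_add: assumes "f \<in> C0 T" "g \<in> C0 T" shows "(\<lambda>x. f x + g x) \<in> C0 T"
proof (rule C0I)
  show "continuous_map T euclidean (\<lambda>x. f x + g x)" using assms by (intro continuous_map_add C0_cont)
  fix e :: real assume "e > 0"
  then obtain K L where KL: "compactin T K" "\<And>x. x \<notin> K \<Longrightarrow> cmod (f x) < e/2"
     "compactin T L" "\<And>x. x \<notin> L \<Longrightarrow> cmod (g x) < e/2"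
    using C0_small[OF assms(1), of "e/2"] C0_small[OF assms(2), of "e/2"] by (metis half_gt_zero)
  have "cmod (f x + g x) < e" if "x \<notin> K \<union> L" for x
    using KL(2)[of x] KL(4)[of x] that norm_triangle_ineq[of "f x" "g x"] by simp
  then show "\<exists>K. compactin T K \<and> (\<forall>x. x \<notin> K \<longrightarrow> cmod (f x + g x) < e)"
    using compactin_Un[OF KL(1,3)] by blast
qed (simp add: C0_zero[OF assms(1)] C0_zero[OF assms(2)])

lemma C0_cnj: assumes "f \<in> C0 T" shows "(\<lambda>x. cnj (f x)) \<in> C0 T"
proof (rule C0I)
  show "continuous_map T euclidean (\<lambda>x. cnj (f x))"
    using C0_cont[OF assms] by (simp add: continuous_map_atin tendsto_cnj)
qed (use C0_small[OF assms] C0_zero[OF assms] in auto)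

lemma C0_sum: "finite I \<Longrightarrow> (\<And>i. i \<in> I \<Longrightarrow> f i \<in> C0 T) \<Longrightarrow> (\<lambda>x. \<Sum>i\<in>I. f i x) \<in> C0 T"
  by (induction I rule: finite_induct) (auto intro: C0_zero_fun C0_add)

lemma C0_unif_limit:
  assumes F: "\<And>k::nat. F k \<in> C0 T"
    and C: "\<And>e. e > 0 \<Longrightarrow> \<exists>N. \<forall>m\<ge>N. \<forall>n\<ge>N. \<forall>x. cmod (F m x - F n x) < e"
  obtains G where "G \<in> C0 T" "\<And>e. e > 0 \<Longrightarrow> \<exists>N. \<forall>n\<ge>N. \<forall>x. cmod (F n x - G x) < e"
proof -
  have "\<exists>G. \<forall>e>0. \<exists>N. \<forall>n x. N \<le> n \<and> True \<longrightarrow> dist (F n x) (G x) < e"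
    unfolding uniformly_convergent_eq_cauchy using C by (simp add: dist_norm) meson
  then obtain G where G: "\<And>e. e > 0 \<Longrightarrow> \<exists>N. \<forall>n\<ge>N. \<forall>x. cmod (F n x - G x) < e"
    by (auto simp: dist_norm)
  have "G \<in> C0 T"
  proof (rule C0I)
    have "continuous_map T Met_TC.mtopology G"
    proof (rule Met_TC.continuous_map_uniform_limit[where F=sequentially and f=F])
      show "\<forall>\<^sub>F \<xi> in sequentially. continuous_map T Met_TC.mtopology (F \<xi>)"
        using F by (simp add: C0_cont)
      show "\<forall>\<^sub>F \<xi> in sequentially. \<forall>x\<in>topspace T. G x \<in> UNIV \<and> dist (F \<xi> x) (G x) < e" if "e > 0" for e
        using G[OF that] by (auto simp: eventually_sequentially dist_norm)
    qed auto
    then show "continuous_map T euclidean G" by simp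
    show "G x = 0" if "x \<notin> topspace T" for x
    proof -
      have "cmod (G x) < e" if e: "e > 0" for e
      proof -
        obtain n where "cmod (F n x - G x) < e" using G[OF e] by blast
        then show ?thesis using C0_zero[OF F \<open>x \<notin> topspace T\<close>, of n] by simp
      qed
      then show ?thesis by (meson less_irrefl norm_ge_zero zero_less_norm_iff)
    qed
    fix e :: real assume e: "e > 0"
    obtain n where n: "\<And>x. cmod (F n x - G x) < e/2" using G[of "e/2"] e by auto
    obtain K where "compactin T K" "\<forall>x. x \<notin> K \<longrightarrow> cmod (F n x) < e/2"
      using C0_small[OF F, of "e/2"] e by auto
    moreover have "cmod (G x) < e" if "cmod (F n x) < e/2" for x
      using n[of x] that norm_triangle_ineq4[of "F n x" "F n x - G x"] by simp
    ultimately show "\<exists>K. compactin T K \<and> (\<forall>x. x \<notin> K \<longrightarrow> cmod (G x) < e)" by blast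
  qed
  then show ?thesis using G that by blast
qed

lemma C0_algebra_simps [simp]:
  "carrier (C0_algebra T) = C0 T" "f \<otimes>\<^bsub>C0_algebra T\<^esub> g = (\<lambda>x. f x * g x)"
  "f \<oplus>\<^bsub>C0_algebra T\<^esub> g = (\<lambda>x. f x + g x)" "\<zero>\<^bsub>C0_algebra T\<^esub> = (\<lambda>x. 0)"
  "c \<odot>\<^bsub>C0_algebra T\<^esub> f = (\<lambda>x. c * f x)" "vnorm (C0_algebra T) f = (SUP x. cmod (f x))"
  "star (C0_algebra T) f = (\<lambda>x. cnj (f x))"
  by (simp_all add: C0_algebra_def)

lemma dyn_correspondence_simps [simp]:
  "carrier (dyn_correspondence T n s) = C0 (edge_space n T)"
  "h \<oplus>\<^bsub>dyn_correspondence T n s\<^esub> k = (\<lambda>p. h p + k p)" "\<zero>\<^bsub>dyn_correspondence T n s\<^esub> = (\<lambda>x. 0)"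
  "c \<odot>\<^bsub>dyn_correspondence T n s\<^esub> h = (\<lambda>p. c * h p)"
  "ract (dyn_correspondence T n s) F g = (\<lambda>(i, x). F (i, x) * g x)"
  "lact (dyn_correspondence T n s) g F = (\<lambda>(i, x). g (s i x) * F (i, x))"
  "inner_prod (dyn_correspondence T n s) F G = (\<lambda>x. \<Sum>i = 1..n. cnj (F (i, x)) * G (i, x))"
  by (simp_all add: dyn_correspondence_def)

lemma cring_complex_ring: "cring complex_ring"
proof (rule cringI)
  show "abelian_group complex_ring"
    by (rule abelian_groupI) (auto simp: complex_ring_def intro: exI[of _ "- _"] add.left_inverse)
  show "comm_monoid complex_ring" by (rule comm_monoidI) (auto simp: complex_ring_def)
qed (auto simp: complex_ring_def algebra_simps)

lemma C0_module:
  assumes "carrier M = C0 T" "\<And>f g. f \<oplus>\<^bsub>M\<^esub> g = (\<lambda>x. f x + g x)" "\<zero>\<^bsub>M\<^esub> = (\<lambda>x. 0)"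
   "\<And>c f. c \<odot>\<^bsub>M\<^esub> f = (\<lambda>x. c * f x)"
 shows "Module.module complex_ring M" (is ?A)
   and C0_minus: "f \<in> C0 T \<Longrightarrow> g \<in> C0 T \<Longrightarrow> f \<ominus>\<^bsub>M\<^esub> g = (\<lambda>x. f x - g x)"
proof -
  have neg: "(\<lambda>x. - f x) \<in> C0 T" if "f \<in> C0 T" for f using C0_smult[OF that, of "-1"] by simp
  show A: ?A
  proof (rule moduleI[OF cring_complex_ring abelian_groupI])
    show "\<exists>y\<in>carrier M. y \<oplus>\<^bsub>M\<^esub> x = \<zero>\<^bsub>M\<^esub>" if "x \<in> carrier M" for x
      using that neg[of x] by (auto simp: assms intro!: bexI[of _ "\<lambda>z. - x z"])
  qed (auto simp: assms complex_ring_def algebra_simps C0_add C0_smult C0_zero_fun)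
  interpret Module.module complex_ring M by (rule A)
  assume fg: "f \<in> C0 T" "g \<in> C0 T"
  have "\<ominus>\<^bsub>M\<^esub> g = (\<lambda>x. - g x)"
    by (rule M.minus_equality) (use fg neg in \<open>auto simp: assms\<close>)
  then show "f \<ominus>\<^bsub>M\<^esub> g = (\<lambda>x. f x - g x)"
    by (simp add: a_minus_def assms)
qed

lemma C0_bdd_above: "f \<in> C0 T \<Longrightarrow> bdd_above (range (\<lambda>x. cmod (f x)))"
  by (rule C0_bdd[of f T], assumption) (rule bdd_aboveI2, auto)

lemma C0_le_norm: "f \<in> C0 T \<Longrightarrow> cmod (f x) \<le> (SUP x. cmod (f x))"
  by (rule cSUP_upper) (auto intro: C0_bdd_above)

lemma sup_norm_le: "(\<And>x. cmod (f x) \<le> b) \<Longrightarrow> (SUP x. cmod (f x)) \<le> b"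
  by (rule cSUP_least) auto

lemma banach_algebra_Metric_space: assumes "banach_algebra B" shows "Metric_space (carrier B) (vdist B)"
proof -
  interpret banach_algebra B by (rule assms)
  have s1: "\<ominus>\<^bsub>B\<^esub> x = (-1) \<odot>\<^bsub>B\<^esub> x" if "x \<in> carrier B" for x
  proof (rule M.minus_equality)
    have "(-1) \<odot>\<^bsub>B\<^esub> x \<oplus>\<^bsub>B\<^esub> 1 \<odot>\<^bsub>B\<^esub> x = (-1 + 1) \<odot>\<^bsub>B\<^esub> x"
      using smult_l_distr[of "-1" 1 x] that by (simp add: complex_ring_def)
    also have "\<dots> = \<zero>\<^bsub>B\<^esub>" using smult_l_null[of x] that by (simp add: complex_ring_def)
    finally show "(-1) \<odot>\<^bsub>B\<^esub> x \<oplus>\<^bsub>B\<^esub> x = \<zero>\<^bsub>B\<^esub>" using smult_one[OF that] by (simp add: complex_ring_def)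
  qed (use that smult_closed[of "-1" x] in \<open>auto simp: complex_ring_def\<close>)
  have neg: "vnorm B (\<ominus>\<^bsub>B\<^esub> x) = vnorm B x" if "x \<in> carrier B" for x
    using vnorm_smult[OF that, of "-1"] s1[OF that] by simp
  have nn: "vnorm B x \<ge> 0" if "x \<in> carrier B" for x
    using vnorm_triangle[OF that M.a_inv_closed[OF that]] neg[OF that] vnorm_eq_zero[of "\<zero>\<^bsub>B\<^esub>"] that
    by (simp add: M.r_neg)
  show ?thesis
  proof
    show "0 \<le> vdist B x y" for x y by (simp add: vdist_def nn)
    show "vdist B x y = vdist B y x" for x y
      using neg[of "x \<ominus>\<^bsub>B\<^esub> y"] by (auto simp: vdist_def M.minus_eq M.minus_add M.a_comm)
    show "x \<in> carrier B \<Longrightarrow> y \<in> carrier B \<Longrightarrow> vdist B x y = 0 \<longleftrightarrow> x = y" for x y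
      by (auto simp: vdist_def vnorm_eq_zero M.minus_eq M.r_neg)
         (metis M.a_inv_closed M.minus_equality M.minus_minus)
    show "vdist B x z \<le> vdist B x y + vdist B y z"
      if "x \<in> carrier B" "y \<in> carrier B" "z \<in> carrier B" for x y z
    proof -
      have "(x \<ominus>\<^bsub>B\<^esub> y) \<oplus>\<^bsub>B\<^esub> (y \<ominus>\<^bsub>B\<^esub> z) = x \<ominus>\<^bsub>B\<^esub> z"
        using that by (simp add: M.minus_eq M.a_assoc M.r_neg1)
      then show ?thesis using vnorm_triangle[of "x \<ominus>\<^bsub>B\<^esub> y" "y \<ominus>\<^bsub>B\<^esub> z"] that by (simp add: vdist_def)
    qed
  qed
qed

lemma mcompleteI:
  assumes M: "Metric_space M d"
    and "\<And>F. range F \<subseteq> M \<Longrightarrow> (\<And>e. e>0 \<Longrightarrow> \<exists>N. \<forall>m\<ge>N. \<forall>n\<ge>N. d (F m) (F n) < e)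
       \<Longrightarrow> \<exists>G\<in>M. \<forall>e>0. \<exists>N. \<forall>n\<ge>(N::nat). d (F n) G < e"
  shows "Metric_space.mcomplete M d"
proof -
  interpret Metric_space M d by (rule M)
  show ?thesis unfolding mcomplete_def MCauchy_def
    using assms(2) by (metis (no_types, lifting) limit_metric_sequentially range_subsetD)
qed


lemma C0_vdist: "vdist (C0_algebra T) f g = (if f \<in> C0 T \<and> g \<in> C0 T then SUP x. cmod (f x - g x) else 0)"
  using C0_minus[of "C0_algebra T" T, simplified] by (simp add: vdist_def)

lemma C0_diff: "f \<in> C0 T \<Longrightarrow> g \<in> C0 T \<Longrightarrow> (\<lambda>x. f x - g x) \<in> C0 T"
  using C0_add[OF _ C0_smult[of g T "-1"]] by simp

lemma C0_norm_eq_0: assumes "f \<in> C0 T" shows "(SUP x. cmod (f x)) = 0 \<longleftrightarrow> f = (\<lambda>x. 0)"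
proof
  assume "(SUP x. cmod (f x)) = 0"
  then have "cmod (f x) \<le> 0" for x using C0_le_norm[OF assms, of x] by simp
  then show "f = (\<lambda>x. 0)" by auto
qed auto

lemma C0_norm_add:
  assumes "f \<in> C0 T" "g \<in> C0 T" shows "(SUP x. cmod (f x + g x)) \<le> (SUP x. cmod (f x)) + (SUP x. cmod (g x))"
  by (rule sup_norm_le) (rule order_trans[OF norm_triangle_ineq add_mono[OF C0_le_norm[OF assms(1)] C0_le_norm[OF assms(2)]]])

lemma C0_norm_ge0: "f \<in> C0 T \<Longrightarrow> 0 \<le> (SUP x. cmod (f x))"
  using order_trans[OF norm_ge_zero C0_le_norm] .

lemma C0_Metric_space: "Metric_space (C0 T) (vdist (C0_algebra T))"
proof
  fix x y z
  show "0 \<le> vdist (C0_algebra T) x y" by (auto simp: C0_vdist intro!: C0_norm_ge0 C0_diff)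
  show "vdist (C0_algebra T) x y = vdist (C0_algebra T) y x" by (simp add: C0_vdist norm_minus_commute)
  assume a: "x \<in> C0 T" "y \<in> C0 T"
  then show "vdist (C0_algebra T) x y = 0 \<longleftrightarrow> x = y"
    using C0_norm_eq_0[OF C0_diff[of x T y]] by (simp add: C0_vdist fun_eq_iff)
  assume "z \<in> C0 T" with a show "vdist (C0_algebra T) x z \<le> vdist (C0_algebra T) x y + vdist (C0_algebra T) y z"
    using C0_norm_add[of "\<lambda>t. x t - y t" T "\<lambda>t. y t - z t"] by (simp add: C0_vdist C0_diff)
qed

lemma C0_complete: "Metric_space.mcomplete (C0 T) (vdist (C0_algebra T))"
proof (rule mcompleteI[OF C0_Metric_space])
  fix F :: "nat \<Rightarrow> _" assume F: "range F \<subseteq> C0 T"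
    and C: "\<And>e. e>0 \<Longrightarrow> \<exists>N. \<forall>m\<ge>N. \<forall>n\<ge>N. vdist (C0_algebra T) (F m) (F n) < e"
  have [simp]: "F n \<in> C0 T" for n using F by auto
  have "\<exists>N. \<forall>m\<ge>N. \<forall>n\<ge>N. \<forall>x. cmod (F m x - F n x) < e" if "e > 0" for e
    using C[OF that] C0_le_norm[OF C0_diff[of "F _" T "F _"]] by (simp add: C0_vdist) (meson le_less_trans)
  then obtain G where G: "G \<in> C0 T" "\<And>e. e > 0 \<Longrightarrow> \<exists>N. \<forall>n\<ge>N. \<forall>x. cmod (F n x - G x) < e"
    by (rule C0_unif_limit[of F T, rotated]) auto
  have "\<exists>N. \<forall>n\<ge>N. vdist (C0_algebra T) (F n) G < e" if e: "e > 0" for e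
  proof -
    obtain N where N: "\<And>n x. n \<ge> N \<Longrightarrow> cmod (F n x - G x) < e/2" using G(2)[of "e/2"] e by auto
    have "vdist (C0_algebra T) (F n) G \<le> e/2" if "n \<ge> N" for n
      using sup_norm_le[of "\<lambda>x. F n x - G x" "e/2", OF less_imp_le[OF N[OF that]]] G(1) by (simp add: C0_vdist)
    then show ?thesis using e by (intro exI[of _ N]) (fastforce intro: le_less_trans)
  qed
  with G show "\<exists>G\<in>C0 T. \<forall>e>0. \<exists>N. \<forall>n\<ge>N. vdist (C0_algebra T) (F n) G < e" by blast
qed

lemma C0_banach_algebra: "banach_algebra (C0_algebra T)"
proof -
  interpret M: Module.module complex_ring "C0_algebra T" by (rule C0_module[where T=T]) auto
  show ?thesis
  proof unfold_locales
    fix x y c assume xy[simp]: "x \<in> carrier (C0_algebra T)" "y \<in> carrier (C0_algebra T)"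
    have [simp]: "x \<in> C0 T" "y \<in> C0 T" using xy by auto
    show "vnorm (C0_algebra T) (x \<otimes>\<^bsub>C0_algebra T\<^esub> y) \<le> vnorm (C0_algebra T) x * vnorm (C0_algebra T) y"
      unfolding C0_algebra_simps by (rule sup_norm_le) (simp add: norm_mult mult_mono C0_le_norm[of x T] C0_le_norm[of y T] C0_norm_ge0[of x T])
  next
    fix x c assume x: "x \<in> carrier (C0_algebra T)"
    then have x: "x \<in> C0 T" by simp
    have le: "(SUP z. cmod (c * y z)) \<le> cmod c * (SUP z. cmod (y z))" if "y \<in> C0 T" for y c
      by (rule sup_norm_le) (unfold norm_mult, intro mult_left_mono C0_le_norm[OF that] norm_ge_zero)
    have "(SUP z. cmod (c * x z)) = cmod c * (SUP z. cmod (x z))"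
    proof (cases "c = 0")
      case False
      have "(SUP z. cmod (inverse c * (c * x z))) \<le> cmod (inverse c) * (SUP z. cmod (c * x z))"
        by (rule le) (rule C0_smult[OF x])
      then have "cmod c * (SUP z. cmod (x z)) \<le> (SUP z. cmod (c * x z))" using False
        by (simp add: mult.assoc[symmetric] norm_inverse norm_divide field_simps)
      then show ?thesis using le[OF x, of c] by simp
    qed simp
    then show "vnorm (C0_algebra T) (c \<odot>\<^bsub>C0_algebra T\<^esub> x) = cmod c * vnorm (C0_algebra T) x" by simp
  qed (auto simp: C0_mult algebra_simps C0_norm_eq_0 C0_norm_add C0_complete)
qed

lemma C0_cstar_algebra: "cstar_algebra (C0_algebra T)"
proof -
  interpret banach_algebra "C0_algebra T" by (rule C0_banach_algebra)
  show ?thesis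
  proof unfold_locales
    fix x assume "x \<in> carrier (C0_algebra T)" then have x: "x \<in> C0 T" by simp
    have "(SUP z. cmod (cnj (x z) * x z)) = (SUP z. cmod (x z))\<^sup>2" (is "?l = ?r\<^sup>2")
    proof (rule antisym)
      show "?l \<le> ?r\<^sup>2" unfolding power2_eq_square
      proof (rule sup_norm_le)
        fix z
        have "cmod (x z) * cmod (x z) \<le> ?r * ?r"
          using C0_le_norm[OF x, of z] by (intro mult_mono) (auto intro: C0_norm_ge0[OF x])
        then show "cmod (cnj (x z) * x z) \<le> ?r * ?r" by (simp add: norm_mult)
      qed
      have "cmod (x z) \<le> sqrt ?l" for z
        using C0_le_norm[OF C0_mult[OF C0_cnj[OF x] x], of z]
        by (intro real_le_rsqrt) (simp add: norm_mult power2_eq_square)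
      then have "?r \<le> sqrt ?l" by (rule sup_norm_le)
      then show "?r\<^sup>2 \<le> ?l" using C0_norm_ge0[OF x] C0_norm_ge0[OF C0_mult[OF C0_cnj[OF x] x]]
        by (metis power_mono real_sqrt_pow2)
    qed
    then show "vnorm (C0_algebra T) (star (C0_algebra T) x \<otimes>\<^bsub>C0_algebra T\<^esub> x) = (vnorm (C0_algebra T) x)\<^sup>2"
      by simp
  qed (auto simp: C0_cnj)
qed

lemma C0_slice: assumes F: "F \<in> C0 (edge_space n T)" shows "(\<lambda>x. F (i, x)) \<in> C0 T"
proof (cases "i \<in> {1..n}")
  case True
  show ?thesis
  proof (rule C0I)
    have "continuous_map T (edge_space n T) (\<lambda>x. (i, x))"
      using True by (intro continuous_map_pairedI) auto
    from continuous_map_compose[OF this C0_cont[OF F]]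
    show "continuous_map T euclidean (\<lambda>x. F (i, x))" by (simp add: o_def)
    fix e :: real assume "e > 0"
    then obtain K where K: "compactin (edge_space n T) K" "\<forall>x. x \<notin> K \<longrightarrow> cmod (F x) < e" using C0_small[OF F] by blast
    have "compactin T (snd ` K)" by (rule image_compactin[OF K(1) continuous_map_snd])
    then show "\<exists>K. compactin T K \<and> (\<forall>x. x \<notin> K \<longrightarrow> cmod (F (i, x)) < e)" using K(2) by (force intro!: exI[of _ "snd ` K"])
  qed (use C0_zero[OF F] in auto)
next
  case False
  then have "F (i,x) = 0" for x using C0_zero[OF F] by auto
  then show ?thesis by (simp add: C0_zero_fun)
qed

lemma continuous_map_edge_space:
  assumes "\<And>i. i \<in> {1..n} \<Longrightarrow> continuous_map T euclidean (g i)"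
  shows "continuous_map (edge_space n T) euclidean (\<lambda>(i, x). g i x)"
  unfolding continuous_map
proof (intro conjI allI impI)
  fix U :: "'b set" assume U: "openin euclidean U"
  have eq: "{p \<in> topspace (edge_space n T). (\<lambda>(i, x). g i x) p \<in> U} = (\<Union>i\<in>{1..n}. {i} \<times> {x \<in> topspace T. g i x \<in> U})"
    by auto
  show "openin (edge_space n T) {p \<in> topspace (edge_space n T). (\<lambda>(i, x). g i x) p \<in> U}"
    unfolding eq by (intro openin_Union) (use assms U in \<open>auto simp: openin_prod_Times_iff continuous_map\<close>)
qed auto

lemma lact_C0:
  assumes F: "F \<in> C0 (edge_space n T)" and f: "f \<in> C0 T" and s: "\<And>i. i \<in> {1..n} \<Longrightarrow> continuous_map T T (s i)"
  shows "(\<lambda>(i, x). f (s i x) * F (i, x)) \<in> C0 (edge_space n T)"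
proof -
  obtain b where b: "\<And>x. cmod (f x) \<le> b" using C0_bdd[OF f] by metis
  have "continuous_map (edge_space n T) euclidean (\<lambda>(i, x). f (s i x))"
    by (rule continuous_map_edge_space) (use continuous_map_compose[OF s C0_cont[OF f]] in \<open>simp add: o_def\<close>)
  from C0_mult_bdd[OF F this, of b] b show ?thesis by (simp add: case_prod_unfold)
qed

lemma ract_C0:
  assumes F: "F \<in> C0 (edge_space n T)" and f: "f \<in> C0 T"
  shows "(\<lambda>(i, x). F (i, x) * f x) \<in> C0 (edge_space n T)"
  using lact_C0[OF F f, of "\<lambda>i x. x"] by (simp add: mult.commute)

lemma inner_C0: "F \<in> C0 (edge_space n T) \<Longrightarrow> G \<in> C0 (edge_space n T) \<Longrightarrow> (\<lambda>x. \<Sum>i = 1..n. cnj (F (i, x)) * G (i, x)) \<in> C0 T"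
  by (intro C0_sum C0_mult C0_cnj C0_slice) auto

lemma sum_cnj_mult_self: "(\<Sum>i = 1..n. cnj (F (i, x)) * F (i, x)) = of_real (\<Sum>i = 1..n. (cmod (F (i, x)))\<^sup>2)"
  by (simp add: mult.commute complex_norm_square flip: of_real_power)

lemma sqrt_inner_C0: assumes F: "F \<in> C0 (edge_space n T)"
  shows "(\<lambda>x. of_real (sqrt (\<Sum>i = 1..n. (cmod (F (i, x)))\<^sup>2))) \<in> C0 T" (is "?r \<in> _")
proof (rule C0I)
  note I = inner_C0[OF F F, unfolded sum_cnj_mult_self]
  have "continuous_map T euclidean (\<lambda>x. complex_of_real (sqrt (cmod (of_real (\<Sum>i = 1..n. (cmod (F (i, x)))\<^sup>2)))))"
    using C0_cont[OF I] unfolding continuous_map_atin limitin_canonical_iff tendsto_of_real_iff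
    by (intro ballI tendsto_of_real tendsto_real_sqrt tendsto_norm) (erule (1) bspec)
  then show "continuous_map T euclidean ?r" by (simp only: norm_of_real) (simp add: abs_of_nonneg sum_nonneg)
  show "?r x = 0" if "x \<notin> topspace T" for x using C0_zero[OF I that] by (simp flip: of_real_sum of_real_power)
  fix e :: real assume e: "e > 0"
  obtain K where K: "compactin T K" "\<And>x. x \<notin> K \<Longrightarrow> cmod (of_real (\<Sum>i = 1..n. (cmod (F (i, x)))\<^sup>2)) < e\<^sup>2"
    using C0_small[OF I, of "e\<^sup>2"] e by auto
  have "cmod (?r x) < e" if "x \<notin> K" for x
    using K(2)[OF that] e unfolding norm_of_real by (simp add: sum_nonneg real_less_lsqrt)
  with K(1) show "\<exists>K. compactin T K \<and> (\<forall>x. x \<notin> K \<longrightarrow> cmod (?r x) < e)" by blast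
qed

definition column_norm where "column_norm n F = (SUP x. sqrt (\<Sum>i = 1..(n::nat). (cmod (F (i, x)))\<^sup>2))"

lemma sqrt_sup_norm_inner: assumes F: "F \<in> C0 (edge_space n T)"
  shows "sqrt (SUP x. cmod (\<Sum>i = 1..n. cnj (F (i, x)) * F (i, x))) = column_norm n F" (is "sqrt ?l = _")
proof -
  have "cstar_algebra (C0_algebra T)" by (rule C0_cstar_algebra)
  from cstar_algebra.cstar_identity[OF this, of "\<lambda>x. of_real (sqrt (\<Sum>i = 1..n. (cmod (F (i, x)))\<^sup>2))"]
  have "?l = (column_norm n F)\<^sup>2" unfolding sum_cnj_mult_self using sqrt_inner_C0[OF F]
    by (simp add: sum_nonneg column_norm_def norm_mult flip: of_real_sum of_real_power)
  moreover have "column_norm n F \<ge> 0" using C0_norm_ge0[OF sqrt_inner_C0[OF F]] by (simp add: column_norm_def sum_nonneg)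
  ultimately show ?thesis by simp
qed

lemma column_norm: assumes F: "F \<in> C0 (edge_space n T)"
  shows column_norm_ge0: "column_norm n F \<ge> 0" and column_norm_upper: "sqrt (\<Sum>i = 1..n. (cmod (F (i, x)))\<^sup>2) \<le> column_norm n F"
    and cmod_le_column_norm: "cmod (F p) \<le> column_norm n F"
proof -
  show 1: "column_norm n F \<ge> 0" using C0_norm_ge0[OF sqrt_inner_C0[OF F]] by (simp add: column_norm_def sum_nonneg)
  show 2: "sqrt (\<Sum>i = 1..n. (cmod (F (i, x)))\<^sup>2) \<le> column_norm n F" for x
    using C0_le_norm[OF sqrt_inner_C0[OF F], of x] by (simp add: column_norm_def sum_nonneg)
  show "cmod (F p) \<le> column_norm n F"
  proof (cases p)
    case (Pair i x)
    show ?thesis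
    proof (cases "i \<in> {1..n}")
      case True
      have "(cmod (F (i,x)))\<^sup>2 \<le> (\<Sum>i = 1..n. (cmod (F (i, x)))\<^sup>2)"
        by (rule member_le_sum[OF True, of "\<lambda>i. (cmod (F (i,x)))\<^sup>2"]) auto
      then show ?thesis using Pair 2[of x] real_le_rsqrt order_trans by blast
    next
      case False then show ?thesis using Pair C0_zero[OF F, of p] 1 by auto
    qed
  qed
qed

lemma hilbert_dist_eq: "hilbert_dist (C0_algebra T) (dyn_correspondence T n s) F G =
   (if F \<in> C0 (edge_space n T) \<and> G \<in> C0 (edge_space n T) then column_norm n (\<lambda>p. F p - G p) else 0)"
  using C0_minus[of "dyn_correspondence T n s" "edge_space n T" F G] sqrt_sup_norm_inner[OF C0_diff[of F "edge_space n T" G]]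
  by (simp add: hilbert_dist_def)

lemma column_norm_triangle:
  assumes "F \<in> C0 (edge_space n T)" "G \<in> C0 (edge_space n T)" shows "column_norm n (\<lambda>p. F p + G p) \<le> column_norm n F + column_norm n G"
  unfolding column_norm_def[of n "\<lambda>p. F p + G p"]
proof (rule cSUP_least)
  fix x
  have "L2_set (\<lambda>i. cmod (F (i,x) + G (i,x))) {1..n} \<le> L2_set (\<lambda>i. cmod (F (i,x)) + cmod (G (i,x))) {1..n}"
    by (rule L2_set_mono) (auto intro: norm_triangle_ineq)
  also have "\<dots> \<le> L2_set (\<lambda>i. cmod (F (i,x))) {1..n} + L2_set (\<lambda>i. cmod (G (i,x))) {1..n}"
    by (rule L2_set_triangle_ineq)
  also have "\<dots> \<le> column_norm n F + column_norm n G"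
    using column_norm_upper[OF assms(1), of x] column_norm_upper[OF assms(2), of x] by (simp add: L2_set_def)
  finally show "sqrt (\<Sum>i = 1..n. (cmod (F (i, x) + G (i, x)))\<^sup>2) \<le> column_norm n F + column_norm n G" by (simp add: L2_set_def)
qed auto

lemma column_norm_eq_0: assumes "F \<in> C0 (edge_space n T)" shows "column_norm n F = 0 \<longleftrightarrow> F = (\<lambda>p. 0)"
proof
  assume "column_norm n F = 0" then have "cmod (F p) \<le> 0" for p using cmod_le_column_norm[OF assms, of p] by simp
  then show "F = (\<lambda>p. 0)" by auto
qed (simp add: column_norm_def)

lemma hilbert_dist_Metric_space: "Metric_space (C0 (edge_space n T)) (hilbert_dist (C0_algebra T) (dyn_correspondence T n s))"
proof
  let ?d = "hilbert_dist (C0_algebra T) (dyn_correspondence T n s)"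
  fix x y z
  show "0 \<le> ?d x y" by (auto simp: hilbert_dist_eq intro!: column_norm_ge0 C0_diff)
  show "?d x y = ?d y x" by (simp add: hilbert_dist_eq column_norm_def norm_minus_commute)
  assume a: "x \<in> C0 (edge_space n T)" "y \<in> C0 (edge_space n T)"
  then show "?d x y = 0 \<longleftrightarrow> x = y"
    using column_norm_eq_0[OF C0_diff[of x _ y]] by (simp add: hilbert_dist_eq fun_eq_iff)
  assume "z \<in> C0 (edge_space n T)" with a show "?d x z \<le> ?d x y + ?d y z"
    using column_norm_triangle[of "\<lambda>t. x t - y t" n T "\<lambda>t. y t - z t"] by (simp add: hilbert_dist_eq C0_diff)
qed

lemma hilbert_dist_mcomplete: "Metric_space.mcomplete (C0 (edge_space n T)) (hilbert_dist (C0_algebra T) (dyn_correspondence T n s))"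
proof (rule mcompleteI[OF hilbert_dist_Metric_space])
  let ?d = "hilbert_dist (C0_algebra T) (dyn_correspondence T n s)"
  fix F :: "nat \<Rightarrow> _" assume F: "range F \<subseteq> C0 (edge_space n T)"
    and C: "\<And>e. e>0 \<Longrightarrow> \<exists>N. \<forall>m\<ge>N. \<forall>n\<ge>N. ?d (F m) (F n) < e"
  have [simp]: "F k \<in> C0 (edge_space n T)" for k using F by auto
  have "\<exists>N. \<forall>m\<ge>N. \<forall>n\<ge>N. \<forall>x. cmod (F m x - F n x) < e" if "e > 0" for e
  proof -
    have le: "cmod (F j x - F k x) \<le> ?d (F j) (F k)" for j k x
      using cmod_le_column_norm[OF C0_diff[of "F j" "edge_space n T" "F k"], of x] by (simp add: hilbert_dist_eq del: One_nat_def)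
    show ?thesis using C[OF that] by (meson le le_less_trans)
  qed
  then obtain G where G: "G \<in> C0 (edge_space n T)" "\<And>e. e > 0 \<Longrightarrow> \<exists>N. \<forall>n\<ge>N. \<forall>x. cmod (F n x - G x) < e"
    by (rule C0_unif_limit[of F "edge_space n T", rotated]) (auto simp del: One_nat_def)
  have "\<exists>N. \<forall>k\<ge>N. ?d (F k) G < e" if e: "e > 0" for e
  proof -
    define c where "c = e / (2 * (n + 1))"
    have c: "c > 0" using e by (simp add: c_def)
    obtain N where N: "\<And>k x. k \<ge> N \<Longrightarrow> cmod (F k x - G x) < c" using G(2)[OF c] by auto
    have "?d (F k) G \<le> n * c" if "k \<ge> N" for k
    proof -
      have "L2_set (\<lambda>i. cmod (F k (i,x) - G (i,x))) {1..n} \<le> (\<Sum>i=1..n. cmod (F k (i,x) - G (i,x)))" for x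
        by (rule L2_set_le_sum) auto
      also have "(\<Sum>i=1..n. cmod (F k (i,x) - G (i,x))) \<le> (\<Sum>i=1..n. c)" for x
        by (rule sum_mono) (use N[OF that] in \<open>auto intro: less_imp_le\<close>)
      finally have "sqrt (\<Sum>i = 1..n. (cmod (F k (i, x) - G (i, x)))\<^sup>2) \<le> n * c" for x by (simp add: L2_set_def)
      then show ?thesis using G(1) by (auto simp: hilbert_dist_eq column_norm_def intro!: cSUP_least simp del: One_nat_def)
    qed
    moreover have "n * c < e" using e by (simp add: c_def field_simps) (smt (verit) mult_nonneg_nonneg of_nat_0_le_iff)
    ultimately show ?thesis by (intro exI[of _ N]) (fastforce intro: le_less_trans)
  qed
  with G show "\<exists>G\<in>C0 (edge_space n T). \<forall>e>0. \<exists>N. \<forall>n\<ge>N. ?d (F n) G < e" by blast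
qed

lemma dyn_cstar_correspondence:
  assumes "multivariable_dynamical_system T n s"
  shows "cstar_correspondence (C0_algebra T) (dyn_correspondence T n s)"
proof -
  have s: "\<And>i. i \<in> {1..n} \<Longrightarrow> continuous_map T T (s i)" using assms by (auto simp: multivariable_dynamical_system_def)
  interpret A: cstar_algebra "C0_algebra T" by (rule C0_cstar_algebra)
  interpret X: Module.module complex_ring "dyn_correspondence T n s" by (rule C0_module[where T="edge_space n T"]) auto
  show ?thesis
  proof unfold_locales
    fix x assume "x \<in> carrier (dyn_correspondence T n s)"
    then have x: "x \<in> C0 (edge_space n T)" by simp
    show "\<exists>a\<in>carrier (C0_algebra T). inner_prod (dyn_correspondence T n s) x x =
             star (C0_algebra T) a \<otimes>\<^bsub>C0_algebra T\<^esub> a"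
    proof (rule bexI)
      show "(\<lambda>z. complex_of_real (sqrt (\<Sum>i = 1..n. (cmod (x (i, z)))\<^sup>2))) \<in> carrier (C0_algebra T)"
        using sqrt_inner_C0[OF x] by simp
      show "inner_prod (dyn_correspondence T n s) x x = star (C0_algebra T)
         (\<lambda>z. complex_of_real (sqrt (\<Sum>i = 1..n. (cmod (x (i, z)))\<^sup>2))) \<otimes>\<^bsub>C0_algebra T\<^esub>
         (\<lambda>z. complex_of_real (sqrt (\<Sum>i = 1..n. (cmod (x (i, z)))\<^sup>2)))"
        unfolding C0_algebra_simps dyn_correspondence_simps sum_cnj_mult_self complex_cnj_complex_of_real of_real_mult[symmetric]
          real_sqrt_mult_self by (simp add: sum_nonneg)
    qed
    show "inner_prod (dyn_correspondence T n s) x x = \<zero>\<^bsub>C0_algebra T\<^esub> \<longleftrightarrow> x = \<zero>\<^bsub>dyn_correspondence T n s\<^esub>"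
    proof -
      have "(\<lambda>z. \<Sum>i = 1..n. cnj (x (i, z)) * x (i, z)) = (\<lambda>z. 0) \<longleftrightarrow> column_norm n x = 0"
        unfolding C0_norm_eq_0[OF inner_C0[OF x x], symmetric] sqrt_sup_norm_inner[OF x, symmetric]
        by (rule real_sqrt_eq_0_iff[symmetric])
      then show ?thesis unfolding C0_algebra_simps dyn_correspondence_simps column_norm_eq_0[OF x] .
    qed
  next
    show "Metric_space.mcomplete (carrier (dyn_correspondence T n s)) (hilbert_dist (C0_algebra T) (dyn_correspondence T n s))"
      using hilbert_dist_mcomplete by simp
  qed (auto simp del: One_nat_def simp: lact_C0[OF _ _ continuous_map_id[unfolded id_def]] inner_C0[unfolded mult.commute[of "cnj _"]] algebra_simps sum.distrib sum_distrib_left sum_distrib_right fun_eq_iff intro!: lact_C0 s)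
qed

end

theory Submission
  imports Defs
begin

text \<open>
  Let \<open>A\<close> be the tensor algebra. Averaging over the gauge action, every \<open>c\<close> in \<open>A\<close> has bounded Fourier
  coefficients \<open>c\<^sub>w(x)\<close> for a path \<open>w\<close> starting at \<open>x\<close>, and they determine \<open>c\<close> by a Fejer argument. The gauge
  action exists because the universal algebra has a copy among the algebras that its universal
  property quantifies over. Since \<open>S(b)\<close> lies in the closed left ideal generated by \<open>b\<close>, every bounded
  functional that annihilates \<open>A b\<close> annihilates \<open>S(b)\<close>. It suffices to compare the coefficients of
  \<open>S(a b)\<close> and \<open>S(a) b\<close> for generators \<open>b\<close>. For \<open>b = \<pi>(f)\<close>, use that \<open>\<pi>(h f - f(x) h)\<close> has vanishing coefficients
  at \<open>x\<close>. For \<open>b = t(\<xi>)\<close> with \<open>\<xi>\<close> living on the edge \<open>j\<close> at \<open>x\<close>, there are two cases. If \<open>\<sigma>\<^sub>j(x) \<noteq> x\<close>, a combination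
  of coefficients at \<open>x\<close> and at \<open>\<sigma>\<^sub>j(x)\<close> annihilates the left ideal generated by an element \<open>t(\<xi>) + \<pi>(f)\<close>
  with \<open>f\<close> separating the two points. If \<open>\<sigma>\<^sub>j(x) = x\<close>, then for \<open>|z| < 1\<close> the power series
  \<open>\<Sum>k. z\<^sup>k c\<^bsub>j j ... j u\<^esub>(x)\<close> (with \<open>k\<close> loops \<open>j\<close> first) annihilates the left ideal generated by
  \<open>t(\<xi>) - z \<xi>(j, x) \<pi>(e)\<close> whenever \<open>e(x) = 1\<close>, so the wanted identity
  holds for all these power series, hence for their coefficients.
\<close>

section \<open>Banach algebras and closed subalgebras\<close>

text \<open>The elements multiplying \<open>a\<close> towards \<open>S a\<close> vary with
  \<open>a\<close>, so nothing ties \<open>S (a \<otimes> b)\<close> to \<open>S a\<close>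
  algebraically: all information comes from functionals that kill a principal left ideal.
  Coefficients are under control for right multiplication by generators, which is why paths are read
  from their source and why products are always built up on the right. At a moved point, functions
  separate \<open>x\<close> from \<open>\<sigma> j x\<close>, so two evaluations suffice. At a loop
  no function separates the two ends. There the passage from \<open>c\<close> to
  \<open>c \<otimes> t \<xi>\<close> shifts the sequence of coefficients along the loop by one
  place, which on generating functions is multiplication by a multiple of the variable; boundedness
  of the coefficients gives convergence on the open disc. This boundedness is what the C*-theory has
  to deliver. It is obtained without spectral theory, from contractivity of star homomorphisms and
  from a comparison of the norm of \<open>\<pi> g\<close> with the values of \<open>g\<close> on the
  hull of the kernel of \<open>\<pi>\<close>.\<close>

lemma complex_ring_simps [simp]:
  "carrier complex_ring = UNIV" "a \<otimes>\<^bsub>complex_ring\<^esub> b = a * b" "\<one>\<^bsub>complex_ring\<^esub> = 1"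
  "\<zero>\<^bsub>complex_ring\<^esub> = 0" "a \<oplus>\<^bsub>complex_ring\<^esub> b = a + b"
  by (simp_all add: complex_ring_def)

context banach_algebra
begin

lemma scale_closed [simp]: "x \<in> carrier B \<Longrightarrow> c \<odot> x \<in> carrier B"
  and scale_add_left: "x \<in> carrier B \<Longrightarrow> (c + d) \<odot> x = c \<odot> x \<oplus> d \<odot> x"
  and scale_add_right: "\<lbrakk>x \<in> carrier B; y \<in> carrier B\<rbrakk> \<Longrightarrow> c \<odot> (x \<oplus> y) = c \<odot> x \<oplus> c \<odot> y"
  and scale_scale [simp]: "x \<in> carrier B \<Longrightarrow> c \<odot> (d \<odot> x) = (c * d) \<odot> x"
  and scale_one [simp]: "x \<in> carrier B \<Longrightarrow> 1 \<odot> x = x"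
  and scale_zero_left [simp]: "x \<in> carrier B \<Longrightarrow> 0 \<odot> x = \<zero>"
  and scale_zero_right [simp]: "c \<odot> \<zero> = \<zero>"
  using M.smult_closed[of c x] M.smult_l_distr[of c d x] M.smult_r_distr[of c x y]
    M.smult_assoc1[of c d x] M.smult_one[of x] M.smult_l_null[of x] M.smult_r_null[of c]
  by auto

declare mult_closed [simp]

lemma uminus_eq_scale: assumes "x \<in> carrier B" shows "\<ominus> x = (-1) \<odot> x"
proof (rule M.minus_equality)
  show "(-1) \<odot> x \<oplus> x = \<zero>" using scale_add_left[of x "-1" 1] assms by simp
qed (use assms in auto)

lemma minus_eq_scale: "\<lbrakk>x \<in> carrier B; y \<in> carrier B\<rbrakk> \<Longrightarrow> x \<ominus> y = x \<oplus> (-1) \<odot> y"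
  by (simp add: M.minus_eq uminus_eq_scale)

lemma mult_zero_left [simp]: "x \<in> carrier B \<Longrightarrow> \<zero> \<otimes> x = \<zero>"
  using smult_mult_left[of \<zero> x 0] by simp

lemma mult_zero_right [simp]: "x \<in> carrier B \<Longrightarrow> x \<otimes> \<zero> = \<zero>"
  using smult_mult_right[of x \<zero> 0] by simp

lemma mult_minus_left: "\<lbrakk>x \<in> carrier B; y \<in> carrier B; z \<in> carrier B\<rbrakk> \<Longrightarrow> (x \<ominus> y) \<otimes> z = x \<otimes> z \<ominus> y \<otimes> z"
  and mult_minus_right: "\<lbrakk>x \<in> carrier B; y \<in> carrier B; z \<in> carrier B\<rbrakk> \<Longrightarrow> z \<otimes> (x \<ominus> y) = z \<otimes> x \<ominus> z \<otimes> y"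
  by (simp_all add: minus_eq_scale mult_distr_left mult_distr_right smult_mult_left smult_mult_right)

lemma scale_minus: "\<lbrakk>x \<in> carrier B; y \<in> carrier B\<rbrakk> \<Longrightarrow> c \<odot> (x \<ominus> y) = c \<odot> x \<ominus> c \<odot> y"
  by (simp add: minus_eq_scale scale_add_right mult.commute)

lemma add_minus_add: "\<lbrakk>x \<in> carrier B; y \<in> carrier B; u \<in> carrier B; v \<in> carrier B\<rbrakk>
    \<Longrightarrow> (x \<oplus> y) \<ominus> (u \<oplus> v) = (x \<ominus> u) \<oplus> (y \<ominus> v)"
  by (simp add: minus_eq_scale scale_add_right M.a_ac)

lemma minus_self [simp]: "x \<in> carrier B \<Longrightarrow> x \<ominus> x = \<zero>"
  by (simp add: M.minus_eq M.r_neg)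

lemma minus_zero [simp]: "x \<in> carrier B \<Longrightarrow> x \<ominus> \<zero> = x"
  by (simp add: minus_eq_scale)

lemma minus_add_cancel: "\<lbrakk>x \<in> carrier B; y \<in> carrier B\<rbrakk> \<Longrightarrow> (x \<ominus> y) \<oplus> y = x"
  by (simp add: M.minus_eq M.a_assoc M.l_neg)

lemma minus_add_minus: "\<lbrakk>x \<in> carrier B; y \<in> carrier B; z \<in> carrier B\<rbrakk> \<Longrightarrow> (x \<ominus> y) \<oplus> (y \<ominus> z) = x \<ominus> z"
  by (simp add: M.minus_eq M.a_assoc M.r_neg1)

lemma minus_eq_zero_iff: "\<lbrakk>x \<in> carrier B; y \<in> carrier B\<rbrakk> \<Longrightarrow> x \<ominus> y = \<zero> \<longleftrightarrow> x = y"
  by (metis M.l_zero minus_add_cancel minus_self)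

lemma vnorm_zero [simp]: "vnorm B \<zero> = 0"
  using vnorm_eq_zero[of \<zero>] by simp

lemma vnorm_nonneg [simp]: assumes "x \<in> carrier B" shows "0 \<le> vnorm B x"
proof -
  have "\<zero> = x \<oplus> (-1) \<odot> x" using assms scale_add_left[of x 1 "-1"] by simp
  then have "0 \<le> vnorm B x + vnorm B ((-1) \<odot> x)"
    using vnorm_triangle[of x "(-1) \<odot> x"] assms by (metis scale_closed vnorm_zero)
  then show ?thesis using assms by (simp add: vnorm_smult)
qed

lemma vnorm_minus_commute: "\<lbrakk>x \<in> carrier B; y \<in> carrier B\<rbrakk> \<Longrightarrow> vnorm B (x \<ominus> y) = vnorm B (y \<ominus> x)"
  using vnorm_smult[of "y \<ominus> x" "-1"] by (simp add: scale_minus) (simp add: minus_eq_scale M.a_comm)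

lemma vnorm_minus_le: "\<lbrakk>x \<in> carrier B; y \<in> carrier B\<rbrakk> \<Longrightarrow> vnorm B (x \<ominus> y) \<le> vnorm B x + vnorm B y"
  using vnorm_triangle[of x "(-1) \<odot> y"] by (simp add: minus_eq_scale vnorm_smult)

lemma vnorm_minus_triangle: "\<lbrakk>x \<in> carrier B; y \<in> carrier B; z \<in> carrier B\<rbrakk>
    \<Longrightarrow> vnorm B (x \<ominus> z) \<le> vnorm B (x \<ominus> y) + vnorm B (y \<ominus> z)"
  using vnorm_triangle[of "x \<ominus> y" "y \<ominus> z"] by (simp add: minus_add_minus)

lemma vnorm_le_add_minus: "\<lbrakk>x \<in> carrier B; y \<in> carrier B\<rbrakk> \<Longrightarrow> vnorm B x \<le> vnorm B y + vnorm B (x \<ominus> y)"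
  using vnorm_triangle[of "x \<ominus> y" y] by (simp add: minus_add_cancel)

lemma Metric_space_vdist: "Metric_space (carrier B) (vdist B)"
  by (rule banach_algebra_Metric_space) unfold_locales

lemma limitin_vtopology_iff: "limitin (vtopology B) X l sequentially \<longleftrightarrow>
   l \<in> carrier B \<and> (\<forall>e>0. \<exists>N. \<forall>n\<ge>N. X n \<in> carrier B \<and> vnorm B (X n \<ominus> l) < e)"
proof -
  interpret Metric_space "carrier B" "vdist B" by (rule Metric_space_vdist)
  have "(X n \<in> carrier B \<and> vdist B (X n) l < e) = (X n \<in> carrier B \<and> vnorm B (X n \<ominus> l) < e)"
    if "l \<in> carrier B" for n e using that by (auto simp: vdist_def)
  then show ?thesis unfolding limit_metric_sequentially by metis
qed

lemma Cauchy_convergent: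
  assumes X: "\<And>n. X n \<in> carrier B"
    and C: "\<And>e. e > 0 \<Longrightarrow> \<exists>N. \<forall>m\<ge>N. \<forall>n\<ge>N. vnorm B (X m \<ominus> X n) < e"
  obtains l where "l \<in> carrier B" "\<And>e. e > 0 \<Longrightarrow> \<exists>N. \<forall>n\<ge>(N::nat). vnorm B (X n \<ominus> l) < e"
proof -
  interpret Metric_space "carrier B" "vdist B" by (rule Metric_space_vdist)
  have "MCauchy X" unfolding MCauchy_def using X C by (auto simp: vdist_def)
  then obtain l where "limitin mtopology X l sequentially" using vcomplete mcomplete_def by blast
  then show ?thesis using that unfolding limitin_vtopology_iff by meson
qed

lemma closedin_vtopologyI:
  assumes "C \<subseteq> carrier B"
    and "\<And>x. x \<in> carrier B \<Longrightarrow> (\<And>e. e > 0 \<Longrightarrow> \<exists>y\<in>C. vnorm B (x \<ominus> y) < e) \<Longrightarrow> x \<in> C"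
  shows "closedin (vtopology B) C"
proof -
  interpret Metric_space "carrier B" "vdist B" by (rule Metric_space_vdist)
  have "l \<in> C" if X: "range X \<subseteq> C" and l: "limitin mtopology X l sequentially" for X l
  proof (rule assms(2))
    show lB: "l \<in> carrier B" using l limitin_vtopology_iff by blast
    fix e :: real assume "e > 0"
    then obtain n where "X n \<in> carrier B" "vnorm B (X n \<ominus> l) < e" using l limitin_vtopology_iff by blast
    then show "\<exists>y\<in>C. vnorm B (l \<ominus> y) < e" using X lB vnorm_minus_commute[of l "X n"] by (intro bexI[of _ "X n"]) auto
  qed
  then show ?thesis using assms(1) by (auto simp: metric_closedin_iff_sequentially_closed)
qed

lemma closedin_vtopologyD:
  assumes "closedin (vtopology B) C" "x \<in> carrier B" "\<And>e. e > 0 \<Longrightarrow> \<exists>y\<in>C. vnorm B (x \<ominus> y) < e"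
  shows "x \<in> C"
proof -
  interpret Metric_space "carrier B" "vdist B" by (rule Metric_space_vdist)
  have sub: "C \<subseteq> carrier B" using closedin_subset[OF assms(1)] by simp
  have "\<forall>n. \<exists>y\<in>C. vnorm B (x \<ominus> y) < inverse (real (Suc n))" using assms(3) by simp
  then obtain X where X: "\<And>n. X n \<in> C" "\<And>n. vnorm B (x \<ominus> X n) < inverse (real (Suc n))" by metis
  have "limitin mtopology X x sequentially" unfolding limitin_vtopology_iff
  proof (intro conjI allI impI assms(2))
    fix e :: real assume "e > 0"
    then obtain N where N: "inverse (real (Suc N)) < e" using reals_Archimedean by blast
    have "vnorm B (X n \<ominus> x) < e" if "n \<ge> N" for n
    proof -
      have "vnorm B (X n \<ominus> x) = vnorm B (x \<ominus> X n)"
        using sub X(1)[of n] assms(2) by (intro vnorm_minus_commute) auto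
      also have "\<dots> < inverse (real (Suc n))" by (rule X(2))
      also have "\<dots> \<le> inverse (real (Suc N))" using that by simp
      finally show ?thesis using N by simp
    qed
    then show "\<exists>N. \<forall>n\<ge>N. X n \<in> carrier B \<and> vnorm B (X n \<ominus> x) < e" using X(1) sub by blast
  qed
  then show ?thesis using assms(1) X(1) unfolding metric_closedin_iff_sequentially_closed by blast
qed

lemma closed_subalgebraI:
  assumes "C \<subseteq> carrier B" "\<zero> \<in> C"
    and "\<And>x y. x \<in> C \<Longrightarrow> y \<in> C \<Longrightarrow> x \<oplus> y \<in> C" "\<And>x y. x \<in> C \<Longrightarrow> y \<in> C \<Longrightarrow> x \<otimes> y \<in> C"
    and "\<And>c x. x \<in> C \<Longrightarrow> c \<odot> x \<in> C"
    and "\<And>x. x \<in> carrier B \<Longrightarrow> (\<And>e. e > 0 \<Longrightarrow> \<exists>y\<in>C. vnorm B (x \<ominus> y) < e) \<Longrightarrow> x \<in> C"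
  shows "closed_subalgebra B C"
  unfolding closed_subalgebra_def using assms closedin_vtopologyI[OF assms(1)] by blast

lemma closed_subalgebraD:
  assumes "closed_subalgebra B C"
  shows "C \<subseteq> carrier B" "\<zero> \<in> C"
    and "x \<in> C \<Longrightarrow> y \<in> C \<Longrightarrow> x \<oplus> y \<in> C" "x \<in> C \<Longrightarrow> y \<in> C \<Longrightarrow> x \<otimes> y \<in> C"
    and "x \<in> C \<Longrightarrow> c \<odot> x \<in> C" "x \<in> C \<Longrightarrow> y \<in> C \<Longrightarrow> x \<ominus> y \<in> C"
    and "x \<in> carrier B \<Longrightarrow> (\<And>e. e > 0 \<Longrightarrow> \<exists>y\<in>C. vnorm B (x \<ominus> y) < e) \<Longrightarrow> x \<in> C"
proof -
  interpret Metric_space "carrier B" "vdist B" by (rule Metric_space_vdist)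
  show 1: "C \<subseteq> carrier B" using assms closedin_subset by (fastforce simp: closed_subalgebra_def)
  show "\<zero> \<in> C" "x \<in> C \<Longrightarrow> y \<in> C \<Longrightarrow> x \<oplus> y \<in> C" "x \<in> C \<Longrightarrow> y \<in> C \<Longrightarrow> x \<otimes> y \<in> C"
    "x \<in> C \<Longrightarrow> c \<odot> x \<in> C"
    using assms by (auto simp: closed_subalgebra_def)
  show "x \<in> C \<Longrightarrow> y \<in> C \<Longrightarrow> x \<ominus> y \<in> C" using assms 1
    by (subst minus_eq_scale) (auto simp: closed_subalgebra_def)
  show "x \<in> carrier B \<Longrightarrow> (\<And>e. e > 0 \<Longrightarrow> \<exists>y\<in>C. vnorm B (x \<ominus> y) < e) \<Longrightarrow> x \<in> C"
    using assms closedin_vtopologyD unfolding closed_subalgebra_def by blast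
qed

lemma closed_subalgebra_carrier: "closed_subalgebra B (carrier B)"
  by (rule closed_subalgebraI) auto

lemma closed_subalgebra_hull:
  assumes "G \<subseteq> carrier B" shows "closed_subalgebra B (closed_subalgebra B hull G)"
proof -
  have sub: "closed_subalgebra B hull G \<subseteq> carrier B"
    using closed_subalgebra_carrier assms by (rule hull_minimal[rotated])
  show ?thesis
  proof (rule closed_subalgebraI[OF sub])
    fix x assume x: "x \<in> carrier B" "\<And>e. e > 0 \<Longrightarrow> \<exists>y\<in>closed_subalgebra B hull G. vnorm B (x \<ominus> y) < e"
    show "x \<in> closed_subalgebra B hull G" unfolding hull_def
    proof (safe)
      fix C assume "closed_subalgebra B C" "G \<subseteq> C"
      then show "x \<in> C" using x closed_subalgebraD(7)[of C x] hull_minimal[of G C "closed_subalgebra B"] by blast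
    qed
  qed (auto simp: hull_def dest: closed_subalgebraD)
qed

end

context cstar_algebra
begin

declare star_closed [simp] star_star [simp]

lemma star_zero [simp]: "star B \<zero> = \<zero>"
  using star_smult[of \<zero> 0] by simp

lemma star_minus: "\<lbrakk>x \<in> carrier B; y \<in> carrier B\<rbrakk> \<Longrightarrow> star B (x \<ominus> y) = star B x \<ominus> star B y"
  by (simp add: minus_eq_scale star_add star_smult)

lemma vnorm_star [simp]: assumes "x \<in> carrier B" shows "vnorm B (star B x) = vnorm B x"
proof -
  have *: "vnorm B y \<le> vnorm B (star B y)" if y: "y \<in> carrier B" for y
  proof (cases "vnorm B y = 0")
    case False
    have "vnorm B y * vnorm B y \<le> vnorm B (star B y) * vnorm B y"
      using cstar_identity[OF y] vnorm_mult[of "star B y" y] y by (simp add: power2_eq_square)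
    then show ?thesis using False vnorm_nonneg[OF y] by (simp add: mult_le_cancel_right)
  qed (use y in simp)
  show ?thesis using *[of x] *[of "star B x"] assms by simp
qed

lemma eq_zero_if_star_mult: "x \<in> carrier B \<Longrightarrow> star B x \<otimes> x = \<zero> \<Longrightarrow> x = \<zero>"
  using cstar_identity[of x] vnorm_eq_zero[of x] by simp

end

lemma linear_onD:
  assumes "linear_on V W f"
  shows "x \<in> carrier V \<Longrightarrow> f x \<in> carrier W"
    and "x \<in> carrier V \<Longrightarrow> y \<in> carrier V \<Longrightarrow> f (x \<oplus>\<^bsub>V\<^esub> y) = f x \<oplus>\<^bsub>W\<^esub> f y"
    and "x \<in> carrier V \<Longrightarrow> f (c \<odot>\<^bsub>V\<^esub> x) = c \<odot>\<^bsub>W\<^esub> f x"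
  using assms by (auto simp: linear_on_def)

lemma star_homD:
  assumes "star_hom A B f"
  shows "x \<in> carrier A \<Longrightarrow> f x \<in> carrier B"
    and "x \<in> carrier A \<Longrightarrow> y \<in> carrier A \<Longrightarrow> f (x \<oplus>\<^bsub>A\<^esub> y) = f x \<oplus>\<^bsub>B\<^esub> f y"
    and "x \<in> carrier A \<Longrightarrow> f (c \<odot>\<^bsub>A\<^esub> x) = c \<odot>\<^bsub>B\<^esub> f x"
    and "x \<in> carrier A \<Longrightarrow> y \<in> carrier A \<Longrightarrow> f (x \<otimes>\<^bsub>A\<^esub> y) = f x \<otimes>\<^bsub>B\<^esub> f y"
    and "x \<in> carrier A \<Longrightarrow> f (star A x) = star B (f x)"
  using assms by (auto simp: star_hom_def linear_on_def)

context banach_algebra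
begin

lemma vnorm_mult_minus_mult:
  assumes "x \<in> carrier B" "y \<in> carrier B" "u \<in> carrier B" "v \<in> carrier B"
  shows "vnorm B (x \<otimes> y \<ominus> u \<otimes> v) \<le> vnorm B (x \<ominus> u) * vnorm B y + vnorm B u * vnorm B (y \<ominus> v)"
proof -
  have "vnorm B (x \<otimes> y \<ominus> u \<otimes> v) \<le> vnorm B (x \<otimes> y \<ominus> u \<otimes> y) + vnorm B (u \<otimes> y \<ominus> u \<otimes> v)"
    using assms by (intro vnorm_minus_triangle) auto
  also have "\<dots> = vnorm B ((x \<ominus> u) \<otimes> y) + vnorm B (u \<otimes> (y \<ominus> v))"
    using assms by (simp add: mult_minus_left mult_minus_right)
  also have "\<dots> \<le> vnorm B (x \<ominus> u) * vnorm B y + vnorm B u * vnorm B (y \<ominus> v)"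
    using assms by (intro add_mono vnorm_mult) auto
  finally show ?thesis .
qed

lemma eq_if_vnorm_minus_le:
  assumes "x \<in> carrier B" "y \<in> carrier B" "\<And>e. e > 0 \<Longrightarrow> vnorm B (x \<ominus> y) \<le> K * e"
  shows "x = y"
proof -
  have "vnorm B (x \<ominus> y) \<le> 0"
  proof (rule field_le_epsilon)
    fix e :: real assume e: "e > 0"
    have "vnorm B (x \<ominus> y) \<le> K * (e / (\<bar>K\<bar> + 1))" using e by (intro assms(3)) auto
    also have "\<dots> \<le> (\<bar>K\<bar> + 1) * (e / (\<bar>K\<bar> + 1))" using e by (intro mult_right_mono) auto
    also have "\<dots> = e" by (simp add: add_nonneg_eq_0_iff)
    finally show "vnorm B (x \<ominus> y) \<le> 0 + e" by simp
  qed
  then show ?thesis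
    using assms(1,2) by (metis antisym M.minus_closed vnorm_nonneg vnorm_eq_zero minus_eq_zero_iff)
qed

section \<open>Norm closures of subspaces and subalgebras\<close>

definition vclosure :: "'b set \<Rightarrow> 'b set" where
  "vclosure D = {x \<in> carrier B. \<forall>e>0. \<exists>d\<in>D. vnorm B (x \<ominus> d) < e}"

lemma vclosure_subset: "vclosure D \<subseteq> carrier B"
  by (auto simp: vclosure_def)

lemma vclosure_carrier: "x \<in> vclosure D \<Longrightarrow> x \<in> carrier B"
  by (auto simp: vclosure_def)

lemma vclosureD: "x \<in> vclosure D \<Longrightarrow> e > 0 \<Longrightarrow> \<exists>d\<in>D. vnorm B (x \<ominus> d) < e"
  by (auto simp: vclosure_def)

lemma subset_vclosure: assumes "D \<subseteq> carrier B" shows "D \<subseteq> vclosure D"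
proof
  fix x assume "x \<in> D"
  then show "x \<in> vclosure D" unfolding vclosure_def using assms by (auto intro!: bexI[of _ x])
qed

lemma vclosure_closed:
  assumes "D \<subseteq> carrier B" "x \<in> carrier B" "\<And>e. e > 0 \<Longrightarrow> \<exists>y\<in>vclosure D. vnorm B (x \<ominus> y) < e"
  shows "x \<in> vclosure D"
  unfolding vclosure_def
proof (intro CollectI conjI allI impI assms(2))
  fix e :: real assume "e > 0"
  then obtain y where y: "y \<in> vclosure D" "vnorm B (x \<ominus> y) < e/2" using assms(3)[of "e/2"] by auto
  then obtain d where d: "d \<in> D" "vnorm B (y \<ominus> d) < e/2"
    using \<open>e > 0\<close> vclosureD[OF y(1), of "e/2"] by auto
  have "y \<in> carrier B" "d \<in> carrier B" using y d assms(1) vclosure_carrier by auto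
  then have "vnorm B (x \<ominus> d) < e" using vnorm_minus_triangle[of x y d] y d assms(2) by auto
  then show "\<exists>d\<in>D. vnorm B (x \<ominus> d) < e" using d by blast
qed

text \<open>Only distances from the fixed point \<open>x\<close> to points of \<open>D\<close>
  enter, so conjugate-linear maps such as \<open>star\<close> and multiplications by a fixed element
  are covered alike.\<close>

lemma vclosure_bounded_image:
  assumes D: "D \<subseteq> carrier B" and E: "E \<subseteq> carrier B"
    and f: "\<And>d. d \<in> D \<Longrightarrow> f d \<in> E" "f x \<in> carrier B"
    and b: "\<And>d. d \<in> D \<Longrightarrow> vnorm B (f x \<ominus> f d) \<le> K * vnorm B (x \<ominus> d)"
    and x: "x \<in> vclosure D"
  shows "f x \<in> vclosure E"
  unfolding vclosure_def
proof (intro CollectI conjI allI impI f(2))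
  fix e :: real assume e: "e > 0"
  then obtain d where d: "d \<in> D" "vnorm B (x \<ominus> d) < e / (\<bar>K\<bar> + 1)"
    using vclosureD[OF x, of "e / (\<bar>K\<bar> + 1)"] by (auto simp: add_nonneg_pos)
  have "x \<in> carrier B" "d \<in> carrier B" using x d D vclosure_carrier by auto
  then have nn: "0 \<le> vnorm B (x \<ominus> d)" by simp
  have "vnorm B (f x \<ominus> f d) \<le> K * vnorm B (x \<ominus> d)" by (rule b[OF d(1)])
  also have "\<dots> \<le> (\<bar>K\<bar> + 1) * vnorm B (x \<ominus> d)" using nn by (intro mult_right_mono) auto
  also have "\<dots> < e" using d(2) by (simp add: pos_less_divide_eq mult.commute)
  finally show "\<exists>d\<in>E. vnorm B (f x \<ominus> d) < e" using f(1)[OF d(1)] by blast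
qed

lemma vclosure_scale:
  assumes "D \<subseteq> carrier B" "\<And>x. x \<in> D \<Longrightarrow> c \<odot> x \<in> D" "x \<in> vclosure D"
  shows "c \<odot> x \<in> vclosure D"
proof -
  have "x \<in> carrier B" using assms(3) vclosure_carrier by auto
  then show ?thesis using assms
    by (intro vclosure_bounded_image[of D D "\<lambda>x. c \<odot> x" x "cmod c"])
      (auto simp: vnorm_smult subset_iff simp flip: scale_minus)
qed

lemma vclosure_add:
  assumes "D \<subseteq> carrier B" "\<And>x y. x \<in> D \<Longrightarrow> y \<in> D \<Longrightarrow> x \<oplus> y \<in> D" "x \<in> vclosure D" "y \<in> vclosure D"
  shows "x \<oplus> y \<in> vclosure D"
  unfolding vclosure_def
proof (intro CollectI conjI allI impI)
  show xy: "x \<oplus> y \<in> carrier B" using assms(3,4) vclosure_carrier by auto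
  fix e :: real assume "e > 0"
  then obtain d d' where d: "d \<in> D" "vnorm B (x \<ominus> d) < e/2" "d' \<in> D" "vnorm B (y \<ominus> d') < e/2"
    using vclosureD[OF assms(3), of "e/2"] vclosureD[OF assms(4), of "e/2"] by auto
  have c: "x \<in> carrier B" "y \<in> carrier B" "d \<in> carrier B" "d' \<in> carrier B" using assms d vclosure_carrier by auto
  then have "vnorm B ((x \<oplus> y) \<ominus> (d \<oplus> d')) < e"
    using vnorm_triangle[of "x \<ominus> d" "y \<ominus> d'"] d by (simp add: add_minus_add)
  then show "\<exists>d\<in>D. vnorm B (x \<oplus> y \<ominus> d) < e" using assms(2)[OF d(1,3)] by blast
qed

lemma vclosure_vclosure: "D \<subseteq> carrier B \<Longrightarrow> x \<in> vclosure (vclosure D) \<Longrightarrow> x \<in> vclosure D"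
  by (rule vclosure_closed) (auto simp: vclosure_def)

lemma vclosure_mult:
  assumes D: "D \<subseteq> carrier B" "\<And>x y. x \<in> D \<Longrightarrow> y \<in> D \<Longrightarrow> x \<otimes> y \<in> D"
    and x: "x \<in> vclosure D" and y: "y \<in> vclosure D"
  shows "x \<otimes> y \<in> vclosure D"
proof -
  have c: "x \<in> carrier B" "y \<in> carrier B" using x y vclosure_carrier by auto
  have 1: "x \<otimes> d \<in> vclosure D" if d: "d \<in> D" for d
  proof (rule vclosure_bounded_image[OF D(1) D(1) _ _ _ x])
    show "vnorm B (x \<otimes> d \<ominus> d' \<otimes> d) \<le> vnorm B d * vnorm B (x \<ominus> d')" if "d' \<in> D" for d'
      using vnorm_mult[of "x \<ominus> d'" d] mult_minus_left[of x d' d] c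
        subsetD[OF D(1) that] subsetD[OF D(1) d] by (simp add: mult.commute)
  qed (use D c d in auto)
  \<comment> \<open>Approximating the two factors one after the other costs a second closure, which
    \<open>vclosure_vclosure\<close> removes.\<close>
  have "x \<otimes> y \<in> vclosure (vclosure D)"
  proof (rule vclosure_bounded_image[OF D(1) vclosure_subset 1 _ _ y])
    show "vnorm B (x \<otimes> y \<ominus> x \<otimes> d) \<le> vnorm B x * vnorm B (y \<ominus> d)" if "d \<in> D" for d
      using vnorm_mult[of x "y \<ominus> d"] mult_minus_right[of y d x] c
        subsetD[OF D(1) that] by simp
  qed (use c in auto)
  then show ?thesis by (rule vclosure_vclosure[OF D(1)])
qed

lemma closed_subalgebra_vclosure:
  assumes "D \<subseteq> carrier B" "\<zero> \<in> D" "\<And>x y. x \<in> D \<Longrightarrow> y \<in> D \<Longrightarrow> x \<oplus> y \<in> D"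
    "\<And>x y. x \<in> D \<Longrightarrow> y \<in> D \<Longrightarrow> x \<otimes> y \<in> D" "\<And>c x. x \<in> D \<Longrightarrow> c \<odot> x \<in> D"
  shows "closed_subalgebra B (vclosure D)"
proof (rule closed_subalgebraI[OF vclosure_subset])
  show "\<zero> \<in> vclosure D" using subset_vclosure assms(1,2) by blast
qed (use assms in \<open>auto intro: vclosure_add vclosure_mult vclosure_scale vclosure_closed\<close>)

end

section \<open>C*-algebras and contractivity of *-homomorphisms\<close>

context cstar_algebra
begin

lemma closed_star_subalgebra_vclosure:
  assumes "D \<subseteq> carrier B" "\<zero> \<in> D" "\<And>x y. x \<in> D \<Longrightarrow> y \<in> D \<Longrightarrow> x \<oplus> y \<in> D"
    "\<And>x y. x \<in> D \<Longrightarrow> y \<in> D \<Longrightarrow> x \<otimes> y \<in> D" "\<And>c x. x \<in> D \<Longrightarrow> c \<odot> x \<in> D"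
    "\<And>x. x \<in> D \<Longrightarrow> star B x \<in> D"
  shows "closed_star_subalgebra B (vclosure D)"
  unfolding closed_star_subalgebra_def
proof (intro conjI ballI closed_subalgebra_vclosure assms)
  fix x assume x: "x \<in> vclosure D"
  then have "x \<in> carrier B" using vclosure_carrier by auto
  then show "star B x \<in> vclosure D" using x assms(1,6)
    by (intro vclosure_bounded_image[of D D "star B" x 1]) (auto simp: subset_iff simp flip: star_minus)
qed auto

text \<open>An element \<open>w\<close> with this property is one for which \<open>1 + w\<close> is an isometry in the unitization.\<close>

lemma vnorm_isometry:
  assumes "w \<in> carrier B" "b \<in> carrier B" "w \<oplus> star B w \<oplus> star B w \<otimes> w = \<zero>"
  shows "vnorm B (b \<oplus> w \<otimes> b) = vnorm B b"
proof -
  have "star B (b \<oplus> w \<otimes> b) \<otimes> (b \<oplus> w \<otimes> b)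
      = star B b \<otimes> b \<oplus> star B b \<otimes> ((w \<oplus> star B w \<oplus> star B w \<otimes> w) \<otimes> b)"
    using assms(1,2) by (simp add: star_add star_mult mult_distr_left mult_distr_right mult_assoc M.a_ac)
  also have "\<dots> = star B b \<otimes> b" using assms by simp
  finally have "(vnorm B (b \<oplus> w \<otimes> b))\<^sup>2 = (vnorm B b)\<^sup>2"
    using cstar_identity[of "b \<oplus> w \<otimes> b"] cstar_identity[of b] assms(1,2) by simp
  then show ?thesis using assms(1,2) by (simp add: power2_eq_iff_nonneg)
qed

text \<open>The element \<open>1 - v\<close> of the unitization is the square root of \<open>1 - y\<^sup>2\<close>, so that \<open>y\<close> is the imaginary part
  of the unitary \<open>(1 - v) + i y\<close>. These relations survive *-homomorphisms, which are therefore contractive.\<close>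

lemma vnorm_le_one_if_half_sqrt:
  assumes y: "y \<in> carrier B" "star B y = y" and v: "v \<in> carrier B" "star B v = v"
    and eq: "v \<oplus> v = y \<otimes> y \<oplus> v \<otimes> v" and comm: "y \<otimes> v = v \<otimes> y"
  shows "vnorm B y \<le> 1"
proof -
  \<comment> \<open>For c = i and c = -i these are the two unitaries (1 - v) + i y and (1 - v) - i y
    of the unitization, applied to \<open>y\<close> in place of the unit.\<close>
  have iso: "vnorm B (y \<oplus> (c \<odot> y \<ominus> v) \<otimes> y) = vnorm B y" if c: "cnj c = - c" "c * c = -1" for c
  proof (rule vnorm_isometry)
    have "star B (c \<odot> y \<ominus> v) \<otimes> (c \<odot> y \<ominus> v) = (- c * c) \<odot> (y \<otimes> y) \<oplus> v \<otimes> v"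
    proof -
      have "star B (c \<odot> y \<ominus> v) \<otimes> (c \<odot> y \<ominus> v) = (- c * c) \<odot> (y \<otimes> y) \<oplus> v \<otimes> v
        \<oplus> (c \<odot> (y \<otimes> v) \<oplus> (-c) \<odot> (y \<otimes> v))"
        using y v c by (simp add: star_add star_smult minus_eq_scale mult_distr_left mult_distr_right scale_add_right
          smult_mult_left smult_mult_right comm M.a_ac)
      also have "c \<odot> (y \<otimes> v) \<oplus> (-c) \<odot> (y \<otimes> v) = \<zero>"
        using scale_add_left[of "y \<otimes> v" c "-c"] y v by simp
      finally show ?thesis using y v by simp
    qed
    then have 1: "star B (c \<odot> y \<ominus> v) \<otimes> (c \<odot> y \<ominus> v) = v \<oplus> v" using c eq y v by simp
    have "(c \<odot> y \<ominus> v) \<oplus> star B (c \<odot> y \<ominus> v)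
       = (c \<odot> y \<oplus> (-c) \<odot> y) \<oplus> ((-1) \<odot> v \<oplus> (-1) \<odot> v)"
      using y v c by (simp add: star_add star_smult minus_eq_scale M.a_ac)
    also have "c \<odot> y \<oplus> (-c) \<odot> y = \<zero>" using scale_add_left[of y c "-c"] y by simp
    finally have 2: "(c \<odot> y \<ominus> v) \<oplus> star B (c \<odot> y \<ominus> v) = (-1) \<odot> (v \<oplus> v)"
      using v by (simp add: scale_add_right)
    show "c \<odot> y \<ominus> v \<oplus> star B (c \<odot> y \<ominus> v) \<oplus> star B (c \<odot> y \<ominus> v) \<otimes> (c \<odot> y \<ominus> v) = \<zero>"
      unfolding 1 2 using v scale_add_left[of "v \<oplus> v" "-1" 1] by simp
  qed (use y v in auto)
  \<comment> \<open>The two unitaries differ by 2 i y; applied to \<open>y\<close>, this gives that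
    twice the square of the norm of \<open>y\<close> is at most twice the norm.\<close>
  have "(\<i> \<odot> y \<ominus> v) \<ominus> ((-\<i>) \<odot> y \<ominus> v) = (\<i> \<odot> y \<ominus> (-\<i>) \<odot> y) \<oplus> ((-1) \<odot> v \<ominus> (-1) \<odot> v)"
    using y v by (subst add_minus_add[symmetric]) (auto simp: minus_eq_scale)
  also have "\<dots> = (2 * \<i>) \<odot> y" using y v scale_add_left[of y \<i> \<i>] by (simp add: minus_eq_scale[of _ "(-\<i>) \<odot> y"])
  finally have "((\<i> \<odot> y \<ominus> v) \<ominus> ((-\<i>) \<odot> y \<ominus> v)) \<otimes> y = (2 * \<i>) \<odot> (y \<otimes> y)"
    using y by (simp add: smult_mult_left)
  then have "(y \<oplus> (\<i> \<odot> y \<ominus> v) \<otimes> y) \<ominus> (y \<oplus> ((-\<i>) \<odot> y \<ominus> v) \<otimes> y) = (2 * \<i>) \<odot> (y \<otimes> y)"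
    using y v by (simp add: add_minus_add mult_minus_left)
  then have "vnorm B ((2 * \<i>) \<odot> (y \<otimes> y)) \<le> vnorm B y + vnorm B y"
    using vnorm_minus_le[of "y \<oplus> (\<i> \<odot> y \<ominus> v) \<otimes> y" "y \<oplus> ((-\<i>) \<odot> y \<ominus> v) \<otimes> y"]
      iso[of \<i>] iso[of "-\<i>"] y v by simp
  then have "vnorm B y * vnorm B y \<le> vnorm B y * 1"
    using cstar_identity[of y] y by (simp add: vnorm_smult norm_mult power2_eq_square)
  then show ?thesis using mult_strict_left_mono[of 1 "vnorm B y" "vnorm B y"] by linarith
qed

text \<open>Fixed point iteration for v = (y^2 + v^2) / 2. The iterates start at zero, hence are
  polynomials in \<open>y\<close> with real coefficients and no constant term: they are
  self-adjoint, commute with \<open>y\<close> and stay in an algebra without unit.\<close>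

lemma exists_half_sqrt:
  assumes y: "y \<in> carrier B" "star B y = y" "vnorm B y < 1"
  obtains v where "v \<in> carrier B" "star B v = v" "v \<oplus> v = y \<otimes> y \<oplus> v \<otimes> v" "y \<otimes> v = v \<otimes> y"
proof -
  define G where "G v = (1/2) \<odot> (y \<otimes> y \<oplus> v \<otimes> v)" for v
  \<comment> \<open>\<open>r\<close> is the smaller root of r = (q + r^2) / 2, where q is the
    squared norm of \<open>y\<close>: the ball of radius \<open>r\<close> is invariant under
    \<open>G\<close>, and \<open>G\<close> contracts there by the factor r < 1.\<close>
  define r where "r = 1 - sqrt (1 - (vnorm B y)\<^sup>2)"
  have q: "(vnorm B y)\<^sup>2 < 1" using y by (simp add: abs_square_less_1)
  have r: "0 \<le> r" "r < 1" "(vnorm B y)\<^sup>2 + r\<^sup>2 = 2 * r"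
    using q by (auto simp: r_def power2_diff)
  have GB: "G v \<in> carrier B" if "v \<in> carrier B" for v using that y by (simp add: G_def)
  have Gdiff: "vnorm B (G v \<ominus> G u) \<le> 1/2 * ((vnorm B u + vnorm B v) * vnorm B (v \<ominus> u))"
    if "v \<in> carrier B" "u \<in> carrier B" for u v
  proof -
    have "G v \<ominus> G u = (1/2) \<odot> (v \<otimes> v \<ominus> u \<otimes> u)"
      using that y by (simp add: G_def scale_minus[symmetric] add_minus_add)
    then show ?thesis using vnorm_mult_minus_mult[of v v u u] that by (simp add: vnorm_smult algebra_simps)
  qed
  define V where "V n = (G ^^ n) \<zero>" for n
  have VS: "V (Suc n) = G (V n)" for n by (simp add: V_def)
  have V: "V n \<in> carrier B \<and> vnorm B (V n) \<le> r" for n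
  proof (induction n)
    case (Suc n)
    have "vnorm B (G (V n)) \<le> 1/2 * (vnorm B y * vnorm B y + vnorm B (V n) * vnorm B (V n))"
      using vnorm_triangle[of "y \<otimes> y" "V n \<otimes> V n"] vnorm_mult[of y y] vnorm_mult[of "V n" "V n"] Suc y
      by (simp add: G_def vnorm_smult)
    also have "\<dots> \<le> 1/2 * ((vnorm B y)\<^sup>2 + r\<^sup>2)"
      using Suc mult_mono[of "vnorm B (V n)" r "vnorm B (V n)" r] r by (simp add: power2_eq_square)
    finally show ?case using Suc GB r by (simp add: VS)
  qed (use r in \<open>simp add: V_def\<close>)
  then have VB [simp]: "V n \<in> carrier B" for n by blast
  have VC: "vnorm B (V (n + k) \<ominus> V n) \<le> r ^ n" for n k
  proof (induction n)
    case 0 show ?case using V[of k] r by (simp add: V_def)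
  next
    case (Suc n)
    have "vnorm B (V (Suc n + k) \<ominus> V (Suc n)) \<le> 1/2 * ((vnorm B (V n) + vnorm B (V (n + k))) * vnorm B (V (n + k) \<ominus> V n))"
      using Gdiff[of "V (n + k)" "V n"] by (simp add: VS)
    also have "\<dots> \<le> 1/2 * ((r + r) * r ^ n)"
      using V Suc r by (intro mult_left_mono mult_mono add_mono) auto
    finally show ?case by simp
  qed
  obtain v where v: "v \<in> carrier B" "\<And>e. e > 0 \<Longrightarrow> \<exists>N. \<forall>n\<ge>N. vnorm B (V n \<ominus> v) < e"
  proof (rule Cauchy_convergent[of V])
    fix e :: real assume e: "e > 0"
    obtain N where N: "r ^ N < e / 2" using real_arch_pow_inv[of "e/2" r] e r by auto
    have "vnorm B (V m \<ominus> V N) < e/2" if "m \<ge> N" for m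
      using VC[of N "m - N"] N that by simp
    then have "vnorm B (V m \<ominus> V n) < e" if "m \<ge> N" "n \<ge> N" for m n
      using vnorm_minus_triangle[of "V m" "V N" "V n"] vnorm_minus_commute[of "V N" "V n"] that
      by (smt (verit) VB field_sum_of_halves)
    then show "\<exists>N. \<forall>m\<ge>N. \<forall>n\<ge>N. vnorm B (V m \<ominus> V n) < e" by blast
  qed auto
  have close: "\<exists>n. vnorm B (V n \<ominus> v) \<le> e \<and> vnorm B (V (Suc n) \<ominus> v) \<le> e" if "e > 0" for e
    using v(2)[OF that] by (meson le_Suc_eq less_imp_le order_refl)
  have Vstar: "star B (V n) = V n" for n
  proof (induction n)
    case (Suc n)
    then show ?case using y by (simp add: VS G_def star_smult star_add star_mult)
  qed (simp add: V_def)
  have Vcomm: "y \<otimes> V n = V n \<otimes> y" for n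
  proof (induction n)
    case (Suc n)
    have "y \<otimes> (V n \<otimes> V n) = (V n \<otimes> V n) \<otimes> y"
      using Suc y by (metis VB mult_assoc)
    then show ?case using y by (simp add: VS G_def smult_mult_left smult_mult_right mult_distr_left mult_distr_right mult_assoc)
  qed (use y in \<open>simp add: V_def\<close>)
  show ?thesis
  proof (rule that[OF v(1)])
    show "star B v = v"
    proof (rule eq_if_vnorm_minus_le[where K=2])
      fix e :: real assume "e > 0"
      then obtain n where n: "vnorm B (V n \<ominus> v) \<le> e" using close by blast
      have "vnorm B (star B v \<ominus> v) \<le> vnorm B (star B v \<ominus> V n) + vnorm B (V n \<ominus> v)"
        using v by (intro vnorm_minus_triangle) auto
      also have "star B v \<ominus> V n = star B (v \<ominus> V n)" using v Vstar by (simp add: star_minus)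
      finally show "vnorm B (star B v \<ominus> v) \<le> 2 * e" using n v vnorm_minus_commute[of v "V n"] by simp
    qed (use v in auto)
    show "y \<otimes> v = v \<otimes> y"
    proof (rule eq_if_vnorm_minus_le[where K=2])
      fix e :: real assume e: "e > 0"
      then obtain n where n: "vnorm B (V n \<ominus> v) \<le> e" using close by blast
      have "vnorm B (y \<otimes> v \<ominus> v \<otimes> y) \<le> vnorm B (y \<otimes> v \<ominus> y \<otimes> V n) + vnorm B (y \<otimes> V n \<ominus> v \<otimes> y)"
        using v y by (intro vnorm_minus_triangle) auto
      also have "\<dots> = vnorm B (y \<otimes> (v \<ominus> V n)) + vnorm B ((V n \<ominus> v) \<otimes> y)"
        using v y by (simp add: Vcomm mult_minus_left mult_minus_right)
      also have "\<dots> \<le> vnorm B y * vnorm B (v \<ominus> V n) + vnorm B (V n \<ominus> v) * vnorm B y"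
        using v y by (intro add_mono vnorm_mult) auto
      also have "\<dots> \<le> 1 * e + e * 1"
        using n v y vnorm_minus_commute[of v "V n"] e by (intro add_mono mult_mono) auto
      finally show "vnorm B (y \<otimes> v \<ominus> v \<otimes> y) \<le> 2 * e" by simp
    qed (use v y in auto)
    have "v = G v"
    proof (rule eq_if_vnorm_minus_le[where K="1 + (r + vnorm B v)"])
      fix e :: real assume e: "e > 0"
      then obtain n where n: "vnorm B (V n \<ominus> v) \<le> e" "vnorm B (V (Suc n) \<ominus> v) \<le> e" using close by blast
      have "vnorm B (v \<ominus> G v) \<le> vnorm B (v \<ominus> V (Suc n)) + vnorm B (G (V n) \<ominus> G v)"
        unfolding VS using v GB by (intro vnorm_minus_triangle) auto
      also have "\<dots> \<le> e + 1/2 * ((vnorm B v + vnorm B (V n)) * vnorm B (V n \<ominus> v))"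
        using n(2) Gdiff[of "V n" v] v vnorm_minus_commute[of v "V (Suc n)"] by auto
      also have "\<dots> \<le> e + 1 * ((vnorm B v + r) * e)"
        using n V[of n] v e r by (intro add_left_mono mult_mono add_mono) auto
      finally show "vnorm B (v \<ominus> G v) \<le> (1 + (r + vnorm B v)) * e" by (simp add: algebra_simps)
    qed (use v GB in auto)
    then have "v \<oplus> v = (1/2 + 1/2) \<odot> (y \<otimes> y \<oplus> v \<otimes> v)"
      using v y by (subst scale_add_left) (auto simp: G_def)
    then show "v \<oplus> v = y \<otimes> y \<oplus> v \<otimes> v" using v y by simp
  qed
qed

end

text \<open>The relations of \<open>exists_half_sqrt\<close> are algebraic, so the image satisfies
  them too, and self-adjoint elements of norm below one go to the unit ball. Rescaling gives all
  self-adjoint elements, and the C*-identity reduces \<open>x\<close> to the self-adjoint product of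
  its adjoint with \<open>x\<close>.\<close>

lemma star_hom_contractive:
  assumes "cstar_algebra A" "cstar_algebra B" and f: "star_hom A B f" and x: "x \<in> carrier A"
  shows "vnorm B (f x) \<le> vnorm A x"
proof -
  interpret A: cstar_algebra A by fact
  interpret B: cstar_algebra B by fact
  note f = star_homD[OF f]
  have 1: "vnorm B (f y) \<le> 1" if y: "y \<in> carrier A" "star A y = y" "vnorm A y < 1" for y
  proof -
    obtain v where "v \<in> carrier A" "star A v = v" "v \<oplus>\<^bsub>A\<^esub> v = y \<otimes>\<^bsub>A\<^esub> y \<oplus>\<^bsub>A\<^esub> v \<otimes>\<^bsub>A\<^esub> v"
      "y \<otimes>\<^bsub>A\<^esub> v = v \<otimes>\<^bsub>A\<^esub> y"
      using A.exists_half_sqrt[OF y] by blast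
    with y f show ?thesis
      by (intro B.vnorm_le_one_if_half_sqrt[of "f y" "f v"]) (metis A.mult_closed)+
  qed
  have 2: "vnorm B (f y) \<le> vnorm A y" if y: "y \<in> carrier A" "star A y = y" for y
  proof (rule field_le_epsilon)
    fix e :: real assume e: "e > 0"
    \<comment> \<open>The summand \<open>e\<close> makes the rescaled norm strictly less than one,
      as the square root iteration requires.\<close>
    define c where "c = vnorm A y + e"
    have c: "c > 0" using e y by (simp add: c_def add_nonneg_pos)
    have nc: "cmod (complex_of_real (inverse c)) = inverse c" using c by (simp add: norm_inverse)
    have "inverse c * vnorm A y < 1" using c e by (simp add: c_def field_simps)
    then have "vnorm B (f (complex_of_real (inverse c) \<odot>\<^bsub>A\<^esub> y)) \<le> 1"
      using y by (intro 1) (simp_all only: A.star_smult A.vnorm_smult nc A.scale_closed complex_cnj_complex_of_real)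
    then have "inverse c * vnorm B (f y) \<le> 1"
      using y f by (simp only: B.vnorm_smult nc)
    then have "vnorm B (f y) \<le> c" using c by (simp add: field_simps)
    then show "vnorm B (f y) \<le> vnorm A y + e" by (simp add: c_def)
  qed
  have "(vnorm B (f x))\<^sup>2 = vnorm B (f (star A x \<otimes>\<^bsub>A\<^esub> x))"
    using B.cstar_identity[of "f x"] f x by simp
  also have "\<dots> \<le> vnorm A (star A x \<otimes>\<^bsub>A\<^esub> x)" using x by (intro 2) (auto simp: A.star_mult)
  also have "\<dots> = (vnorm A x)\<^sup>2" using A.cstar_identity[OF x] .
  finally show ?thesis using A.vnorm_nonneg[OF x] power2_le_imp_le by blast
qed

section \<open>Toeplitz representations into the universal algebra\<close>

text \<open>Structure carried along a map injective on the carrier; it moves an algebra into the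
  type over which the universal property quantifies.\<close>

definition transport_cstar :: "('b \<Rightarrow> 'c) \<Rightarrow> 'b cstar_algebra \<Rightarrow> 'c cstar_algebra" where
  "transport_cstar j T = (let i = inv_into (carrier T) j in
     \<lparr>carrier = j ` carrier T, mult = (\<lambda>x y. j (i x \<otimes>\<^bsub>T\<^esub> i y)), one = undefined,
      zero = j \<zero>\<^bsub>T\<^esub>, add = (\<lambda>x y. j (i x \<oplus>\<^bsub>T\<^esub> i y)), smult = (\<lambda>c x. j (c \<odot>\<^bsub>T\<^esub> i x)),
      vnorm = (\<lambda>x. vnorm T (i x)), star = (\<lambda>x. j (star T (i x)))\<rparr>)"

lemma transport_cstar:
  assumes "cstar_algebra T" and j: "inj_on j (carrier T)"
  shows cstar_algebra_transport: "cstar_algebra (transport_cstar j T)"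
    and star_hom_transport: "star_hom T (transport_cstar j T) j"
    and star_hom_transport_inv: "star_hom (transport_cstar j T) T (inv_into (carrier T) j)"
proof -
  interpret cstar_algebra T by fact
  let ?B = "transport_cstar j T"
  define i where "i = inv_into (carrier T) j"
  have ij [simp]: "i (j x) = x" if "x \<in> carrier T" for x using that j by (simp add: i_def)
  have simps [simp]: "carrier ?B = j ` carrier T" "x \<otimes>\<^bsub>?B\<^esub> y = j (i x \<otimes>\<^bsub>T\<^esub> i y)"
    "\<zero>\<^bsub>?B\<^esub> = j \<zero>\<^bsub>T\<^esub>" "x \<oplus>\<^bsub>?B\<^esub> y = j (i x \<oplus>\<^bsub>T\<^esub> i y)" "c \<odot>\<^bsub>?B\<^esub> x = j (c \<odot>\<^bsub>T\<^esub> i x)"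
    "vnorm ?B x = vnorm T (i x)" "star ?B x = j (star T (i x))" for x y c
    by (simp_all add: transport_cstar_def Let_def i_def)
  show "star_hom T ?B j" "star_hom ?B T (inv_into (carrier T) j)"
    unfolding star_hom_def linear_on_def i_def[symmetric] by auto
  have M: "Module.module complex_ring ?B"
  proof (rule moduleI[OF cring_complex_ring abelian_groupI])
    show "\<exists>y\<in>carrier ?B. y \<oplus>\<^bsub>?B\<^esub> x = \<zero>\<^bsub>?B\<^esub>" if "x \<in> carrier ?B" for x
      using that by (intro bexI[of _ "j (\<ominus>\<^bsub>T\<^esub> i x)"]) (auto simp: M.l_neg)
  qed (auto simp: scale_add_left scale_add_right M.a_ac)
  interpret B: Module.module complex_ring ?B by (rule M)
  have minus: "j x \<ominus>\<^bsub>?B\<^esub> j y = j (x \<ominus>\<^bsub>T\<^esub> y)" if "x \<in> carrier T" "y \<in> carrier T" for x y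
  proof -
    have "\<ominus>\<^bsub>?B\<^esub> j y = j (\<ominus>\<^bsub>T\<^esub> y)" by (rule B.minus_equality) (use that in \<open>auto simp: M.l_neg\<close>)
    then show ?thesis using that by (simp add: a_minus_def)
  qed
  have ba: "vnorm ?B (x \<ominus>\<^bsub>?B\<^esub> y) = vnorm T (i x \<ominus>\<^bsub>T\<^esub> i y)" if "x \<in> carrier ?B" "y \<in> carrier ?B" for x y
    using that minus by auto
  have dist: "vdist ?B x y = (if x \<in> carrier ?B \<and> y \<in> carrier ?B then vdist T (i x) (i y) else 0)" for x y
    unfolding vdist_def[of ?B] using ba[of x y] by (auto simp: vdist_def)
  have MS: "Metric_space (carrier ?B) (vdist ?B)"
  proof -
    interpret Metric_space "carrier T" "vdist T" by (rule Metric_space_vdist)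
    show ?thesis by unfold_locales (auto simp: dist commute intro: triangle)
  qed
  have "Metric_space.mcomplete (carrier ?B) (vdist ?B)"
  proof (rule mcompleteI[OF MS])
    fix F :: "nat \<Rightarrow> 'b" assume F: "range F \<subseteq> carrier ?B"
      and C: "\<And>e. e>0 \<Longrightarrow> \<exists>N. \<forall>m\<ge>N. \<forall>n\<ge>N. vdist ?B (F m) (F n) < e"
    have Fm: "F n \<in> j ` carrier T" for n using F by auto
    then have iF: "i (F n) \<in> carrier T" for n by (metis ij imageE)
    have d: "vdist ?B (F m) (F n) = vnorm T (i (F m) \<ominus>\<^bsub>T\<^esub> i (F n))" for m n
      using Fm iF by (simp add: dist vdist_def[of T])
    obtain l where l: "l \<in> carrier T" "\<And>e. e > 0 \<Longrightarrow> \<exists>N. \<forall>n\<ge>(N::nat). vnorm T (i (F n) \<ominus>\<^bsub>T\<^esub> l) < e"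
      using Cauchy_convergent[of "\<lambda>n. i (F n)"] iF C unfolding d by blast
    show "\<exists>G\<in>carrier ?B. \<forall>e>0. \<exists>N. \<forall>n\<ge>N. vdist ?B (F n) G < e"
      using l Fm iF by (intro bexI[of _ "j l"]) (auto simp: dist vdist_def[of T])
  qed
  then show "cstar_algebra ?B"
    by unfold_locales
      (auto simp: mult_assoc mult_distr_left mult_distr_right smult_mult_left smult_mult_right
        vnorm_eq_zero vnorm_triangle vnorm_smult vnorm_mult star_add star_smult star_mult cstar_identity
        inj_on_eq_iff[OF j])
qed

lemma star_hom_compose:
  "star_hom A B f \<Longrightarrow> star_hom B C g \<Longrightarrow> star_hom A C (\<lambda>x. g (f x))"
  unfolding star_hom_def linear_on_def by simp

section \<open>Coding a generated C*-algebra by sequences of formal sums of words\<close>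

context
  fixes T :: "'b cstar_algebra" and G :: "'l \<Rightarrow> 'b"
  assumes T: "cstar_algebra T"
begin

interpretation cstar_algebra T by (rule T)

text \<open>Words are nonempty because there is no unit to evaluate the empty one; hence the first
  letter is a separate argument.\<close>

primrec eval_word :: "'l \<Rightarrow> 'l list \<Rightarrow> 'b" where
  "eval_word l [] = G l"
| "eval_word l (m # w) = G l \<otimes>\<^bsub>T\<^esub> eval_word m w"

text \<open>An empty inner list is read with the unspecified letter \<open>hd []\<close>. This is
  harmless, since only the inclusion of \<open>word_sums\<close> in the range is claimed.\<close>

definition eval_words :: "'l list list \<Rightarrow> 'b" where
  "eval_words L = foldr (\<lambda>w b. eval_word (hd w) (tl w) \<oplus>\<^bsub>T\<^esub> b) L \<zero>\<^bsub>T\<^esub>"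

inductive_set words :: "'b set" where
  "G l \<in> words"
| "w \<in> words \<Longrightarrow> G l \<otimes>\<^bsub>T\<^esub> w \<in> words"

inductive_set word_sums :: "'b set" where
  "\<zero>\<^bsub>T\<^esub> \<in> word_sums"
| "w \<in> words \<Longrightarrow> s \<in> word_sums \<Longrightarrow> w \<oplus>\<^bsub>T\<^esub> s \<in> word_sums"

lemma word_sums_subset_eval: "word_sums \<subseteq> range eval_words"
proof
  have "\<exists>l v. w = eval_word l v" if "w \<in> words" for w
    using that
  proof induction
    case (1 l) show ?case by (metis eval_word.simps(1))
  next
    case (2 w l) then show ?case by (metis eval_word.simps(2))
  qed
  then have w: "\<exists>v. w = eval_word (hd v) (tl v)" if "w \<in> words" for w
    using that by (metis list.sel(1) list.sel(3))
  fix s assume "s \<in> word_sums"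
  then show "s \<in> range eval_words"
  proof induction
    case 1 show ?case by (rule range_eqI[of _ _ "[]"]) (simp add: eval_words_def)
  next
    case (2 w s)
    then obtain v L where "w = eval_word (hd v) (tl v)" "s = eval_words L" using w by blast
    then show ?case by (intro range_eqI[of _ _ "v # L"]) (simp add: eval_words_def)
  qed
qed

context
  assumes G: "\<And>l. G l \<in> carrier T"
    and G_scale: "\<And>c l. \<exists>l'. c \<odot>\<^bsub>T\<^esub> G l = G l'"
    and G_star: "\<And>l. \<exists>l'. star T (G l) = G l'"
begin

lemma words_carrier: "w \<in> words \<Longrightarrow> w \<in> carrier T"
  by (induction rule: words.induct) (use G in auto)

lemma words_mult: "w \<in> words \<Longrightarrow> v \<in> words \<Longrightarrow> w \<otimes>\<^bsub>T\<^esub> v \<in> words"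
  by (induction rule: words.induct) (auto simp: mult_assoc G words_carrier intro: words.intros)

lemma words_star: "w \<in> words \<Longrightarrow> star T w \<in> words"
proof (induction rule: words.induct)
  case (1 l) then show ?case using G_star[of l] words.intros by auto
next
  case (2 w l) then show ?case using G_star[of l] words.intros(1) words_mult[of "star T w"] G words_carrier
    by (auto simp: star_mult)
qed

text \<open>The scalar is absorbed by the first letter, so that formal sums of words carry no
  coefficients.\<close>

lemma words_scale: "w \<in> words \<Longrightarrow> c \<odot>\<^bsub>T\<^esub> w \<in> words"
proof (induction rule: words.induct)
  case (1 l) then show ?case using G_scale[of c l] words.intros by auto
next
  case (2 w l)
  obtain l' where "c \<odot>\<^bsub>T\<^esub> G l = G l'" using G_scale by blast
  then show ?case using 2 words.intros(2)[of w l'] smult_mult_left[of "G l" w c] G words_carrier by simp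
qed

lemma word_sums_carrier: "s \<in> word_sums \<Longrightarrow> s \<in> carrier T"
  by (induction rule: word_sums.induct) (auto simp: words_carrier)

lemma word_sums_add: "s \<in> word_sums \<Longrightarrow> r \<in> word_sums \<Longrightarrow> s \<oplus>\<^bsub>T\<^esub> r \<in> word_sums"
  by (induction rule: word_sums.induct)
    (auto simp: M.a_assoc words_carrier word_sums_carrier intro: word_sums.intros)

lemma word_sums_scale: "s \<in> word_sums \<Longrightarrow> c \<odot>\<^bsub>T\<^esub> s \<in> word_sums"
  by (induction rule: word_sums.induct)
    (auto simp: scale_add_right words_carrier word_sums_carrier intro: word_sums.intros words_scale)

lemma word_sums_star: "s \<in> word_sums \<Longrightarrow> star T s \<in> word_sums"
  by (induction rule: word_sums.induct)
    (auto simp: star_add words_carrier word_sums_carrier intro: word_sums.intros words_star)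

lemma words_word_sums: "w \<in> words \<Longrightarrow> w \<in> word_sums"
  using word_sums.intros(2)[OF _ word_sums.intros(1)] words_carrier by simp

lemma word_sums_mult: "s \<in> word_sums \<Longrightarrow> r \<in> word_sums \<Longrightarrow> s \<otimes>\<^bsub>T\<^esub> r \<in> word_sums"
proof (induction rule: word_sums.induct)
  case 1 then show ?case by (simp add: word_sums_carrier word_sums.intros)
next
  case (2 w s)
  have "w \<otimes>\<^bsub>T\<^esub> r \<in> word_sums" using \<open>r \<in> word_sums\<close>
  proof (induction rule: word_sums.induct)
    case 1 then show ?case using 2 by (simp add: words_carrier word_sums.intros)
  next
    case (2 v r) then show ?case using \<open>w \<in> words\<close>
      by (auto simp: mult_distr_right words_carrier word_sums_carrier intro: word_sums.intros words_mult)
  qed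
  then show ?case using 2 by (simp add: mult_distr_left words_carrier word_sums_carrier word_sums_add)
qed

text \<open>An element is coded by a sequence of formal sums of words converging to it.\<close>

lemma exists_inj_on_generated:
  assumes "closed_star_subalgebra T hull R = carrier T" "R \<subseteq> range G"
  shows "\<exists>j :: 'b \<Rightarrow> nat \<Rightarrow> 'l list list. inj_on j (carrier T)"
proof -
  have "closed_star_subalgebra T (vclosure word_sums)"
    using word_sums_carrier
    by (intro closed_star_subalgebra_vclosure word_sums_add word_sums_mult word_sums_scale word_sums_star)
       (auto intro: word_sums.intros)
  moreover have "R \<subseteq> vclosure word_sums"
    using assms(2) subset_vclosure[of word_sums] word_sums_carrier words_word_sums words.intros(1) by blast
  ultimately have "carrier T \<subseteq> vclosure word_sums" unfolding assms(1)[symmetric] by (rule hull_minimal[rotated])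
  then have ex: "\<exists>L. vnorm T (x \<ominus>\<^bsub>T\<^esub> eval_words L) < e \<and> eval_words L \<in> carrier T" if "x \<in> carrier T" "e > 0" for x e
    using that vclosureD[of x word_sums e] word_sums_subset_eval word_sums_carrier by blast
  have "\<exists>s. \<forall>n. vnorm T (x \<ominus>\<^bsub>T\<^esub> eval_words (s n)) < inverse (real (Suc n)) \<and> eval_words (s n) \<in> carrier T"
    if "x \<in> carrier T" for x
    using ex[OF that] by (intro choice) auto
  then obtain j where j: "vnorm T (x \<ominus>\<^bsub>T\<^esub> eval_words (j x n)) < inverse (real (Suc n))"
    "eval_words (j x n) \<in> carrier T" if "x \<in> carrier T" for x n by metis
  have "inj_on j (carrier T)"
  proof (rule inj_onI)
    fix x y assume xy: "x \<in> carrier T" "y \<in> carrier T" "j x = j y"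
    show "x = y"
    proof (rule eq_if_vnorm_minus_le[where K=2])
      fix e :: real assume "e > 0"
      then obtain n where n: "inverse (real (Suc n)) < e" using reals_Archimedean by blast
      have "vnorm T (x \<ominus>\<^bsub>T\<^esub> y) \<le> vnorm T (x \<ominus>\<^bsub>T\<^esub> eval_words (j x n)) + vnorm T (eval_words (j x n) \<ominus>\<^bsub>T\<^esub> y)"
        using xy j by (intro vnorm_minus_triangle) auto
      also have "vnorm T (eval_words (j x n) \<ominus>\<^bsub>T\<^esub> y) = vnorm T (y \<ominus>\<^bsub>T\<^esub> eval_words (j y n))"
        using xy j by (metis vnorm_minus_commute)
      finally show "vnorm T (x \<ominus>\<^bsub>T\<^esub> y) \<le> 2 * e" using j(1)[OF xy(1), of n] j(1)[OF xy(2), of n] n by simp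
    qed (use xy in auto)
  qed
  then show ?thesis by blast
qed

end
end

text \<open>The given representation is composed with an injection \<open>j\<close> of
  \<open>T\<close> into \<open>rep_universe\<close>, the universal property is applied to the copy
  of \<open>T\<close> there, and the resulting homomorphism is brought back by the inverse of
  \<open>j\<close>.\<close>

lemma universal_toeplitz_rep_self:
  assumes AX: "cstar_correspondence A X" and U: "universal_toeplitz_rep A X T \<pi> t" and R: "toeplitz_rep A X T \<pi>' t'"
  shows "\<exists>\<rho>. star_hom T T \<rho> \<and> (\<forall>a\<in>carrier A. \<rho> (\<pi> a) = \<pi>' a) \<and> (\<forall>x\<in>carrier X. \<rho> (t x) = t' x)"
proof -
  interpret AX: cstar_correspondence A X by (rule AX)
  have T: "cstar_algebra T" and rep: "toeplitz_rep A X T \<pi> t"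
    and gen: "closed_star_subalgebra T hull (\<pi> ` carrier A \<union> t ` carrier X) = carrier T"
    using U by (auto simp: universal_toeplitz_rep_def)
  interpret T: cstar_algebra T by (rule T)
  have \<pi>: "star_hom A T \<pi>" and t: "linear_on X T t" using rep by (auto simp: toeplitz_rep_def)
  \<comment> \<open>\<open>p\<close> and \<open>q\<close> are zero off the carriers, which makes
    \<open>G\<close> total. Its three summands are \<open>\<pi> a\<close>, \<open>t x\<close> and
    the adjoint of \<open>t x\<close>, a family stable under scalars and
    \<open>star\<close>.\<close>
  define p where "p a = (if a \<in> carrier A then \<pi> a else \<zero>\<^bsub>T\<^esub>)" for a
  define q where "q x = (if x \<in> carrier X then t x else \<zero>\<^bsub>T\<^esub>)" for x
  define G where "G = case_sum p (case_sum q (\<lambda>x. star T (q x)))"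
  have p: "p a \<in> carrier T" "star T (p a) = p (if a \<in> carrier A then star A a else a)" for a
    using star_homD[OF \<pi>] by (auto simp: p_def)
  have q: "q x \<in> carrier T" for x using linear_onD[OF t] by (simp add: q_def)
  have ps: "c \<odot>\<^bsub>T\<^esub> p a = p (if a \<in> carrier A then c \<odot>\<^bsub>A\<^esub> a else a)" for c a
    using star_homD[OF \<pi>] by (auto simp: p_def)
  have qs: "c \<odot>\<^bsub>T\<^esub> q x = q (if x \<in> carrier X then c \<odot>\<^bsub>X\<^esub> x else x)" for c x
    using linear_onD[OF t] AX.X.smult_closed[of c x] by (auto simp: q_def)
  have "\<exists>j :: 'c \<Rightarrow> nat \<Rightarrow> ('a + 'b + 'b) list list. inj_on j (carrier T)"
  proof (rule exists_inj_on_generated[OF T _ _ _ gen, of G])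
    show "G l \<in> carrier T" for l by (auto simp: G_def p q split: sum.split)
    show "\<exists>l'. c \<odot>\<^bsub>T\<^esub> G l = G l'" for c l
    proof (cases l)
      case (Inl a) then show ?thesis by (auto simp: G_def ps intro!: exI[of _ "Inl _"])
    next
      case (Inr l')
      show ?thesis
      proof (cases l')
        case (Inl x) then show ?thesis using Inr by (auto simp: G_def qs intro!: exI[of _ "Inr (Inl _)"])
      next
        case (Inr x)
        have "c \<odot>\<^bsub>T\<^esub> star T (q x) = star T (cnj c \<odot>\<^bsub>T\<^esub> q x)" using q by (simp add: T.star_smult)
        then show ?thesis using Inr \<open>l = Inr l'\<close> by (auto simp: G_def qs intro!: exI[of _ "Inr (Inr _)"])
      qed
    qed
    show "\<exists>l'. star T (G l) = G l'" for l
    proof (cases l)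
      case (Inl a) then show ?thesis by (auto simp: G_def p intro!: exI[of _ "Inl _"])
    next
      case (Inr l')
      then show ?thesis
        by (cases l') (auto simp: G_def q intro: exI[of _ "Inr (Inl _)"] exI[of _ "Inr (Inr _)"])
    qed
    show "\<pi> ` carrier A \<union> t ` carrier X \<subseteq> range G"
    proof safe
      fix a assume "a \<in> carrier A" then show "\<pi> a \<in> range G"
        by (intro range_eqI[of _ _ "Inl a"]) (simp add: G_def p_def)
    next
      fix x assume "x \<in> carrier X" then show "t x \<in> range G"
        by (intro range_eqI[of _ _ "Inr (Inl x)"]) (simp add: G_def q_def)
    qed
  qed
  then obtain j :: "'c \<Rightarrow> ('a, 'b) rep_universe" where j: "inj_on j (carrier T)" by blast
  let ?B = "transport_cstar j T"
  note hom = star_hom_transport[OF T j] and inv = star_hom_transport_inv[OF T j]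
  have R': "star_hom A T \<pi>'" "linear_on X T t'"
     "\<And>a x. a \<in> carrier A \<Longrightarrow> x \<in> carrier X \<Longrightarrow> \<pi>' a \<otimes>\<^bsub>T\<^esub> t' x = t' (lact X a x)"
     "\<And>x y. x \<in> carrier X \<Longrightarrow> y \<in> carrier X \<Longrightarrow> star T (t' x) \<otimes>\<^bsub>T\<^esub> t' y = \<pi>' (inner_prod X x y)"
    using R by (auto simp: toeplitz_rep_def)
  note c = star_homD(1)[OF R'(1)] linear_onD(1)[OF R'(2)]
  have "toeplitz_rep A X ?B (\<lambda>a. j (\<pi>' a)) (\<lambda>x. j (t' x))"
    unfolding toeplitz_rep_def
  proof (intro conjI ballI)
    show "star_hom A ?B (\<lambda>a. j (\<pi>' a))" by (rule star_hom_compose[OF R'(1) hom])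
    show "linear_on X ?B (\<lambda>x. j (t' x))"
      using linear_onD[OF R'(2)] star_homD[OF hom] by (simp add: linear_on_def)
  qed (use star_homD[OF hom] R' c in \<open>simp_all flip: R'(3,4)\<close>)
  note rep' = conjI[OF cstar_algebra_transport[OF T j] this]
  have "\<forall>(B :: ('a, 'b) rep_universe cstar_algebra) \<pi>' t'. cstar_algebra B \<and> toeplitz_rep A X B \<pi>' t' \<longrightarrow>
        (\<exists>\<rho>. star_hom T B \<rho> \<and> (\<forall>a\<in>carrier A. \<rho> (\<pi> a) = \<pi>' a) \<and> (\<forall>x\<in>carrier X. \<rho> (t x) = t' x))"
    using U unfolding universal_toeplitz_rep_def by (elim conjE)
  from this[rule_format, OF rep'] obtain \<rho> where \<rho>: "star_hom T ?B \<rho>"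
    "\<forall>a\<in>carrier A. \<rho> (\<pi> a) = j (\<pi>' a)" "\<forall>x\<in>carrier X. \<rho> (t x) = j (t' x)"
    by (elim exE conjE)
  show ?thesis
  proof (intro exI conjI ballI)
    show "star_hom T T (\<lambda>x. inv_into (carrier T) j (\<rho> x))" by (rule star_hom_compose[OF \<rho>(1) inv])
  qed (use \<rho>(2,3) c j in simp_all)
qed

section \<open>The gauge action and the kernel of the universal representation\<close>

lemma C0_compose:
  fixes h :: "complex \<Rightarrow> complex"
  assumes f: "f \<in> C0 T" and h: "continuous_on UNIV h" "h 0 = 0"
  shows "(\<lambda>x. h (f x)) \<in> C0 T"
proof (rule C0I)
  have "continuous_map euclidean euclidean h" using h by simp
  from continuous_map_compose[OF C0_cont[OF f] this]
  show "continuous_map T euclidean (\<lambda>x. h (f x))" by (simp add: o_def)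
  fix e :: real assume "e > 0"
  then obtain d where d: "d > 0" "\<And>z. dist z 0 < d \<Longrightarrow> dist (h z) (h 0) < e"
    using h by (metis continuous_on_iff UNIV_I)
  then obtain K where "compactin T K" "\<forall>x. x \<notin> K \<longrightarrow> cmod (f x) < d" using C0_small[OF f] by blast
  then show "\<exists>K. compactin T K \<and> (\<forall>x. x \<notin> K \<longrightarrow> cmod (h (f x)) < e)"
    using d(2) h by (metis dist_0_norm dist_commute)
qed (use C0_zero[OF f] h in simp)

text \<open>Complete regularity yields a function that vanishes outside a neighbourhood of
  \<open>x\<close> contained in a compact set, hence at infinity. Admitting \<open>y = x\<close>
  lets the lemma serve both for separating points and for mere nonvanishing at
  \<open>x\<close>.\<close>

lemma C0_separate:
  assumes "locally_compact_space T" "Hausdorff_space T" "x \<in> topspace T"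
  shows "\<exists>f\<in>C0 T. f x = 1 \<and> (y \<noteq> x \<longrightarrow> f y = 0)"
proof -
  obtain U K where U: "openin T U" "compactin T K" "x \<in> U" "U \<subseteq> K"
    using assms by (auto simp: locally_compact_space_def)
  define S where "S = U - ({y} - {x})"
  have "openin T S"
  proof (cases "y \<in> topspace T \<and> y \<noteq> x")
    case True
    then have "S = U - {y}" by (auto simp: S_def)
    then show ?thesis using U assms(2) True by (auto intro!: openin_diff closedin_Hausdorff_singleton)
  next
    case False
    then have "S = U" using openin_subset[OF U(1)] by (auto simp: S_def)
    then show ?thesis using U by simp
  qed
  moreover have "completely_regular_space T"
    using assms locally_compact_Hausdorff_imp_regular_space completely_regular_eq_regular_space by blast
  ultimately obtain f where f: "continuous_map T euclideanreal f" "f x = 0" "f ` (topspace T - S) \<subseteq> {1}"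
    using U unfolding completely_regular_space_alt' by (metis S_def Diff_iff insertI1)
  define h where "h z = (if z \<in> topspace T then complex_of_real (1 - f z) else 0)" for z
  have h0: "h z = 0" if "z \<notin> S" for z using f(3) that by (auto simp: h_def)
  have "h \<in> C0 T"
  proof (rule C0I)
    have "continuous_map T euclidean (\<lambda>z. complex_of_real (1 - f z))"
      using f(1) by (simp add: continuous_map_atin) (auto intro!: tendsto_intros)
    then show "continuous_map T euclidean h" by (rule continuous_map_eq) (simp add: h_def)
    show "\<exists>K. compactin T K \<and> (\<forall>x. x \<notin> K \<longrightarrow> cmod (h x) < e)" if "e > 0" for e
      using U h0 that by (intro exI[of _ K]) (metis S_def DiffD1 norm_zero subsetD)
  qed (simp add: h_def)
  moreover have "h x = 1" using assms f by (simp add: h_def)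
  ultimately show ?thesis using h0[of y] by (auto simp: S_def)
qed

lemma C0_edge_extend:
  assumes "f \<in> C0 T" "j \<in> {1..n}"
  shows "(\<lambda>(i, x). if i = j then f x else 0) \<in> C0 (edge_space n T)"
proof (rule C0I)
  show "continuous_map (edge_space n T) euclidean (\<lambda>(i, x). if i = j then f x else 0)"
    by (rule continuous_map_edge_space) (use C0_cont[OF assms(1)] in auto)
  fix e :: real assume e: "e > 0"
  then obtain K where K: "compactin T K" "\<forall>x. x \<notin> K \<longrightarrow> cmod (f x) < e" using C0_small[OF assms(1)] by blast
  have "compactin (edge_space n T) ({j} \<times> K)" using K assms(2) by (simp add: compactin_Times)
  then show "\<exists>K. compactin (edge_space n T) K \<and> (\<forall>p. p \<notin> K \<longrightarrow> cmod ((\<lambda>(i, x). if i = j then f x else 0) p) < e)"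
    using K e by (intro exI[of _ "{j} \<times> K"]) auto
next
  fix p assume "p \<notin> topspace (edge_space n T)"
  then show "(\<lambda>(i, x). if i = j then f x else 0) p = 0" using C0_zero[OF assms(1)] assms(2) by (cases p) auto
qed

text \<open>The edge space is a disjoint union of copies of \<open>T\<close>, so cutting to one copy
  is continuous. This isolates a loop from the other edges leaving the same point.\<close>

lemma C0_edge_restrict:
  assumes "\<xi> \<in> C0 (edge_space n T)"
  shows "(\<lambda>(i, x). if i = j then \<xi> (i, x) else 0) \<in> C0 (edge_space n T)"
proof (cases "j \<in> {1..n}")
  case True
  have "(\<lambda>(i, x). if i = j then \<xi> (i, x) else 0) = (\<lambda>(i, x). if i = j then \<xi> (j, x) else 0)" by (auto simp: fun_eq_iff)
  then show ?thesis using C0_edge_extend[OF C0_slice[OF assms, of j] True] by (simp only:)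
next
  case False
  then have "(\<lambda>(i, x). if i = j then \<xi> (i, x) else 0) = (\<lambda>p. 0)" using C0_zero[OF assms] by (auto simp: fun_eq_iff)
  then show ?thesis by (simp only: C0_zero_fun)
qed

locale toeplitz_system = cstar_algebra T
  for T :: "'b cstar_algebra" (structure) +
  fixes \<Omega> :: "'a topology" and n :: nat and \<sigma> :: "nat \<Rightarrow> 'a \<Rightarrow> 'a"
    and \<pi> :: "('a \<Rightarrow> complex) \<Rightarrow> 'b" and t :: "(nat \<times> 'a \<Rightarrow> complex) \<Rightarrow> 'b"
  assumes mds: "multivariable_dynamical_system \<Omega> n \<sigma>"
    and univ: "universal_toeplitz_rep (C0_algebra \<Omega>) (dyn_correspondence \<Omega> n \<sigma>) T \<pi> t"
begin

abbreviation X where "X \<equiv> C0 (edge_space n \<Omega>)"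

lemma \<sigma>_cont: "i \<in> {1..n} \<Longrightarrow> continuous_map \<Omega> \<Omega> (\<sigma> i)"
  using mds by (auto simp: multivariable_dynamical_system_def)

lemma rep: "toeplitz_rep (C0_algebra \<Omega>) (dyn_correspondence \<Omega> n \<sigma>) T \<pi> t"
  using univ by (simp add: universal_toeplitz_rep_def)

lemma pi_hom: "star_hom (C0_algebra \<Omega>) T \<pi>" and t_lin: "linear_on (dyn_correspondence \<Omega> n \<sigma>) T t"
  using rep by (simp_all add: toeplitz_rep_def)

lemma pi_closed [simp]: "f \<in> C0 \<Omega> \<Longrightarrow> \<pi> f \<in> carrier T"
  and pi_add: "f \<in> C0 \<Omega> \<Longrightarrow> g \<in> C0 \<Omega> \<Longrightarrow> \<pi> (\<lambda>x. f x + g x) = \<pi> f \<oplus> \<pi> g"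
  and pi_scale: "f \<in> C0 \<Omega> \<Longrightarrow> \<pi> (\<lambda>x. c * f x) = c \<odot> \<pi> f"
  and pi_mult: "f \<in> C0 \<Omega> \<Longrightarrow> g \<in> C0 \<Omega> \<Longrightarrow> \<pi> (\<lambda>x. f x * g x) = \<pi> f \<otimes> \<pi> g"
  and pi_star: "f \<in> C0 \<Omega> \<Longrightarrow> \<pi> (\<lambda>x. cnj (f x)) = star T (\<pi> f)"
  using star_homD[OF pi_hom, of f] by simp_all

lemma t_closed [simp]: "\<xi> \<in> X \<Longrightarrow> t \<xi> \<in> carrier T"
  and t_add: "\<xi> \<in> X \<Longrightarrow> \<eta> \<in> X \<Longrightarrow> t (\<lambda>p. \<xi> p + \<eta> p) = t \<xi> \<oplus> t \<eta>"
  and t_scale: "\<xi> \<in> X \<Longrightarrow> t (\<lambda>p. c * \<xi> p) = c \<odot> t \<xi>"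
  using linear_onD[OF t_lin, of \<xi>] by simp_all

lemma pi_t: "f \<in> C0 \<Omega> \<Longrightarrow> \<xi> \<in> X \<Longrightarrow> \<pi> f \<otimes> t \<xi> = t (\<lambda>(i, x). f (\<sigma> i x) * \<xi> (i, x))"
  and t_star_t: "\<xi> \<in> X \<Longrightarrow> \<eta> \<in> X \<Longrightarrow> star T (t \<xi>) \<otimes> t \<eta> = \<pi> (\<lambda>x. \<Sum>i=1..n. cnj (\<xi> (i, x)) * \<eta> (i, x))"
  using rep by (simp_all add: toeplitz_rep_def)

lemma pi_zero: "\<pi> (\<lambda>x. 0) = \<zero>"
  using pi_scale[of "\<lambda>x. 0" 0] by (simp add: C0_zero_fun)

lemma pi_diff: "f \<in> C0 \<Omega> \<Longrightarrow> g \<in> C0 \<Omega> \<Longrightarrow> \<pi> (\<lambda>x. f x - g x) = \<pi> f \<ominus> \<pi> g"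
  using pi_add[OF _ C0_smult[of g \<Omega> "-1"], of f] pi_scale[of g "-1"] by (simp add: minus_eq_scale)

lemma t_diff: "\<xi> \<in> X \<Longrightarrow> \<eta> \<in> X \<Longrightarrow> t (\<lambda>p. \<xi> p - \<eta> p) = t \<xi> \<ominus> t \<eta>"
  using t_add[OF _ C0_smult[of \<eta> _ "-1"], of \<xi>] t_scale[of \<eta> "-1"] by (simp add: minus_eq_scale)

lemma pi_norm_le: "f \<in> C0 \<Omega> \<Longrightarrow> (\<And>x. cmod (f x) \<le> b) \<Longrightarrow> vnorm T (\<pi> f) \<le> b"
  using star_hom_contractive[OF C0_cstar_algebra _ pi_hom, of f] cstar_algebra_axioms sup_norm_le[of f b]
  by simp

lemma inner_X: "\<xi> \<in> X \<Longrightarrow> \<eta> \<in> X \<Longrightarrow> (\<lambda>x. \<Sum>i=1..n. cnj (\<xi> (i, x)) * \<eta> (i, x)) \<in> C0 \<Omega>"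
  using inner_C0 .

lemma X_ract: "\<xi> \<in> X \<Longrightarrow> f \<in> C0 \<Omega> \<Longrightarrow> (\<lambda>(i, x). \<xi> (i, x) * f x) \<in> X"
  by (rule ract_C0)

lemma X_lact: "\<xi> \<in> X \<Longrightarrow> f \<in> C0 \<Omega> \<Longrightarrow> (\<lambda>(i, x). f (\<sigma> i x) * \<xi> (i, x)) \<in> X"
  by (rule lact_C0) (auto intro: \<sigma>_cont)

text \<open>Compatibility with the right action is not among the defining relations of a Toeplitz
  representation but follows from them: for the difference \<open>d\<close> of the two sides, all
  four products in the expansion of \<open>star T d \<otimes> d\<close> equal
  \<open>\<pi> g\<close>, and the C*-identity makes \<open>d\<close> vanish.\<close>

lemma t_pi: assumes \<xi>: "\<xi> \<in> X" and f: "f \<in> C0 \<Omega>"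
  shows "t \<xi> \<otimes> \<pi> f = t (\<lambda>(i, x). \<xi> (i, x) * f x)" (is "?l = t ?\<eta>")
proof -
  have \<eta>: "?\<eta> \<in> X" by (rule X_ract[OF \<xi> f])
  have c [simp]: "t \<xi> \<in> carrier T" "\<pi> f \<in> carrier T" "t ?\<eta> \<in> carrier T" using \<xi> f \<eta> by simp_all
  define g where "g x = (\<Sum>i=1..n. cnj (\<xi> (i, x)) * \<xi> (i, x)) * (cnj (f x) * f x)" for x
  have 1: "star T (t ?\<eta>) \<otimes> t ?\<eta> = \<pi> g"
    unfolding t_star_t[OF \<eta> \<eta>] g_def by (simp add: sum_distrib_right sum_distrib_left algebra_simps)
  have 2: "star T (t ?\<eta>) \<otimes> (t \<xi> \<otimes> \<pi> f) = \<pi> g"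
  proof -
    have "star T (t ?\<eta>) \<otimes> (t \<xi> \<otimes> \<pi> f) = (star T (t ?\<eta>) \<otimes> t \<xi>) \<otimes> \<pi> f" by (simp add: mult_assoc)
    also have "\<dots> = \<pi> g" unfolding t_star_t[OF \<eta> \<xi>] pi_mult[OF inner_X[OF \<eta> \<xi>] f, symmetric] g_def
      by (simp add: sum_distrib_right sum_distrib_left algebra_simps)
    finally show ?thesis .
  qed
  have 3: "star T (t \<xi> \<otimes> \<pi> f) \<otimes> t ?\<eta> = \<pi> g"
  proof -
    have "star T (t \<xi> \<otimes> \<pi> f) \<otimes> t ?\<eta> = star T (\<pi> f) \<otimes> (star T (t \<xi>) \<otimes> t ?\<eta>)" by (simp add: mult_assoc star_mult)
    also have "\<dots> = \<pi> g"
      unfolding t_star_t[OF \<xi> \<eta>] pi_star[OF f, symmetric] pi_mult[OF C0_cnj[OF f] inner_X[OF \<xi> \<eta>], symmetric] g_def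
      by (simp add: sum_distrib_right sum_distrib_left algebra_simps)
    finally show ?thesis .
  qed
  have 4: "star T (t \<xi> \<otimes> \<pi> f) \<otimes> (t \<xi> \<otimes> \<pi> f) = \<pi> g"
  proof -
    have "star T (t \<xi> \<otimes> \<pi> f) \<otimes> (t \<xi> \<otimes> \<pi> f) = star T (\<pi> f) \<otimes> ((star T (t \<xi>) \<otimes> t \<xi>) \<otimes> \<pi> f)"
      by (simp add: mult_assoc star_mult)
    also have "\<dots> = \<pi> g"
      unfolding t_star_t[OF \<xi> \<xi>] pi_star[OF f, symmetric] pi_mult[OF inner_X[OF \<xi> \<xi>] f, symmetric]
        pi_mult[OF C0_cnj[OF f] C0_mult[OF inner_X[OF \<xi> \<xi>] f], symmetric] g_def
      by (simp add: sum_distrib_right sum_distrib_left algebra_simps)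
    finally show ?thesis .
  qed
  have "star T (?l \<ominus> t ?\<eta>) \<otimes> (?l \<ominus> t ?\<eta>) = (star T ?l \<otimes> ?l \<ominus> star T ?l \<otimes> t ?\<eta>) \<ominus> (star T (t ?\<eta>) \<otimes> ?l \<ominus> star T (t ?\<eta>) \<otimes> t ?\<eta>)"
    by (simp add: star_minus mult_minus_left mult_minus_right add_minus_add minus_eq_scale scale_add_right mult_distr_left
      mult_distr_right star_add star_smult smult_mult_left smult_mult_right M.a_ac)
  also have "\<dots> = \<zero>" unfolding 1 2 3 4 using 1 by (simp flip: 1)
  finally have "?l \<ominus> t ?\<eta> = \<zero>" by (rule eq_zero_if_star_mult[rotated]) simp
  then show ?thesis using minus_eq_zero_iff[of ?l "t ?\<eta>"] by simp
qed

lemma t_norm_sq_le: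
  fixes b :: real
  assumes "\<xi> \<in> X" "\<And>p. cmod (\<xi> p) \<le> b"
  shows "(vnorm T (t \<xi>))\<^sup>2 \<le> n * b\<^sup>2"
proof -
  have "(vnorm T (t \<xi>))\<^sup>2 = vnorm T (\<pi> (\<lambda>x. \<Sum>i=1..n. cnj (\<xi> (i, x)) * \<xi> (i, x)))"
    using cstar_identity[of "t \<xi>"] t_star_t[OF assms(1,1)] assms(1) by simp
  also have "\<dots> \<le> n * b\<^sup>2"
  proof (rule pi_norm_le[OF inner_X[OF assms(1,1)]])
    fix x
    have "cmod (\<Sum>i=1..n. cnj (\<xi> (i, x)) * \<xi> (i, x)) \<le> (\<Sum>i=1..n. b\<^sup>2)"
    proof (rule sum_norm_le)
      show "cmod (cnj (\<xi> (i, x)) * \<xi> (i, x)) \<le> b\<^sup>2" for i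
        using power_mono[OF assms(2)[of "(i, x)"], of 2] by (simp add: norm_mult power2_eq_square)
    qed
    then show "cmod (\<Sum>i=1..n. cnj (\<xi> (i, x)) * \<xi> (i, x)) \<le> n * b\<^sup>2" by simp
  qed
  finally show ?thesis .
qed

text \<open>A factor of modulus one in front of \<open>t\<close> cancels in inner products, so the
  result is again a representation in \<open>T\<close>, and universality extends it.\<close>

lemma exists_gauge:
  assumes z: "cmod z = 1"
  shows "\<exists>\<rho>. star_hom T T \<rho> \<and> (\<forall>f\<in>C0 \<Omega>. \<rho> (\<pi> f) = \<pi> f) \<and> (\<forall>\<xi>\<in>X. \<rho> (t \<xi>) = z \<odot> t \<xi>)"
proof -
  have zz: "cnj z * z = 1" using z by (simp add: mult.commute complex_norm_square[symmetric])
  have "toeplitz_rep (C0_algebra \<Omega>) (dyn_correspondence \<Omega> n \<sigma>) T \<pi> (\<lambda>\<xi>. z \<odot> t \<xi>)"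
    unfolding toeplitz_rep_def
  proof (intro conjI ballI pi_hom)
    show "linear_on (dyn_correspondence \<Omega> n \<sigma>) T (\<lambda>\<xi>. z \<odot> t \<xi>)"
      by (auto simp: linear_on_def t_add t_scale scale_add_right mult.commute)
  next
    fix f \<xi> assume "f \<in> carrier (C0_algebra \<Omega>)" "\<xi> \<in> carrier (dyn_correspondence \<Omega> n \<sigma>)"
    then show "\<pi> f \<otimes> (z \<odot> t \<xi>) = z \<odot> t (lact (dyn_correspondence \<Omega> n \<sigma>) f \<xi>)"
      by (simp add: smult_mult_right pi_t)
  next
    fix \<xi> \<eta> assume "\<xi> \<in> carrier (dyn_correspondence \<Omega> n \<sigma>)" "\<eta> \<in> carrier (dyn_correspondence \<Omega> n \<sigma>)"
    then show "star T (z \<odot> t \<xi>) \<otimes> (z \<odot> t \<eta>) = \<pi> (inner_prod (dyn_correspondence \<Omega> n \<sigma>) \<xi> \<eta>)"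
      by (simp add: smult_mult_right smult_mult_left star_smult t_star_t[symmetric] zz mult.commute[of z] del: One_nat_def)
  qed
  from universal_toeplitz_rep_self[OF dyn_cstar_correspondence[OF mds] univ this] show ?thesis by simp
qed

definition \<gamma> :: "complex \<Rightarrow> 'b \<Rightarrow> 'b" where
  "\<gamma> z = (SOME \<rho>. star_hom T T \<rho> \<and> (\<forall>f\<in>C0 \<Omega>. \<rho> (\<pi> f) = \<pi> f) \<and> (\<forall>\<xi>\<in>X. \<rho> (t \<xi>) = z \<odot> t \<xi>))"

lemma \<gamma>: assumes "cmod z = 1"
  shows \<gamma>_hom: "star_hom T T (\<gamma> z)" and \<gamma>_pi: "f \<in> C0 \<Omega> \<Longrightarrow> \<gamma> z (\<pi> f) = \<pi> f"
    and \<gamma>_t: "\<xi> \<in> X \<Longrightarrow> \<gamma> z (t \<xi>) = z \<odot> t \<xi>"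
    and \<gamma>_norm: "x \<in> carrier T \<Longrightarrow> vnorm T (\<gamma> z x) \<le> vnorm T x"
proof -
  note * = someI_ex[OF exists_gauge[OF assms], folded \<gamma>_def]
  then show "star_hom T T (\<gamma> z)" "f \<in> C0 \<Omega> \<Longrightarrow> \<gamma> z (\<pi> f) = \<pi> f" "\<xi> \<in> X \<Longrightarrow> \<gamma> z (t \<xi>) = z \<odot> t \<xi>"
    by blast+
  then show "x \<in> carrier T \<Longrightarrow> vnorm T (\<gamma> z x) \<le> vnorm T x"
    by (intro star_hom_contractive) (use cstar_algebra_axioms in auto)
qed

text \<open>The hull of the kernel of \<open>\<pi>\<close>. In fact \<open>\<pi>\<close> is injective and this is all of \<open>\<Omega>\<close>, but using
  the hull instead of the injectivity avoids constructing a concrete (Fock) representation.\<close>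

definition spec :: "'a set" where
  "spec = {x \<in> topspace \<Omega>. \<forall>f\<in>C0 \<Omega>. \<pi> f = \<zero> \<longrightarrow> f x = 0}"

text \<open>For \<open>r\<close> between the norm and \<open>g x\<close>, the functions
  \<open>h k\<close> satisfy \<open>h k = g * h (Suc k)\<close>, so the norm of
  \<open>\<pi> (h 0)\<close> is at most \<open>b * (?N / r) ^ k\<close> for every \<open>k\<close>.
  Hence \<open>\<pi> (h 0) = \<zero>\<close>, although \<open>h 0 x = g x - r\<close> is positive.
  The maximum with \<open>r\<close> keeps the division by powers of \<open>g\<close>
  bounded.\<close>

lemma spec_lower:
  fixes g :: "'a \<Rightarrow> real"
  assumes gC: "(\<lambda>x. complex_of_real (g x)) \<in> C0 \<Omega>" and "x \<in> spec"
  shows "g x \<le> vnorm T (\<pi> (\<lambda>x. complex_of_real (g x)))"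
proof (rule ccontr)
  let ?N = "vnorm T (\<pi> (\<lambda>x. complex_of_real (g x)))"
  assume "\<not> g x \<le> ?N"
  then obtain r where r: "?N < r" "r < g x" using dense by (metis not_le)
  have N0: "0 \<le> ?N" using gC by simp
  then have r0: "r > 0" using r by linarith
  define h where "h k y = complex_of_real (max (g y - r) 0 / (max (g y) r) ^ k)" for k y
  have hC: "h k \<in> C0 \<Omega>" for k
  proof -
    have "continuous_on UNIV (\<lambda>z. complex_of_real (max (Re z - r) 0 / (max (Re z) r) ^ k))"
      using r0 by (intro continuous_intros) (auto simp: max_def)
    from C0_compose[OF gC this] r0 show ?thesis by (simp add: h_def[abs_def])
  qed
  obtain b where b: "b > 0" "\<And>y. cmod (h 0 y) \<le> b" using C0_bdd[OF hC[of 0]] by metis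
  have hk: "vnorm T (\<pi> (h k)) \<le> b / r ^ k" for k
  proof (rule pi_norm_le[OF hC])
    fix y
    have "cmod (h k y) = cmod (h 0 y) / (max (g y) r) ^ k" using r0 by (simp add: h_def norm_divide norm_power)
    also have "\<dots> \<le> b / r ^ k" using r0 b by (intro frac_le power_mono) auto
    finally show "cmod (h k y) \<le> b / r ^ k" .
  qed
  have h0: "vnorm T (\<pi> (h 0)) \<le> ?N ^ k * vnorm T (\<pi> (h k))" for k
  proof (induction k)
    case (Suc k)
    have "h k = (\<lambda>y. complex_of_real (g y) * h (Suc k) y)"
      using r0 by (auto simp: h_def fun_eq_iff max_def)
    then have "\<pi> (h k) = \<pi> (\<lambda>x. complex_of_real (g x)) \<otimes> \<pi> (h (Suc k))" using pi_mult[OF gC hC] by simp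
    then have "vnorm T (\<pi> (h k)) \<le> ?N * vnorm T (\<pi> (h (Suc k)))" using gC hC vnorm_mult by simp
    then have "?N ^ k * vnorm T (\<pi> (h k)) \<le> ?N ^ k * (?N * vnorm T (\<pi> (h (Suc k))))"
      using N0 by (intro mult_left_mono) auto
    then show ?case using Suc by (simp add: mult.assoc mult.left_commute)
  qed simp
  have le: "vnorm T (\<pi> (h 0)) \<le> b * (?N / r) ^ k" for k
  proof -
    have "vnorm T (\<pi> (h 0)) \<le> ?N ^ k * (b / r ^ k)" using h0[of k] mult_left_mono[OF hk[of k], of "?N ^ k"] N0 by auto
    then show ?thesis by (simp add: power_divide mult.commute)
  qed
  have "(\<lambda>k. b * (?N / r) ^ k) \<longlonglongrightarrow> b * 0"
    using r N0 r0 by (intro tendsto_mult_left LIMSEQ_power_zero) simp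
  then have "vnorm T (\<pi> (h 0)) \<le> 0" using le by (intro LIMSEQ_le_const[of _ _ "vnorm T (\<pi> (h 0))"]) auto
  then have "\<pi> (h 0) = \<zero>" using hC[of 0] by (metis antisym pi_closed vnorm_eq_zero vnorm_nonneg)
  then have "h 0 x = 0" using assms(2) hC by (auto simp: spec_def)
  then show False using r by (simp add: h_def)
qed

lemma pi_sum_sq_zero:
  assumes "finite F" "\<And>y. y \<in> F \<Longrightarrow> k y \<in> C0 \<Omega> \<and> \<pi> (k y) = \<zero>"
  shows "\<pi> (\<lambda>x. \<Sum>y\<in>F. cnj (k y x) * k y x) = \<zero>"
  using assms
proof (induction F rule: finite_induct)
  case (insert y F)
  have "(\<lambda>x. \<Sum>y\<in>F. cnj (k y x) * k y x) \<in> C0 \<Omega>"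
    using insert by (intro C0_sum C0_mult C0_cnj) auto
  moreover have "k y \<in> C0 \<Omega>" "\<pi> (k y) = \<zero>" using insert by auto
  ultimately show ?case using insert
    by (simp add: pi_add C0_mult C0_cnj pi_mult)
qed (simp add: pi_zero)

text \<open>Finitely many kernel elements cover the compact set \<open>K\<close> where
  \<open>g\<close> is at least \<open>c\<close>, and the sum \<open>G\<close> of their squared
  moduli is a kernel element that is at least 1 on \<open>K\<close>. Hence the excess
  \<open>h\<close> of \<open>g\<close> over \<open>c\<close> is \<open>G\<close> times a C0 function
  and lies in the kernel too, while \<open>g - h\<close> is at most \<open>c\<close>.\<close>

lemma spec_upper:
  fixes g :: "'a \<Rightarrow> real"
  assumes gC: "(\<lambda>x. complex_of_real (g x)) \<in> C0 \<Omega>" and g0: "\<And>x. 0 \<le> g x"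
    and b: "0 \<le> b" "\<And>x. x \<in> spec \<Longrightarrow> g x \<le> b"
  shows "vnorm T (\<pi> (\<lambda>x. complex_of_real (g x))) \<le> b"
proof (rule field_le_epsilon)
  fix e :: real assume e: "e > 0"
  define c where "c = b + e"
  have c: "c > 0" using e b by (simp add: c_def)
  define K where "K = {x \<in> topspace \<Omega>. c \<le> cmod (complex_of_real (g x))}"
  have K: "compactin \<Omega> K" using gC c by (auto simp: K_def C0_def)
  have "\<forall>y\<in>K. \<exists>k\<in>C0 \<Omega>. \<pi> k = \<zero> \<and> k y \<noteq> 0"
    using b(2) e g0 by (force simp: K_def spec_def c_def)
  then obtain k' where k': "\<And>y. y \<in> K \<Longrightarrow> k' y \<in> C0 \<Omega>" "\<And>y. y \<in> K \<Longrightarrow> \<pi> (k' y) = \<zero>" "\<And>y. y \<in> K \<Longrightarrow> k' y y \<noteq> 0"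
    by metis
  \<comment> \<open>Normalized to the value 2 at \<open>y\<close>, so that \<open>y\<close> lies in
    the open set \<open>U y\<close> where the modulus exceeds 1.\<close>
  define k where "k y x = 2 / k' y y * k' y x" for y x
  have kC: "k y \<in> C0 \<Omega>" and k0: "\<pi> (k y) = \<zero>" and ky: "k y y = 2" if "y \<in> K" for y
    using k'[OF that] pi_scale[OF k'(1)[OF that], of "2 / k' y y"] C0_smult[OF k'(1)[OF that], of "2 / k' y y"]
    by (simp_all add: k_def[abs_def])
  define U where "U y = {x \<in> topspace \<Omega>. cmod (k y x) \<in> {1<..}}" for y
  have "openin \<Omega> (U y)" if "y \<in> K" for y
    unfolding U_def
    by (rule openin_continuous_map_preimage[OF continuous_map_norm[OF C0_cont[OF kC[OF that]]]]) auto
  moreover have "K \<subseteq> \<Union> (U ` K)" using ky by (auto simp: U_def K_def)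
  ultimately obtain \<F> where "finite \<F>" "\<F> \<subseteq> U ` K" "K \<subseteq> \<Union>\<F>"
    using K unfolding compactin_def by (metis imageE)
  then obtain F where F: "finite F" "F \<subseteq> K" "K \<subseteq> \<Union> (U ` F)" by (metis finite_subset_image)
  define G where "G x = (\<Sum>y\<in>F. (cmod (k y x))\<^sup>2)" for x
  have Gk: "(\<lambda>x. complex_of_real (G x)) = (\<lambda>x. \<Sum>y\<in>F. cnj (k y x) * k y x)"
    by (simp add: G_def fun_eq_iff mult.commute complex_norm_square flip: of_real_power)
  have GC: "(\<lambda>x. complex_of_real (G x)) \<in> C0 \<Omega>"
    unfolding Gk using F kC by (intro C0_sum C0_mult C0_cnj) auto
  have \<pi>G: "\<pi> (\<lambda>x. complex_of_real (G x)) = \<zero>"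
    unfolding Gk using F kC k0 by (intro pi_sum_sq_zero) auto
  have G1: "1 \<le> G x" if "x \<in> K" for x
  proof -
    obtain y where y: "y \<in> F" "1 < cmod (k y x)" using subsetD[OF F(3) \<open>x \<in> K\<close>] by (auto simp: U_def)
    have "1 \<le> (cmod (k y x))\<^sup>2" using y by (simp add: one_le_power)
    also have "\<dots> \<le> G x" unfolding G_def by (rule member_le_sum[OF y(1)]) (use F in auto)
    finally show ?thesis .
  qed
  define h where "h x = max (g x - c) 0" for x
  have "continuous_on UNIV (\<lambda>z. complex_of_real (max (Re z - c) 0))" by (intro continuous_intros)
  from C0_compose[OF gC this] c have hC: "(\<lambda>x. complex_of_real (h x)) \<in> C0 \<Omega>" by (simp add: h_def)
  have h0: "h x = 0" if "x \<notin> K" for x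
  proof (cases "x \<in> topspace \<Omega>")
    case True then show ?thesis using that g0[of x] by (auto simp: K_def h_def)
  next
    case False then show ?thesis using C0_zero[OF gC, of x] c by (simp add: h_def)
  qed
  have invC: "continuous_map \<Omega> euclidean (\<lambda>x. complex_of_real (1 / max (G x) 1))"
  proof -
    have "continuous_on UNIV (\<lambda>z. complex_of_real (1 / max (Re z) 1))"
      by (intro continuous_intros) (auto simp: max_def)
    then have "continuous_map euclidean euclidean (\<lambda>z. complex_of_real (1 / max (Re z) 1))" by simp
    from continuous_map_compose[OF C0_cont[OF GC] this] show ?thesis by (simp add: o_def)
  qed
  have qC: "(\<lambda>x. complex_of_real (1 / max (G x) 1) * complex_of_real (h x)) \<in> C0 \<Omega>"
    by (rule C0_mult_bdd[OF hC invC, of 1]) (simp add: norm_divide max_def)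
  have "complex_of_real (h x) = complex_of_real (G x) * (complex_of_real (1 / max (G x) 1) * complex_of_real (h x))" for x
    using h0[of x] G1[of x] by (cases "x \<in> K") (auto simp: max_def)
  then have "\<pi> (\<lambda>x. complex_of_real (h x)) = \<pi> (\<lambda>x. complex_of_real (G x)) \<otimes> \<pi> (\<lambda>x. complex_of_real (1 / max (G x) 1) * complex_of_real (h x))"
    using pi_mult[OF GC qC] by (simp only:)
  then have \<pi>h: "\<pi> (\<lambda>x. complex_of_real (h x)) = \<zero>" using qC by (simp add: \<pi>G del: of_real_divide)
  have "vnorm T (\<pi> (\<lambda>x. complex_of_real (g x) - complex_of_real (h x))) \<le> c"
    by (rule pi_norm_le[OF C0_diff[OF gC hC]]) (use g0 c in \<open>auto simp: h_def max_def simp flip: of_real_diff\<close>)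
  also have "\<pi> (\<lambda>x. complex_of_real (g x) - complex_of_real (h x)) = \<pi> (\<lambda>x. complex_of_real (g x))"
    unfolding pi_diff[OF gC hC] \<pi>h using gC by simp
  finally show "vnorm T (\<pi> (\<lambda>x. complex_of_real (g x))) \<le> b + e" by (simp add: c_def)
qed

lemma lch: "locally_compact_space \<Omega>" "Hausdorff_space \<Omega>"
  using mds by (auto simp: multivariable_dynamical_system_def)

text \<open>If \<open>\<pi> f\<close> vanishes, so does \<open>t \<eta>\<close> for
  \<open>\<eta>\<close> the left multiple by \<open>f\<close> of a function on edge
  \<open>j\<close>. The inner square of \<open>\<eta>\<close> is then a kernel element, and its
  value at \<open>x\<close> is the squared modulus of \<open>f (\<sigma> j x)\<close>. Invariance
  matters because a coefficient at \<open>x\<close> refers to one at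
  \<open>\<sigma> j x\<close>.\<close>

lemma spec_\<sigma>:
  assumes x: "x \<in> spec" and j: "j \<in> {1..n}"
  shows "\<sigma> j x \<in> spec"
  unfolding spec_def
proof (intro CollectI conjI ballI impI)
  have xt: "x \<in> topspace \<Omega>" using x by (simp add: spec_def)
  then show "\<sigma> j x \<in> topspace \<Omega>" using \<sigma>_cont[OF j] by (auto simp: continuous_map_def)
  fix f assume f: "f \<in> C0 \<Omega>" "\<pi> f = \<zero>"
  obtain h where h: "h \<in> C0 \<Omega>" "h x = 1" using C0_separate[OF lch xt] by blast
  define \<xi> where "\<xi> = (\<lambda>(i, x). if i = j then h x else 0)"
  have \<xi>: "\<xi> \<in> X" unfolding \<xi>_def by (rule C0_edge_extend[OF h(1) j])
  define \<eta> where "\<eta> = (\<lambda>(i, x). f (\<sigma> i x) * \<xi> (i, x))"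
  have \<eta>: "\<eta> \<in> X" unfolding \<eta>_def by (rule X_lact[OF \<xi> f(1)])
  have "t \<eta> = \<zero>" using pi_t[OF f(1) \<xi>] \<xi> f(2) by (simp add: \<eta>_def)
  then have "\<pi> (\<lambda>x. \<Sum>i=1..n. cnj (\<eta> (i, x)) * \<eta> (i, x)) = \<zero>" using t_star_t[OF \<eta> \<eta>] by simp
  then have "(\<Sum>i=1..n. cnj (\<eta> (i, x)) * \<eta> (i, x)) = 0" using x inner_X[OF \<eta> \<eta>] by (force simp: spec_def simp del: One_nat_def)
  also have "(\<Sum>i=1..n. cnj (\<eta> (i, x)) * \<eta> (i, x)) = (\<Sum>i=1..n. if i = j then cnj (f (\<sigma> j x)) * f (\<sigma> j x) else 0)"
    by (rule sum.cong) (auto simp: \<eta>_def \<xi>_def h)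
  finally show "f (\<sigma> j x) = 0" using j by (simp del: One_nat_def)
qed

end

section \<open>Homogeneous elements and Cesaro means\<close>

lemma sum_roots_of_unity:
  assumes "a < N" "b < N"
  shows "(\<Sum>l<N. cis (2 * pi * real l / real N) ^ a * cnj (cis (2 * pi * real l / real N)) ^ b) = (if a = b then of_nat N else 0)"
proof (cases "a = b")
  case True
  have "cis (2 * pi * real l / real N) ^ a * cnj (cis (2 * pi * real l / real N)) ^ a = 1" for l
    by (simp add: power_mult_distrib[symmetric] cis_cnj cis_mult)
  then show ?thesis using True by simp
next
  case False
  define r where "r = cis (2 * pi * (real a - real b) / N)"
  have N: "N > 0" using assms by simp
  have rl: "cis (2 * pi * real l / real N) ^ a * cnj (cis (2 * pi * real l / real N)) ^ b = r ^ l" for l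
    unfolding r_def by (simp add: cis_cnj Complex.DeMoivre cis_mult algebra_simps diff_divide_distrib)
  have rN: "r ^ N = 1"
  proof -
    have "r ^ N = cis (2 * pi * of_int (int a - int b))" using N by (simp add: r_def Complex.DeMoivre)
    also have "\<dots> = 1" by (rule cis_multiple_2pi) auto
    finally show ?thesis .
  qed
  have "r \<noteq> 1"
  proof
    assume "r = 1"
    then have "cos (2 * pi * (real a - real b) / N) = 1" by (simp add: r_def complex_eq_iff)
    then obtain k :: int where k: "2 * pi * (real a - real b) / N = k * 2 * pi"
      using cos_one_2pi_int by auto
    then have "2 * pi * ((real a - real b) / N) = 2 * pi * k" by simp
    then have "(real a - real b) / N = k" using pi_gt_zero by (metis mult_cancel_left mult_eq_0_iff pi_neq_zero zero_neq_numeral)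
    then have "real a - real b = k * N" using N by (simp add: divide_eq_eq)
    then have kN: "int a - int b = k * int N" by (metis of_int_diff of_int_eq_iff of_int_mult of_int_of_nat_eq)
    then have "k \<noteq> 0" using False by auto
    then have "1 \<le> \<bar>k\<bar>" by linarith
    then have "int N \<le> \<bar>k * int N\<bar>" using mult_right_mono[of 1 "\<bar>k\<bar>" "int N"] by (simp add: abs_mult)
    then show False using kN assms by linarith
  qed
  then show ?thesis using False rN geometric_sum[of r N] by (simp add: rl)
qed

text \<open>All exponents that occur are below \<open>d + M\<close>, so the roots of unity of that
  order produce no aliasing. The sum counts pairs with i + k = j among indices below
  \<open>M\<close>; the truncated subtraction \<open>M - k\<close> makes the result zero for
  \<open>k \<ge> M\<close>.\<close>

lemma fejer_sum:
  assumes "k < d" "M > 0"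
  defines "z \<equiv> \<lambda>l. cis (2 * pi * real l / real (d + M))"
  shows "(\<Sum>l<d + M. of_real ((cmod (\<Sum>i<M. z l ^ i))\<^sup>2 / (real (d + M) * M)) * z l ^ k)
    = complex_of_real (real (M - k) / M)"
proof -
  let ?N = "d + M"
  have "of_real ((cmod (\<Sum>i<M. z l ^ i))\<^sup>2) * z l ^ k = (\<Sum>i<M. \<Sum>j<M. z l ^ (i + k) * cnj (z l) ^ j)" for l
  proof -
    have "of_real ((cmod (\<Sum>i<M. z l ^ i))\<^sup>2) = (\<Sum>i<M. z l ^ i) * (\<Sum>j<M. cnj (z l) ^ j)"
      using complex_norm_square[of "\<Sum>i<M. z l ^ i"] by simp
    then show ?thesis unfolding sum_product by (simp only: sum_distrib_left sum_distrib_right power_add mult_ac)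
  qed
  then have "(\<Sum>l<?N. of_real ((cmod (\<Sum>i<M. z l ^ i))\<^sup>2) * z l ^ k)
      = (\<Sum>l<?N. \<Sum>i<M. \<Sum>j<M. z l ^ (i + k) * cnj (z l) ^ j)" by simp
  also have "\<dots> = (\<Sum>i<M. \<Sum>j<M. \<Sum>l<?N. z l ^ (i + k) * cnj (z l) ^ j)"
    by (subst sum.swap, rule sum.cong[OF refl], subst sum.swap) (rule refl)
  also have "\<dots> = (\<Sum>i<M. \<Sum>j<M. if i + k = j then of_nat ?N else 0)"
  proof (intro sum.cong refl)
    fix i j assume "i \<in> {..<M}" "j \<in> {..<M}"
    then show "(\<Sum>l<?N. z l ^ (i + k) * cnj (z l) ^ j) = (if i + k = j then of_nat ?N else 0)"
      unfolding z_def using assms(1) by (intro sum_roots_of_unity) auto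
  qed
  also have "\<dots> = (\<Sum>i<M. if i + k < M then of_nat ?N else 0)"
    by (intro sum.cong refl) (simp add: sum.delta)
  also have "\<dots> = (\<Sum>i\<in>{i. i < M - k}. of_nat ?N)"
    by (rule sum.mono_neutral_cong_right) auto
  finally have *: "(\<Sum>l<?N. of_real ((cmod (\<Sum>i<M. z l ^ i))\<^sup>2) * z l ^ k) = complex_of_real (real (M - k) * real ?N)"
    by simp
  have "(\<Sum>l<?N. of_real ((cmod (\<Sum>i<M. z l ^ i))\<^sup>2 / (real ?N * M)) * z l ^ k)
      = (\<Sum>l<?N. of_real ((cmod (\<Sum>i<M. z l ^ i))\<^sup>2) * z l ^ k) / of_real (real ?N * M)"
    by (simp add: sum_divide_distrib)
  also have "\<dots> = complex_of_real (real (M - k) / M)"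
    unfolding * using assms(2) by (simp del: of_nat_add of_real_mult add: of_real_divide[symmetric])
  finally show ?thesis .
qed

context banach_algebra
begin

primrec psum :: "(nat \<Rightarrow> 'b) \<Rightarrow> nat \<Rightarrow> 'b" where
  "psum P 0 = \<zero>"
| "psum P (Suc d) = psum P d \<oplus> P d"

lemma psum_closed [simp]: "(\<And>k. P k \<in> carrier B) \<Longrightarrow> psum P d \<in> carrier B"
  by (induction d) auto

lemma psum_cong: "(\<And>k. k < d \<Longrightarrow> P k = Q k) \<Longrightarrow> psum P d = psum Q d"
  by (induction d) auto

lemma psum_add: "(\<And>k. P k \<in> carrier B) \<Longrightarrow> (\<And>k. Q k \<in> carrier B) \<Longrightarrow>
    psum (\<lambda>k. P k \<oplus> Q k) d = psum P d \<oplus> psum Q d"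
  by (induction d) (auto simp: M.a_ac)

lemma psum_scale: "(\<And>k. P k \<in> carrier B) \<Longrightarrow> psum (\<lambda>k. c \<odot> P k) d = c \<odot> psum P d"
  by (induction d) (auto simp: scale_add_right)

lemma psum_mult: "(\<And>k. P k \<in> carrier B) \<Longrightarrow> x \<in> carrier B \<Longrightarrow> psum (\<lambda>k. P k \<otimes> x) d = psum P d \<otimes> x"
  by (induction d) (auto simp: mult_distr_left)

lemma psum_extend: "(\<And>k. P k \<in> carrier B) \<Longrightarrow> (\<And>k. k \<ge> d \<Longrightarrow> P k = \<zero>) \<Longrightarrow> d \<le> d' \<Longrightarrow> psum P d' = psum P d"
  by (induction d') (auto simp: le_Suc_eq)

lemma psum_single:
  assumes "p \<in> carrier B" shows "psum (\<lambda>j. if j = k then p else \<zero>) d = (if k < d then p else \<zero>)"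
  using assms by (induction d) auto

lemma psum_Suc_shift: "(\<And>k. P k \<in> carrier B) \<Longrightarrow> P 0 = \<zero> \<Longrightarrow> psum P (Suc d) = psum (\<lambda>k. P (Suc k)) d"
  by (induction d) auto

lemma vnorm_psum_le: "(\<And>k. P k \<in> carrier B) \<Longrightarrow> vnorm B (psum P d) \<le> (\<Sum>k<d. vnorm B (P k))"
proof (induction d)
  case (Suc d)
  then show ?case using vnorm_triangle[of "psum P d" "P d"] by fastforce
qed auto

end

context toeplitz_system
begin

text \<open>The coefficients of \<open>c \<otimes> t \<xi>\<close> when \<open>C\<close> are those
  of \<open>c\<close>: \<open>\<xi>\<close> consumes the first edge \<open>i\<close> of the path,
  and the remaining path starts at \<open>\<sigma> i x\<close>. The value 0 at the empty word
  reflects that \<open>t \<xi>\<close> raises the degree.\<close>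

definition shift :: "(nat list \<Rightarrow> 'a \<Rightarrow> complex) \<Rightarrow> (nat \<times> 'a \<Rightarrow> complex) \<Rightarrow> nat list \<Rightarrow> 'a \<Rightarrow> complex" where
  "shift C \<xi> w x = (case w of [] \<Rightarrow> 0 | i # v \<Rightarrow> C v (\<sigma> i x) * \<xi> (i, x))"

lemma shift_simps [simp]: "shift C \<xi> [] x = 0" "shift C \<xi> (i # v) x = C v (\<sigma> i x) * \<xi> (i, x)"
  by (simp_all add: shift_def)

text \<open>A word \<open>w\<close> lists the edges of a path starting at \<open>x\<close> in the order in which they are traversed, so
  that right multiplication by \<open>t \<xi>\<close> acts on the head of the list. The coefficient functions \<open>C\<close> of \<open>p\<close>
  are in general determined by \<open>p\<close> on \<open>spec\<close> only.\<close>

inductive homog :: "nat \<Rightarrow> 'b \<Rightarrow> (nat list \<Rightarrow> 'a \<Rightarrow> complex) \<Rightarrow> bool" where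
  homog_zero: "homog k \<zero> (\<lambda>w x. 0)"
| homog_pi: "f \<in> C0 \<Omega> \<Longrightarrow> homog 0 (\<pi> f) (\<lambda>w x. if w = [] then f x else 0)"
| homog_t: "\<xi> \<in> X \<Longrightarrow> homog (Suc 0) (t \<xi>) (shift (\<lambda>w x. if w = [] then 1 else 0) \<xi>)"
| homog_mult: "homog (Suc k) p C \<Longrightarrow> \<xi> \<in> X \<Longrightarrow> homog (Suc (Suc k)) (p \<otimes> t \<xi>) (shift C \<xi>)"
| homog_add: "homog k p C \<Longrightarrow> homog k q D \<Longrightarrow> homog k (p \<oplus> q) (\<lambda>w x. C w x + D w x)"

lemma homog_closed [intro, simp]: "homog k p C \<Longrightarrow> p \<in> carrier T"
  by (induction rule: homog.induct) auto

definition W :: "nat \<Rightarrow> nat list set" where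
  "W k = {w. set w \<subseteq> {1..n} \<and> length w = k}"

lemma finite_W [simp]: "finite (W k)"
  unfolding W_def by (rule finite_lists_length_eq) simp

lemma W_0: "W 0 = {[]}"
  by (auto simp: W_def)

lemma sum_W_Suc: "(\<Sum>w\<in>W (Suc k). f w) = (\<Sum>i=1..n. \<Sum>v\<in>W k. f (i # v))"
proof -
  have "W (Suc k) = (\<lambda>(i, v). i # v) ` ({1..n} \<times> W k)"
    by (auto simp: W_def length_Suc_conv image_iff)
  then have "(\<Sum>w\<in>W (Suc k). f w) = (\<Sum>(i, v)\<in>{1..n} \<times> W k. f (i # v))"
    by (simp add: sum.reindex inj_on_def case_prod_unfold)
  then show ?thesis by (simp add: sum.cartesian_product)
qed

lemma X_support: "\<xi> \<in> X \<Longrightarrow> \<xi> (i, x) \<noteq> 0 \<Longrightarrow> i \<in> {1..n}"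
  using C0_zero[of \<xi> "edge_space n \<Omega>" "(i, x)"] by auto

lemma homog_support: "homog k p C \<Longrightarrow> C w x \<noteq> 0 \<Longrightarrow> w \<in> W k"
proof (induction arbitrary: w x rule: homog.induct)
  case (homog_t \<xi>)
  then show ?case using X_support[OF homog_t(1)] by (cases w) (auto simp: W_def split: if_splits)
next
  case (homog_mult k p C \<xi>)
  then show ?case using X_support[OF homog_mult(2)] by (cases w) (auto simp: W_def)
next
  case (homog_add k p C q D)
  then show ?case by (metis add.right_neutral)
qed (auto simp: W_def split: if_splits)

text \<open>The function-valued inner product of the \<open>k\<close>-th tensor power of the
  correspondence, in path coordinates.\<close>

definition inner :: "nat \<Rightarrow> (nat list \<Rightarrow> 'a \<Rightarrow> complex) \<Rightarrow> (nat list \<Rightarrow> 'a \<Rightarrow> complex) \<Rightarrow> 'a \<Rightarrow> complex" where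
  "inner k C D x = (\<Sum>w\<in>W k. cnj (C w x) * D w x)"

definition has_inner where
  "has_inner k p C q D \<longleftrightarrow> inner k C D \<in> C0 \<Omega> \<and> star T p \<otimes> q = \<pi> (inner k C D)"

lemma has_inner_zero:
  "p \<in> carrier T \<Longrightarrow> has_inner k p C \<zero> (\<lambda>w x. 0)" "p \<in> carrier T \<Longrightarrow> has_inner k \<zero> (\<lambda>w x. 0) p C"
  by (simp_all add: has_inner_def inner_def[abs_def] C0_zero_fun pi_zero)

lemma has_inner_add_right:
  assumes "has_inner k p C q D" "has_inner k p C q' D'" "p \<in> carrier T" "q \<in> carrier T" "q' \<in> carrier T"
  shows "has_inner k p C (q \<oplus> q') (\<lambda>w x. D w x + D' w x)"
proof -
  have "inner k C (\<lambda>w x. D w x + D' w x) = (\<lambda>x. inner k C D x + inner k C D' x)"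
    by (simp add: inner_def[abs_def] sum.distrib distrib_left)
  then show ?thesis using assms by (simp add: has_inner_def mult_distr_right pi_add C0_add)
qed

lemma has_inner_add_left:
  assumes "has_inner k p C q D" "has_inner k p' C' q D" "p \<in> carrier T" "q \<in> carrier T" "p' \<in> carrier T"
  shows "has_inner k (p \<oplus> p') (\<lambda>w x. C w x + C' w x) q D"
proof -
  have "inner k (\<lambda>w x. C w x + C' w x) D = (\<lambda>x. inner k C D x + inner k C' D x)"
    by (simp add: inner_def[abs_def] sum.distrib distrib_right)
  then show ?thesis using assms by (simp add: has_inner_def star_add mult_distr_left pi_add C0_add)
qed

text \<open>The inner product of the two left factors is some \<open>\<pi> g\<close>; it passes into
  \<open>t \<eta>\<close> by the left action, and \<open>t_star_t\<close> evaluates what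
  remains.\<close>

lemma has_inner_shift:
  assumes "has_inner k p C q D" "p \<in> carrier T" "q \<in> carrier T" "\<xi> \<in> X" "\<eta> \<in> X"
  shows "has_inner (Suc k) (p \<otimes> t \<xi>) (shift C \<xi>) (q \<otimes> t \<eta>) (shift D \<eta>)"
proof -
  let ?g = "inner k C D"
  have g: "?g \<in> C0 \<Omega>" "star T p \<otimes> q = \<pi> ?g" using assms by (auto simp: has_inner_def)
  have \<zeta>: "(\<lambda>(i, x). ?g (\<sigma> i x) * \<eta> (i, x)) \<in> X" by (rule X_lact[OF assms(5) g(1)])
  have eq: "inner (Suc k) (shift C \<xi>) (shift D \<eta>)
      = (\<lambda>x. \<Sum>i=1..n. cnj (\<xi> (i, x)) * (\<lambda>(i, x). ?g (\<sigma> i x) * \<eta> (i, x)) (i, x))"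
    unfolding inner_def[abs_def] sum_W_Suc
    by (simp add: sum_distrib_left sum_distrib_right mult_ac)
  have "star T (p \<otimes> t \<xi>) \<otimes> (q \<otimes> t \<eta>) = star T (t \<xi>) \<otimes> ((star T p \<otimes> q) \<otimes> t \<eta>)"
    using assms by (simp add: star_mult mult_assoc)
  also have "\<dots> = \<pi> (inner (Suc k) (shift C \<xi>) (shift D \<eta>))"
    unfolding g pi_t[OF g(1) assms(5)] t_star_t[OF assms(4) \<zeta>] eq ..
  finally show ?thesis using inner_X[OF assms(4) \<zeta>] by (simp add: has_inner_def eq)
qed

text \<open>Both elements have the same degree, so factors \<open>t\<close> can be peeled off from
  both in parallel; the nested induction runs over the derivation for \<open>q\<close>.\<close>

lemma homog_has_inner: "homog k p C \<Longrightarrow> homog k q D \<Longrightarrow> has_inner k p C q D"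
proof (induction arbitrary: q D rule: homog.induct)
  case (homog_zero k) then show ?case by (simp add: has_inner_zero)
next
  case (homog_pi f)
  show ?case using homog_pi(2)
  proof (induction "0::nat" q D rule: homog.induct)
    case (homog_pi g)
    then show ?case using \<open>f \<in> C0 \<Omega>\<close>
      by (simp add: has_inner_def inner_def[abs_def] W_0 C0_mult C0_cnj pi_mult pi_star)
  next
    case (homog_add p C q D)
    then show ?case using \<open>f \<in> C0 \<Omega>\<close> by (intro has_inner_add_right) auto
  qed (use homog_pi in \<open>simp_all add: has_inner_zero\<close>)
next
  case (homog_t \<xi>)
  show ?case using homog_t(2)
  proof (induction "Suc 0" q D rule: homog.induct)
    case (homog_t \<eta>)
    have "inner (Suc 0) (shift (\<lambda>w x. if w = [] then 1 else 0) \<xi>) (shift (\<lambda>w x. if w = [] then 1 else 0) \<eta>)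
      = (\<lambda>x. \<Sum>i=1..n. cnj (\<xi> (i, x)) * \<eta> (i, x))"
      by (simp add: inner_def[abs_def] sum_W_Suc W_0)
    then show ?case using \<open>\<xi> \<in> X\<close> homog_t inner_X by (simp add: has_inner_def t_star_t del: One_nat_def)
  next
    case (homog_add p C q D)
    then show ?case using \<open>\<xi> \<in> X\<close> by (intro has_inner_add_right) auto
  qed (use homog_t in \<open>simp_all add: has_inner_zero\<close>)
next
  case (homog_mult k p C \<xi>)
  show ?case using homog_mult(4)
  proof (induction "Suc (Suc k)" q D rule: homog.induct)
    case (homog_mult q D \<eta>)
    then show ?case using \<open>homog (Suc k) p C\<close> \<open>\<xi> \<in> X\<close> homog_mult.hyps \<open>\<And>q D. homog (Suc k) q D \<Longrightarrow> has_inner (Suc k) p C q D\<close>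
      by (intro has_inner_shift) auto
  next
    case (homog_add p' C' q D)
    then show ?case using \<open>homog (Suc k) p C\<close> \<open>\<xi> \<in> X\<close> by (intro has_inner_add_right) auto
  qed (use homog_mult in \<open>simp_all add: has_inner_zero\<close>)
next
  case (homog_add k p C q' D')
  then show ?case by (intro has_inner_add_left) auto
qed

lemma homog_norm:
  assumes "homog k p C"
  shows "(\<lambda>x. complex_of_real (\<Sum>w\<in>W k. (cmod (C w x))\<^sup>2)) \<in> C0 \<Omega>"
    and "(vnorm T p)\<^sup>2 = vnorm T (\<pi> (\<lambda>x. complex_of_real (\<Sum>w\<in>W k. (cmod (C w x))\<^sup>2)))"
proof -
  have eq: "inner k C C = (\<lambda>x. complex_of_real (\<Sum>w\<in>W k. (cmod (C w x))\<^sup>2))"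
    by (simp add: inner_def[abs_def] mult.commute complex_norm_square flip: of_real_power)
  show "(\<lambda>x. complex_of_real (\<Sum>w\<in>W k. (cmod (C w x))\<^sup>2)) \<in> C0 \<Omega>"
    "(vnorm T p)\<^sup>2 = vnorm T (\<pi> (\<lambda>x. complex_of_real (\<Sum>w\<in>W k. (cmod (C w x))\<^sup>2)))"
    using homog_has_inner[OF assms assms] cstar_identity[of p] assms unfolding has_inner_def eq by auto
qed

lemma homog_coeff_le:
  assumes "homog k p C" "x \<in> spec"
  shows "cmod (C w x) \<le> vnorm T p"
proof (cases "C w x = 0")
  case False
  then have w: "w \<in> W k" by (rule homog_support[OF assms(1)])
  have "(cmod (C w x))\<^sup>2 \<le> (\<Sum>w\<in>W k. (cmod (C w x))\<^sup>2)" by (rule member_le_sum[OF w]) auto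
  also have "\<dots> \<le> (vnorm T p)\<^sup>2" using spec_lower[OF homog_norm(1)[OF assms(1)] assms(2)] homog_norm(2)[OF assms(1)] by simp
  finally show ?thesis by (rule power2_le_imp_le) (rule vnorm_nonneg[OF homog_closed[OF assms(1)]])
qed (use assms in simp)

text \<open>The constant depends on the degree alone. This is enough for
  \<open>has_coeffs_zero_imp_zero\<close>, which handles finitely many degrees at a time.\<close>

lemma homog_norm_le:
  fixes b :: real
  assumes "homog k p C" "0 \<le> b" "\<And>w x. x \<in> spec \<Longrightarrow> cmod (C w x) \<le> b"
  shows "vnorm T p \<le> sqrt (card (W k)) * b"
proof -
  have "(vnorm T p)\<^sup>2 \<le> card (W k) * b\<^sup>2"
    unfolding homog_norm(2)[OF assms(1)]
  proof (rule spec_upper[OF homog_norm(1)[OF assms(1)]])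
    fix x assume "x \<in> spec"
    then have "(\<Sum>w\<in>W k. (cmod (C w x))\<^sup>2) \<le> (\<Sum>w\<in>W k. b\<^sup>2)"
      using assms by (intro sum_mono power_mono) auto
    then show "(\<Sum>w\<in>W k. (cmod (C w x))\<^sup>2) \<le> card (W k) * b\<^sup>2" by simp
  qed (auto simp: sum_nonneg)
  then have "vnorm T p \<le> sqrt (card (W k) * b\<^sup>2)" by (rule real_le_rsqrt)
  then show ?thesis using assms(2) by (simp add: real_sqrt_mult)
qed

lemma homog_gauge: assumes "cmod z = 1" shows "homog k p C \<Longrightarrow> \<gamma> z p = z ^ k \<odot> p"
proof (induction rule: homog.induct)
  case (homog_zero k)
  show ?case using star_homD(3)[OF \<gamma>_hom[OF assms], of \<zero> 0] star_homD(1)[OF \<gamma>_hom[OF assms], of \<zero>] by simp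
next
  case (homog_mult k p C \<xi>)
  then show ?case using star_homD(4)[OF \<gamma>_hom[OF assms], of p "t \<xi>"] \<gamma>_t[OF assms]
    by (simp add: smult_mult_left smult_mult_right mult_ac)
next
  case (homog_add k p C q D)
  then show ?case using star_homD(2)[OF \<gamma>_hom[OF assms], of p q] by (simp add: scale_add_right)
qed (use \<gamma>_t[OF assms] \<gamma>_pi[OF assms] in simp_all)

lemma homog_scale: "homog k p C \<Longrightarrow> homog k (c \<odot> p) (\<lambda>w x. c * C w x)"
proof (induction rule: homog.induct)
  case (homog_zero k) then show ?case by (simp add: homog.homog_zero)
next
  case (homog_pi f)
  have "(\<lambda>(w :: nat list) x. c * (if w = [] then f x else 0)) = (\<lambda>w x. if w = [] then c * f x else 0)" by (auto simp: fun_eq_iff)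
  then show ?case using homog.homog_pi[OF C0_smult[OF homog_pi, of c]] homog_pi by (simp only: pi_scale)
next
  case (homog_t \<xi>)
  have "(\<lambda>w x. c * shift C \<xi> w x) = shift C (\<lambda>p. c * \<xi> p)" for C by (auto simp: fun_eq_iff shift_def split: list.split)
  then show ?case using homog.homog_t[OF C0_smult[OF homog_t, of c]] homog_t by (simp add: t_scale)
next
  case (homog_mult k p C \<xi>)
  have "(\<lambda>w x. c * shift C \<xi> w x) = shift (\<lambda>w x. c * C w x) \<xi>" by (auto simp: fun_eq_iff shift_def split: list.split)
  then show ?case using homog.homog_mult[OF homog_mult.IH homog_mult(2)] homog_mult by (simp add: smult_mult_left)
next
  case (homog_add k p C q D)
  then show ?case using homog.homog_add[OF homog_add.IH] by (simp add: scale_add_right distrib_left)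
qed

lemma shift_X_ract: "shift C (\<lambda>(i, x). \<xi> (i, x) * f x) = (\<lambda>w x. shift C \<xi> w x * f x)"
  by (auto simp: fun_eq_iff shift_def split: list.split)

lemma homog_mult_pi: assumes f: "f \<in> C0 \<Omega>" shows "homog k p C \<Longrightarrow> homog k (p \<otimes> \<pi> f) (\<lambda>w x. C w x * f x)"
proof (induction rule: homog.induct)
  case (homog_zero k) then show ?case using f by (simp add: homog.homog_zero)
next
  case (homog_pi g)
  have "(\<lambda>(w :: nat list) x. (if w = [] then g x else 0) * f x) = (\<lambda>w x. if w = [] then g x * f x else 0)" by (auto simp: fun_eq_iff)
  then show ?case using homog.homog_pi[OF C0_mult[OF homog_pi f]] homog_pi f by (simp only: pi_mult)
next
  case (homog_t \<xi>)
  then show ?case using homog.homog_t[OF X_ract[OF homog_t f]] f by (simp add: t_pi shift_X_ract)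
next
  case (homog_mult k p C \<xi>)
  then show ?case using homog.homog_mult[OF homog_mult(1) X_ract[OF homog_mult(2) f]] f
    by (simp add: t_pi shift_X_ract mult_assoc)
next
  case (homog_add k p C q D)
  then show ?case using homog.homog_add[OF homog_add.IH] f by (simp add: mult_distr_left distrib_right)
qed

lemma shift_zero: "shift (\<lambda>w x. 0) \<xi> = (\<lambda>w x. 0)"
  by (auto simp: fun_eq_iff shift_def split: list.split)

lemma shift_add: "shift (\<lambda>w x. C w x + D w x) \<xi> = (\<lambda>w x. shift C \<xi> w x + shift D \<xi> w x)"
  by (auto simp: fun_eq_iff shift_def distrib_right split: list.split)

text \<open>Since \<open>homog_mult\<close> starts in positive degree, degree zero is treated by
  folding \<open>\<pi> f \<otimes> t \<xi>\<close> into a single \<open>t\<close>.\<close>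

lemma homog_mult_t:
  assumes "homog k p C" and \<xi>: "\<xi> \<in> X"
  shows "homog (Suc k) (p \<otimes> t \<xi>) (shift C \<xi>)"
proof (cases k)
  case 0
  with assms have "homog 0 p C" by simp
  then have "homog (Suc 0) (p \<otimes> t \<xi>) (shift C \<xi>)"
  proof (induction "0::nat" p C rule: homog.induct)
    case homog_zero then show ?case using \<xi> by (simp add: shift_zero homog.homog_zero)
  next
    case (homog_pi f)
    have "shift (\<lambda>w x. if w = [] then f x else 0) \<xi> = shift (\<lambda>w x. if w = [] then 1 else 0) (\<lambda>(i, x). f (\<sigma> i x) * \<xi> (i, x))"
      by (auto simp: fun_eq_iff shift_def split: list.split)
    then show ?case using homog.homog_t[OF X_lact[OF \<xi> homog_pi]] \<xi> homog_pi by (simp add: pi_t)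
  next
    case (homog_add p C q D)
    then show ?case using homog.homog_add[of "Suc 0" "p \<otimes> t \<xi>"] \<xi> by (simp add: shift_add mult_distr_left)
  qed
  then show ?thesis using 0 by simp
qed (use assms in \<open>auto intro: homog_mult\<close>)

lemma gauge_psum:
  assumes "cmod z = 1" "\<And>k. homog k (P k) (C k)"
  shows "\<gamma> z (psum P d) = psum (\<lambda>k. z ^ k \<odot> P k) d"
proof (induction d)
  case 0 then show ?case using homog_gauge[OF assms(1) homog_zero[of 0]] by simp
next
  case (Suc d)
  have "P k \<in> carrier T" for k using assms(2) by (rule homog_closed)
  then show ?case using Suc star_homD(2)[OF \<gamma>_hom[OF assms(1)], of "psum P d" "P d"] homog_gauge[OF assms] by simp
qed

text \<open>Weighting degree \<open>k\<close> by a combination of the powers \<open>z l ^ k\<close>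
  amounts to the same combination of the contractive gauge maps
  \<open>\<gamma> (z l)\<close>.\<close>

lemma psum_multiplier_le:
  fixes a z :: "nat \<Rightarrow> complex"
  assumes P: "\<And>k. homog k (P k) (C k)" and z: "\<And>l. cmod (z l) = 1"
  shows "vnorm T (psum (\<lambda>k. (\<Sum>l<N. a l * z l ^ k) \<odot> P k) d) \<le> (\<Sum>l<N. cmod (a l)) * vnorm T (psum P d)"
proof (induction N)
  case 0
  have Pc: "P k \<in> carrier T" for k using P by (rule homog_closed)
  have "psum (\<lambda>k. 0 \<odot> P k) d = 0 \<odot> psum P d" by (rule psum_scale[OF Pc])
  then show ?case using Pc by simp
next
  case (Suc N)
  have Pc [simp]: "P k \<in> carrier T" for k using P by (rule homog_closed)
  have "psum (\<lambda>k. (\<Sum>l<Suc N. a l * z l ^ k) \<odot> P k) d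
      = psum (\<lambda>k. (\<Sum>l<N. a l * z l ^ k) \<odot> P k) d \<oplus> psum (\<lambda>k. a N \<odot> (z N ^ k \<odot> P k)) d"
    by (simp add: scale_add_left psum_add)
  also have "psum (\<lambda>k. a N \<odot> (z N ^ k \<odot> P k)) d = a N \<odot> \<gamma> (z N) (psum P d)"
    by (subst psum_scale) (auto simp: gauge_psum[OF z P])
  finally have "vnorm T (psum (\<lambda>k. (\<Sum>l<Suc N. a l * z l ^ k) \<odot> P k) d)
     \<le> vnorm T (psum (\<lambda>k. (\<Sum>l<N. a l * z l ^ k) \<odot> P k) d) + cmod (a N) * vnorm T (\<gamma> (z N) (psum P d))"
    using vnorm_triangle star_homD(1)[OF \<gamma>_hom[OF z]] by (simp add: vnorm_smult[symmetric])
  also have "\<dots> \<le> (\<Sum>l<N. cmod (a l)) * vnorm T (psum P d) + cmod (a N) * vnorm T (psum P d)"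
    using Suc \<gamma>_norm[OF z] by (intro add_mono mult_left_mono) auto
  finally show ?case by (simp add: distrib_right)
qed

text \<open>Discrete Fourier inversion over the roots of unity of order \<open>d\<close>: the
  weights single out degree \<open>k\<close> among those below \<open>d\<close>, and their moduli
  add up to one.\<close>

lemma psum_component_le:
  assumes P: "\<And>k. homog k (P k) (C k)" and k: "k < d"
  shows "vnorm T (P k) \<le> vnorm T (psum P d)"
proof -
  define z where "z l = cis (2 * pi * real l / real d)" for l :: nat
  define a where "a l = cnj (z l) ^ k / of_nat d" for l
  have z: "cmod (z l) = 1" for l by (simp add: z_def)
  have [simp]: "P j \<in> carrier T" for j using P by (rule homog_closed)
  have "(\<Sum>l<d. a l * z l ^ j) = (if j = k then 1 else 0)" if "j < d" for j
  proof -
    have "(\<Sum>l<d. a l * z l ^ j) = (\<Sum>l<d. z l ^ j * cnj (z l) ^ k) / of_nat d"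
      by (simp add: a_def sum_divide_distrib mult.commute)
    then show ?thesis using sum_roots_of_unity[OF that k] k by (simp add: z_def)
  qed
  then have "psum (\<lambda>j. (\<Sum>l<d. a l * z l ^ j) \<odot> P j) d = psum (\<lambda>j. if j = k then P k else \<zero>) d"
    by (intro psum_cong) auto
  also have "\<dots> = P k" using k by (simp add: psum_single)
  finally have "vnorm T (P k) \<le> (\<Sum>l<d. cmod (a l)) * vnorm T (psum P d)"
    using psum_multiplier_le[where z=z, OF P z, where a=a and N=d and d=d] by simp
  also have "(\<Sum>l<d. cmod (a l)) = 1" using k by (simp add: a_def norm_divide norm_power z)
  finally show ?thesis by simp
qed

text \<open>The Cesaro means are averages of the gauge action with the (positive) Fejer kernel as density.
  Since only finitely many degrees occur, roots of unity of high order replace the circle.\<close>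

lemma fejer_contractive:
  assumes P: "\<And>k. homog k (P k) (C k)" and M: "M > 0"
  shows "vnorm T (psum (\<lambda>k. complex_of_real (real (M - k) / M) \<odot> P k) d) \<le> vnorm T (psum P d)"
proof (cases "d = 0")
  case False
  define z where "z l = cis (2 * pi * real l / real (d + M))" for l :: nat
  define a where "a l = complex_of_real ((cmod (\<Sum>i<M. z l ^ i))\<^sup>2 / (real (d + M) * M))" for l
  have z: "cmod (z l) = 1" for l by (simp add: z_def)
  have s: "(\<Sum>l<d + M. a l * z l ^ k) = complex_of_real (real (M - k) / M)" if "k < d" for k
    unfolding a_def z_def by (rule fejer_sum[OF that M])
  have "psum (\<lambda>k. (\<Sum>l<d + M. a l * z l ^ k) \<odot> P k) d = psum (\<lambda>k. complex_of_real (real (M - k) / M) \<odot> P k) d"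
    by (intro psum_cong) (simp only: s)
  then have "vnorm T (psum (\<lambda>k. complex_of_real (real (M - k) / M) \<odot> P k) d) \<le> (\<Sum>l<d + M. cmod (a l)) * vnorm T (psum P d)"
    using psum_multiplier_le[where z=z, OF P z, where a=a and N="d + M" and d=d] by simp
  \<comment> \<open>The weights are nonnegative, so their total modulus is the multiplier in degree
    zero, which is 1.\<close>
  also have "(\<Sum>l<d + M. cmod (a l)) = 1"
  proof -
    have "complex_of_real (cmod (a l)) = a l" for l
      unfolding a_def by (subst norm_of_real, subst abs_of_nonneg) auto
    then have "complex_of_real (\<Sum>l<d + M. cmod (a l)) = (\<Sum>l<d + M. a l * z l ^ 0)" by simp
    also have "\<dots> = complex_of_real 1" using s[of 0] False M by simp
    finally show ?thesis by (simp only: of_real_eq_iff)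
  qed
  finally show ?thesis by simp
qed simp

end

section \<open>Fourier coefficients\<close>

context toeplitz_system
begin

definition cut :: "nat \<Rightarrow> (nat list \<Rightarrow> 'a \<Rightarrow> complex) \<Rightarrow> nat list \<Rightarrow> 'a \<Rightarrow> complex" where
  "cut k C w x = (if length w = k then C w x else 0)"

text \<open>One function \<open>C\<close> carries the coefficients of all degrees, told apart by the
  length of the word. The bound \<open>d\<close> is not meant to be sharp, so that two elements can
  be given a common one.\<close>

definition degree_parts :: "nat \<Rightarrow> (nat \<Rightarrow> 'b) \<Rightarrow> (nat list \<Rightarrow> 'a \<Rightarrow> complex) \<Rightarrow> bool" where
  "degree_parts d P C \<longleftrightarrow> (\<forall>k. homog k (P k) (cut k C)) \<and> (\<forall>k\<ge>d. P k = \<zero> \<and> cut k C = (\<lambda>w x. 0))"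

definition is_poly :: "'b \<Rightarrow> (nat list \<Rightarrow> 'a \<Rightarrow> complex) \<Rightarrow> bool" where
  "is_poly p C \<longleftrightarrow> (\<exists>d P. degree_parts d P C \<and> p = psum P d)"

lemma degree_partsD:
  assumes "degree_parts d P C"
  shows degree_parts_homog: "homog k (P k) (cut k C)" and degree_parts_zero: "k \<ge> d \<Longrightarrow> P k = \<zero>"
    and degree_parts_closed: "P k \<in> carrier T"
  using assms by (auto simp: degree_parts_def)

lemma degree_parts_extend:
  assumes "degree_parts d P C" "d \<le> d'"
  shows "degree_parts d' P C" "psum P d' = psum P d"
  using assms psum_extend[of P d d'] degree_parts_closed[OF assms(1)] by (auto simp: degree_parts_def)

lemma poly_closed [simp, intro]: "is_poly p C \<Longrightarrow> p \<in> carrier T"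
  by (auto simp: is_poly_def degree_parts_closed)

lemma homog_imp_poly:
  assumes p: "homog k p C" shows "is_poly p C"
proof -
  have cut: "cut j C = (if j = k then C else (\<lambda>w x. 0))" for j
    using homog_support[OF p] by (auto simp: cut_def fun_eq_iff W_def)
  have "degree_parts (Suc k) (\<lambda>j. if j = k then p else \<zero>) C"
    using p by (auto simp: degree_parts_def cut homog_zero)
  moreover have "p = psum (\<lambda>j. if j = k then p else \<zero>) (Suc k)" using p by (subst psum_single) auto
  ultimately show ?thesis unfolding is_poly_def by blast
qed

lemma degree_parts_add:
  assumes "degree_parts d P C" "degree_parts d Q D"
  shows "degree_parts d (\<lambda>k. P k \<oplus> Q k) (\<lambda>w x. C w x + D w x)"
proof -
  have "cut k (\<lambda>w x. C w x + D w x) = (\<lambda>w x. cut k C w x + cut k D w x)" for k by (auto simp: cut_def fun_eq_iff)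
  then show ?thesis using assms by (auto simp: degree_parts_def intro: homog_add)
qed

lemma degree_parts_scale:
  assumes "degree_parts d P C"
  shows "degree_parts d (\<lambda>k. c \<odot> P k) (\<lambda>w x. c * C w x)"
proof -
  have "cut k (\<lambda>w x. c * C w x) = (\<lambda>w x. c * cut k C w x)" for k by (auto simp: cut_def fun_eq_iff)
  then show ?thesis using assms by (auto simp: degree_parts_def intro: homog_scale)
qed

lemma poly_add:
  assumes "is_poly p C" "is_poly q D" shows "is_poly (p \<oplus> q) (\<lambda>w x. C w x + D w x)"
proof -
  obtain d P e Q where *: "degree_parts d P C" "p = psum P d" "degree_parts e Q D" "q = psum Q e"
    using assms by (auto simp: is_poly_def)
  let ?m = "max d e"
  have P: "degree_parts ?m P C" "psum P ?m = p" and Q: "degree_parts ?m Q D" "psum Q ?m = q"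
    using degree_parts_extend[OF *(1), of ?m] degree_parts_extend[OF *(3), of ?m] * by auto
  show ?thesis unfolding is_poly_def
    using degree_parts_add[OF P(1) Q(1)] psum_add[of P Q ?m] degree_parts_closed[OF P(1)] degree_parts_closed[OF Q(1)] P(2) Q(2)
    by metis
qed

lemma poly_scale:
  assumes "is_poly p C" shows "is_poly (c \<odot> p) (\<lambda>w x. c * C w x)"
proof -
  obtain d P where *: "degree_parts d P C" "p = psum P d" using assms by (auto simp: is_poly_def)
  show ?thesis unfolding is_poly_def
    using degree_parts_scale[OF *(1), of c] psum_scale[of P c d] degree_parts_closed[OF *(1)] *(2) by metis
qed

lemma poly_zero: "is_poly \<zero> (\<lambda>w x. 0)"
  by (rule homog_imp_poly[OF homog_zero])

lemma poly_mult_pi: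
  assumes "is_poly p C" and f: "f \<in> C0 \<Omega>" shows "is_poly (p \<otimes> \<pi> f) (\<lambda>w x. C w x * f x)"
proof -
  obtain d P where *: "degree_parts d P C" "p = psum P d" using assms by (auto simp: is_poly_def)
  have "cut k (\<lambda>w x. C w x * f x) = (\<lambda>w x. cut k C w x * f x)" for k by (auto simp: cut_def fun_eq_iff)
  then have "degree_parts d (\<lambda>k. P k \<otimes> \<pi> f) (\<lambda>w x. C w x * f x)"
    using *(1) f by (auto simp: degree_parts_def intro: homog_mult_pi)
  then show ?thesis unfolding is_poly_def
    using psum_mult[of P "\<pi> f" d] degree_parts_closed[OF *(1)] *(2) f by (metis pi_closed)
qed

lemma poly_mult_t:
  assumes "is_poly p C" and \<xi>: "\<xi> \<in> X" shows "is_poly (p \<otimes> t \<xi>) (shift C \<xi>)"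
proof -
  obtain d P where *: "degree_parts d P C" "p = psum P d" using assms by (auto simp: is_poly_def)
  \<comment> \<open>Right multiplication by \<open>t \<xi>\<close> raises every degree by one and
    leaves degree zero empty.\<close>
  define Q where "Q k = (case k of 0 \<Rightarrow> \<zero> | Suc j \<Rightarrow> P j \<otimes> t \<xi>)" for k
  have cut0: "cut 0 (shift C \<xi>) = (\<lambda>w x. 0)" and cutS: "cut (Suc k) (shift C \<xi>) = shift (cut k C) \<xi>" for k
    by (auto simp: cut_def fun_eq_iff shift_def split: list.split)
  have Q: "degree_parts (Suc d) Q (shift C \<xi>)"
    unfolding degree_parts_def
  proof (intro conjI allI impI)
    show "homog k (Q k) (cut k (shift C \<xi>))" for k
      using homog_mult_t[OF degree_parts_homog[OF *(1)] \<xi>]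
      by (cases k) (simp_all add: Q_def cut0 cutS homog_zero)
    fix k assume "Suc d \<le> k"
    then obtain j where "k = Suc j" "d \<le> j" by (metis Suc_le_D Suc_le_mono)
    then show "Q k = \<zero>" "cut k (shift C \<xi>) = (\<lambda>w x. 0)"
      using *(1) \<xi> by (auto simp: Q_def cutS degree_parts_def shift_zero)
  qed
  have "psum Q (Suc d) = psum (\<lambda>k. Q (Suc k)) d"
    by (rule psum_Suc_shift) (use degree_parts_closed[OF Q] in \<open>auto simp: Q_def\<close>)
  also have "\<dots> = p \<otimes> t \<xi>"
    using psum_mult[of P "t \<xi>" d] degree_parts_closed[OF *(1)] *(2) \<xi> by (simp add: Q_def)
  finally show ?thesis unfolding is_poly_def using Q by metis
qed

lemma poly_coeff_le:
  assumes "is_poly p C" "x \<in> spec" shows "cmod (C w x) \<le> vnorm T p"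
proof -
  obtain d P where *: "degree_parts d P C" "p = psum P d" using assms by (auto simp: is_poly_def)
  let ?k = "length w"
  have *: "degree_parts (max d (Suc ?k)) P C" "p = psum P (max d (Suc ?k))"
    using degree_parts_extend[OF *(1), of "max d (Suc ?k)"] *(2) by auto
  have "cmod (C w x) = cmod (cut ?k C w x)" by (simp add: cut_def)
  also have "\<dots> \<le> vnorm T (P ?k)" by (rule homog_coeff_le[OF degree_parts_homog[OF *(1)] assms(2)])
  also have "\<dots> \<le> vnorm T p" unfolding *(2) by (rule psum_component_le[OF degree_parts_homog[OF *(1)]]) simp
  finally show ?thesis .
qed

text \<open>A relation, since values off \<open>spec\<close> are arbitrary. The same polynomial
  approximates the element and, uniformly on \<open>spec\<close>, its coefficients; so bounded
  operations pass from polynomials to limits.\<close>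

definition has_coeffs :: "'b \<Rightarrow> (nat list \<Rightarrow> 'a \<Rightarrow> complex) \<Rightarrow> bool" where
  "has_coeffs c C \<longleftrightarrow> c \<in> carrier T \<and>
     (\<forall>e>0. \<exists>p D. is_poly p D \<and> vnorm T (c \<ominus> p) < e \<and> (\<forall>w. \<forall>x\<in>spec. cmod (C w x - D w x) < e))"

lemma has_coeffsE:
  assumes "has_coeffs c C" "e > 0"
  obtains p D where "is_poly p D" "p \<in> carrier T" "vnorm T (c \<ominus> p) < e" "\<And>w x. x \<in> spec \<Longrightarrow> cmod (C w x - D w x) < e"
  using assms unfolding has_coeffs_def by (meson poly_closed)

lemma has_coeffs_carrier: "has_coeffs c C \<Longrightarrow> c \<in> carrier T"
  by (simp add: has_coeffs_def)

lemma has_coeffs_le: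
  assumes c: "has_coeffs c C" and x: "x \<in> spec" shows "cmod (C w x) \<le> vnorm T c"
proof (rule field_le_epsilon)
  fix e :: real assume "e > 0"
  then obtain p D where p: "is_poly p D" "p \<in> carrier T" "vnorm T (c \<ominus> p) < e/2"
    "\<And>w x. x \<in> spec \<Longrightarrow> cmod (C w x - D w x) < e/2"
    using has_coeffsE[OF c, of "e/2"] by (metis half_gt_zero)
  have cT: "c \<in> carrier T" using c by (rule has_coeffs_carrier)
  have "cmod (C w x) \<le> cmod (D w x) + cmod (C w x - D w x)" using norm_triangle_ineq2[of "C w x" "D w x"] by simp
  also have "\<dots> \<le> vnorm T p + e/2" using poly_coeff_le[OF p(1) x] p(4)[OF x, of w] by (intro add_mono) (auto intro: less_imp_le)
  also have "vnorm T p \<le> vnorm T c + vnorm T (p \<ominus> c)" using p cT by (intro vnorm_le_add_minus) auto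
  also have "vnorm T (p \<ominus> c) < e/2" using p cT vnorm_minus_commute[of p c] by simp
  finally show "cmod (C w x) \<le> vnorm T c + e" by simp
qed

text \<open>\<open>f\<close> acts on elements and \<open>g\<close> on coefficients. The inner
  premise of \<open>gK\<close> is uniform in words and points because \<open>shift\<close> relates a
  coefficient at \<open>x\<close> to one at another point.\<close>

lemma has_coeffs_lipschitz_image:
  assumes c: "has_coeffs c C" and K: "0 \<le> K"
    and f: "f c \<in> carrier T" "\<And>p D. is_poly p D \<Longrightarrow> is_poly (f p) (g D)"
    and fK: "\<And>p. p \<in> carrier T \<Longrightarrow> vnorm T (f c \<ominus> f p) \<le> K * vnorm T (c \<ominus> p)"
    and gK: "\<And>D e w x. x \<in> spec \<Longrightarrow> (\<And>w x. x \<in> spec \<Longrightarrow> cmod (C w x - D w x) < e) \<Longrightarrow> cmod (g C w x - g D w x) \<le> K * e"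
  shows "has_coeffs (f c) (g C)"
  unfolding has_coeffs_def
proof (intro conjI allI impI f(1))
  fix e :: real assume e: "e > 0"
  define e' where "e' = e / (K + 1)"
  have e': "e' > 0" "K * e' < e" using e K by (auto simp: e'_def field_simps)
  obtain p D where p: "is_poly p D" "p \<in> carrier T" "vnorm T (c \<ominus> p) < e'" "\<And>w x. x \<in> spec \<Longrightarrow> cmod (C w x - D w x) < e'"
    using has_coeffsE[OF c e'(1)] by metis
  show "\<exists>p D. is_poly p D \<and> vnorm T (f c \<ominus> p) < e \<and> (\<forall>w. \<forall>x\<in>spec. cmod (g C w x - D w x) < e)"
  proof (intro exI conjI allI ballI)
    show "is_poly (f p) (g D)" by (rule f(2)[OF p(1)])
    have "vnorm T (f c \<ominus> f p) \<le> K * e'" using fK[OF p(2)] mult_left_mono[OF less_imp_le[OF p(3)] K] by linarith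
    then show "vnorm T (f c \<ominus> f p) < e" using e'(2) by linarith
    show "cmod (g C w x - g D w x) < e" if "x \<in> spec" for w x
      using gK[OF that p(4), of w] e'(2) by (rule le_less_trans)
  qed
qed

lemma has_coeffs_scale: assumes "has_coeffs c C" shows "has_coeffs (a \<odot> c) (\<lambda>w x. a * C w x)"
proof (rule has_coeffs_lipschitz_image[where K="cmod a" and g="\<lambda>C w x. a * C w x" and f="\<lambda>c. a \<odot> c", OF assms])
  fix D w x and e :: real assume "x \<in> spec" "\<And>w x. x \<in> spec \<Longrightarrow> cmod (C w x - D w x) < e"
  then have "cmod a * cmod (C w x - D w x) \<le> cmod a * e" by (simp add: mult_left_mono less_imp_le)
  then show "cmod (a * C w x - a * D w x) \<le> cmod a * e" by (simp add: norm_mult flip: right_diff_distrib)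
next
  show "vnorm T (a \<odot> c \<ominus> a \<odot> p) \<le> cmod a * vnorm T (c \<ominus> p)" if "p \<in> carrier T" for p
    using that has_coeffs_carrier[OF assms] by (simp add: scale_minus[symmetric] vnorm_smult)
qed (use has_coeffs_carrier[OF assms] in \<open>auto intro: poly_scale\<close>)

lemma has_coeffs_mult_pi:
  assumes c: "has_coeffs c C" and f: "f \<in> C0 \<Omega>" shows "has_coeffs (c \<otimes> \<pi> f) (\<lambda>w x. C w x * f x)"
proof -
  obtain b where b: "b > 0" "\<And>x. cmod (f x) \<le> b" using C0_bdd[OF f] by metis
  note cT = has_coeffs_carrier[OF c]
  show ?thesis
  proof (rule has_coeffs_lipschitz_image[where K=b and g="\<lambda>C w x. C w x * f x" and f="\<lambda>c. c \<otimes> \<pi> f", OF c])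
    fix D w x and e :: real assume "x \<in> spec" "\<And>w x. x \<in> spec \<Longrightarrow> cmod (C w x - D w x) < e"
    then have "cmod (C w x - D w x) \<le> e" by (simp add: less_imp_le)
    then have "cmod (f x) * cmod (C w x - D w x) \<le> b * e" using b by (intro mult_mono) auto
    then show "cmod (C w x * f x - D w x * f x) \<le> b * e"
      by (simp only: norm_mult mult.commute[of _ "f x"] right_diff_distrib[symmetric])
  next
    fix p assume p: "p \<in> carrier T"
    have "vnorm T (c \<otimes> \<pi> f \<ominus> p \<otimes> \<pi> f) \<le> vnorm T (c \<ominus> p) * vnorm T (\<pi> f)"
      using p cT f vnorm_mult[of "c \<ominus> p" "\<pi> f"] by (simp add: mult_minus_left)
    also have "\<dots> \<le> vnorm T (c \<ominus> p) * b" using p cT f by (intro mult_left_mono pi_norm_le b) auto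
    finally show "vnorm T (c \<otimes> \<pi> f \<ominus> p \<otimes> \<pi> f) \<le> b * vnorm T (c \<ominus> p)" by (simp add: mult.commute)
  qed (use b f cT in \<open>auto intro: poly_mult_pi\<close>)
qed

lemma has_coeffs_mult_t:
  assumes c: "has_coeffs c C" and \<xi>: "\<xi> \<in> X" shows "has_coeffs (c \<otimes> t \<xi>) (shift C \<xi>)"
proof -
  obtain b where b: "b > 0" "\<And>x. cmod (\<xi> x) \<le> b" using C0_bdd[OF \<xi>] by metis
  note cT = has_coeffs_carrier[OF c]
  let ?K = "b + vnorm T (t \<xi>)"
  have tn: "0 \<le> vnorm T (t \<xi>)" using \<xi> by simp
  show ?thesis
  proof (rule has_coeffs_lipschitz_image[where K="?K" and g="\<lambda>C. shift C \<xi>" and f="\<lambda>c. c \<otimes> t \<xi>", OF c])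
    fix D w x and e :: real assume x: "x \<in> spec" and D: "\<And>w x. x \<in> spec \<Longrightarrow> cmod (C w x - D w x) < e"
    have e: "e > 0" using D[OF x] by (meson norm_ge_zero le_less_trans)
    have "cmod (shift C \<xi> w x - shift D \<xi> w x) \<le> b * e"
    proof (cases w)
      case (Cons i v)
      show ?thesis
      proof (cases "\<xi> (i, x) = 0")
        case False
        \<comment> \<open>Forward invariance of \<open>spec\<close> is what keeps the coefficient at
          the end of the edge within the range of the estimate.\<close>
        then have "\<sigma> i x \<in> spec" using X_support[OF \<xi>] spec_\<sigma>[OF x] by blast
        then have "cmod (C v (\<sigma> i x) - D v (\<sigma> i x)) \<le> e" using D by (simp add: less_imp_le)
        then have "cmod (\<xi> (i, x)) * cmod (C v (\<sigma> i x) - D v (\<sigma> i x)) \<le> b * e"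
          using b by (intro mult_mono) auto
        then show ?thesis unfolding Cons shift_simps
          by (simp only: norm_mult mult.commute[of _ "\<xi> (i, x)"] right_diff_distrib[symmetric])
      qed (use Cons b e in simp)
    qed (use b e in simp)
    then show "cmod (shift C \<xi> w x - shift D \<xi> w x) \<le> ?K * e"
      using mult_nonneg_nonneg[OF tn less_imp_le[OF e]] by (simp add: distrib_right)
  next
    fix p assume p: "p \<in> carrier T"
    have "vnorm T (c \<otimes> t \<xi> \<ominus> p \<otimes> t \<xi>) \<le> vnorm T (c \<ominus> p) * vnorm T (t \<xi>)"
      using p cT \<xi> vnorm_mult[of "c \<ominus> p" "t \<xi>"] by (simp add: mult_minus_left)
    also have "\<dots> \<le> ?K * vnorm T (c \<ominus> p)" using p cT b by (subst mult.commute) (intro mult_right_mono, auto)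
    finally show "vnorm T (c \<otimes> t \<xi> \<ominus> p \<otimes> t \<xi>) \<le> ?K * vnorm T (c \<ominus> p)" .
  qed (use b tn \<xi> cT in \<open>auto intro: poly_mult_t\<close>)
qed

lemma has_coeffs_add:
  assumes c: "has_coeffs c C" and c': "has_coeffs c' C'" shows "has_coeffs (c \<oplus> c') (\<lambda>w x. C w x + C' w x)"
  unfolding has_coeffs_def
proof (intro conjI allI impI)
  note cT = has_coeffs_carrier[OF c] has_coeffs_carrier[OF c']
  show "c \<oplus> c' \<in> carrier T" using cT by simp
  fix e :: real assume e: "e > 0"
  obtain p D where p: "is_poly p D" "p \<in> carrier T" "vnorm T (c \<ominus> p) < e/2" "\<And>w x. x \<in> spec \<Longrightarrow> cmod (C w x - D w x) < e/2"
    using has_coeffsE[OF c, of "e/2"] e by (metis half_gt_zero)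
  obtain p' D' where p': "is_poly p' D'" "p' \<in> carrier T" "vnorm T (c' \<ominus> p') < e/2" "\<And>w x. x \<in> spec \<Longrightarrow> cmod (C' w x - D' w x) < e/2"
    using has_coeffsE[OF c', of "e/2"] e by (metis half_gt_zero)
  show "\<exists>p D. is_poly p D \<and> vnorm T (c \<oplus> c' \<ominus> p) < e \<and> (\<forall>w. \<forall>x\<in>spec. cmod (C w x + C' w x - D w x) < e)"
  proof (intro exI conjI allI ballI)
    show "is_poly (p \<oplus> p') (\<lambda>w x. D w x + D' w x)" by (rule poly_add[OF p(1) p'(1)])
    show "vnorm T (c \<oplus> c' \<ominus> (p \<oplus> p')) < e"
      using vnorm_triangle[of "c \<ominus> p" "c' \<ominus> p'"] p p' cT by (simp add: add_minus_add)
    show "cmod (C w x + C' w x - (D w x + D' w x)) < e" if "x \<in> spec" for w x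
      using p(4)[OF that, of w] p'(4)[OF that, of w] norm_diff_triangle_ineq[of "C w x" "C' w x" "D w x" "D' w x"] by simp
  qed
qed

lemma has_coeffs_unique:
  assumes "has_coeffs c C" "has_coeffs c D" "x \<in> spec" shows "C w x = D w x"
proof -
  have c: "c \<in> carrier T" using assms has_coeffs_carrier by blast
  have "has_coeffs (c \<oplus> (-1) \<odot> c) (\<lambda>w x. C w x + (-1) * D w x)"
    by (intro has_coeffs_add has_coeffs_scale assms)
  moreover have "c \<oplus> (-1) \<odot> c = \<zero>" using minus_eq_scale[OF c c] minus_self[OF c] by simp
  ultimately have "cmod (C w x + (-1) * D w x) \<le> 0" using has_coeffs_le[OF _ assms(3)] by fastforce
  then show ?thesis by simp
qed

definition Q :: "'b set" where "Q = vclosure {p. \<exists>C. is_poly p C}"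

lemma polys_subset: "{p. \<exists>C. is_poly p C} \<subseteq> carrier T"
  by auto

text \<open>By \<open>poly_coeff_le\<close> applied to differences, the coefficients of
  approximating polynomials are uniformly Cauchy on \<open>spec\<close>.\<close>

lemma has_coeffs_exists:
  assumes "c \<in> Q" shows "\<exists>C. has_coeffs c C"
proof -
  have cT: "c \<in> carrier T" using assms by (simp add: Q_def vclosure_carrier)
  have "\<exists>p D. is_poly p D \<and> vnorm T (c \<ominus> p) < inverse (real (Suc k))" for k
    using vclosureD[OF assms[unfolded Q_def], of "inverse (real (Suc k))"] by auto
  then obtain p D where p: "\<And>k. is_poly (p k) (D k)" "\<And>k. vnorm T (c \<ominus> p k) < inverse (real (Suc k))" by metis
  have le: "cmod (D k w x - D l w x) \<le> inverse (real (Suc k)) + inverse (real (Suc l))" if "x \<in> spec" for k l w x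
  proof -
    have "is_poly (p k \<oplus> (-1) \<odot> p l) (\<lambda>w x. D k w x + (-1) * D l w x)" by (intro poly_add poly_scale p)
    from poly_coeff_le[OF this that, of w]
    have "cmod (D k w x - D l w x) \<le> vnorm T (p k \<ominus> p l)" using p by (simp add: minus_eq_scale poly_closed[OF p(1)])
    also have "\<dots> \<le> vnorm T (p k \<ominus> c) + vnorm T (c \<ominus> p l)" using cT p by (intro vnorm_minus_triangle) auto
    also have "vnorm T (p k \<ominus> c) = vnorm T (c \<ominus> p k)" using cT p by (intro vnorm_minus_commute) auto
    finally show ?thesis using p(2)[of k] p(2)[of l] by linarith
  qed
  have inv: "\<exists>N. \<forall>k\<ge>N. inverse (real (Suc k)) < e" if "e > 0" for e :: real
  proof -
    obtain N where "inverse (real (Suc N)) < e" using reals_Archimedean[OF \<open>e > 0\<close>] by blast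
    moreover have "inverse (real (Suc k)) \<le> inverse (real (Suc N))" if "k \<ge> N" for k using that by simp
    ultimately show ?thesis by (meson le_less_trans)
  qed
  have "convergent (\<lambda>k. D k w x)" if x: "x \<in> spec" for w x
    unfolding Cauchy_convergent_iff[symmetric]
  proof (rule metric_CauchyI)
    fix e :: real assume "e > 0"
    then obtain N where N: "\<And>k. k \<ge> N \<Longrightarrow> inverse (real (Suc k)) < e/2" using inv[of "e/2"] by auto
    have "dist (D k w x) (D l w x) < e" if "k \<ge> N" "l \<ge> N" for k l
      using le[OF x, of k w l] N[OF that(1)] N[OF that(2)] by (simp add: dist_norm)
    then show "\<exists>N. \<forall>k\<ge>N. \<forall>l\<ge>N. dist (D k w x) (D l w x) < e" by blast
  qed
  then have lim: "(\<lambda>k. D k w x) \<longlonglongrightarrow> lim (\<lambda>k. D k w x)" if "x \<in> spec" for w x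
    using that convergent_LIMSEQ_iff by blast
  have lim_le: "cmod (lim (\<lambda>k. D k w x) - D l w x) \<le> 2 * inverse (real (Suc l))" if x: "x \<in> spec" for w x l
  proof (rule LIMSEQ_le_const2)
    show "(\<lambda>k. cmod (D k w x - D l w x)) \<longlonglongrightarrow> cmod (lim (\<lambda>k. D k w x) - D l w x)"
      by (intro tendsto_intros lim x)
    have "cmod (D k w x - D l w x) \<le> 2 * inverse (real (Suc l))" if "k \<ge> l" for k
    proof -
      have "inverse (real (Suc k)) \<le> inverse (real (Suc l))" using that by simp
      then show ?thesis using le[OF x, of k w l] by linarith
    qed
    then show "\<exists>N. \<forall>k\<ge>N. cmod (D k w x - D l w x) \<le> 2 * inverse (real (Suc l))" by blast
  qed
  have "has_coeffs c (\<lambda>w x. lim (\<lambda>k. D k w x))"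
    unfolding has_coeffs_def
  proof (intro conjI allI impI cT)
    fix e :: real assume e: "e > 0"
    then obtain l where l: "inverse (real (Suc l)) < e/2" using inv[of "e/2"] by auto
    then show "\<exists>p D'. is_poly p D' \<and> vnorm T (c \<ominus> p) < e \<and> (\<forall>w. \<forall>x\<in>spec. cmod (lim (\<lambda>k. D k w x) - D' w x) < e)"
      using p(1)[of l] p(2)[of l] lim_le e by (intro exI[of _ "p l"] exI[of _ "D l"]) (fastforce intro: le_less_trans)
  qed
  then show ?thesis by blast
qed

text \<open>Two approximants are compared. The first, \<open>p\<close>, determines the order
  \<open>M\<close> of the Cesaro mean; the finer \<open>q\<close> has coefficients so small that its
  mean of order \<open>M\<close> is negligible, and contractivity bounds the difference of the two
  means by that of \<open>p\<close> and \<open>q\<close>.\<close>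

lemma has_coeffs_zero_imp_zero:
  assumes c: "has_coeffs c C" and C: "\<And>w x. x \<in> spec \<Longrightarrow> C w x = 0"
  shows "c = \<zero>"
proof (rule eq_if_vnorm_minus_le[where K=5])
  show cT: "c \<in> carrier T" using c by (rule has_coeffs_carrier)
  fix e :: real assume e: "e > 0"
  let ?m = "\<lambda>M k. complex_of_real (real (M - k) / real M)"
  obtain p D where p: "is_poly p D" "p \<in> carrier T" "vnorm T (c \<ominus> p) < e"
    using has_coeffsE[OF c e] by metis
  then obtain d P where P: "degree_parts d P D" "p = psum P d" by (auto simp: is_poly_def)
  have Pc [simp]: "P k \<in> carrier T" for k using P degree_parts_closed by blast
  \<comment> \<open>\<open>b / M\<close> bounds the distance from \<open>p\<close> to its mean of
    order \<open>M\<close>, since the weight of degree \<open>k\<close> differs from 1 by at most k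
    / M.\<close>
  define b where "b = (\<Sum>k<d. real k * vnorm T (P k))"
  obtain M0 :: nat where M0: "b / e < M0" using reals_Archimedean2 by blast
  define M where "M = Suc M0"
  have M: "M > 0" "b / M < e" using M0 e by (auto simp: M_def field_simps)
  define s where "s = (\<Sum>k<M. sqrt (card (W k)))"
  have s: "s \<ge> 0" by (auto simp: s_def intro: sum_nonneg)
  \<comment> \<open>The degree of \<open>q\<close> is out of control, but its mean of order
    \<open>M\<close> only sees degrees below \<open>M\<close>; hence the tolerance can be fixed from
    \<open>s\<close> before \<open>q\<close> is chosen.\<close>
  define \<delta> where "\<delta> = e / (s + 1)"
  have \<delta>: "\<delta> > 0" "s * \<delta> \<le> e" "\<delta> \<le> e" using e s by (auto simp: \<delta>_def field_simps)
  obtain q E where q: "is_poly q E" "q \<in> carrier T" "vnorm T (c \<ominus> q) < \<delta>" "\<And>w x. x \<in> spec \<Longrightarrow> cmod (C w x - E w x) < \<delta>"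
    using has_coeffsE[OF c \<delta>(1)] by metis
  then obtain d' R where R: "degree_parts d' R E" "q = psum R d'" by (auto simp: is_poly_def)
  have Rc [simp]: "R k \<in> carrier T" for k using R degree_parts_closed by blast
  define N where "N = max d (max d' M)"
  have PN: "degree_parts N P D" "p = psum P N" using degree_parts_extend[OF P(1), of N] P(2) by (auto simp: N_def)
  have RN: "degree_parts N R E" "q = psum R N" using degree_parts_extend[OF R(1), of N] R(2) by (auto simp: N_def)
  have PRN: "degree_parts N (\<lambda>k. P k \<oplus> (-1) \<odot> R k) (\<lambda>w x. D w x + (-1) * E w x)"
    by (intro degree_parts_add degree_parts_scale PN RN)
  let ?F = "\<lambda>P. psum (\<lambda>k. ?m M k \<odot> P k)"
  have 1: "vnorm T (p \<ominus> ?F P d) \<le> e"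
  proof -
    have "p \<ominus> ?F P d = psum (\<lambda>k. P k \<oplus> (-1) \<odot> (?m M k \<odot> P k)) d"
      unfolding P(2) by (simp add: minus_eq_scale psum_scale[symmetric] psum_add[symmetric])
    also have "\<dots> = psum (\<lambda>k. (1 - ?m M k) \<odot> P k) d"
    proof (rule psum_cong)
      fix k
      show "P k \<oplus> (-1) \<odot> (?m M k \<odot> P k) = (1 - ?m M k) \<odot> P k"
        using scale_add_left[of "P k" 1 "- ?m M k"] by simp
    qed
    finally have "vnorm T (p \<ominus> ?F P d) \<le> (\<Sum>k<d. vnorm T ((1 - ?m M k) \<odot> P k))"
      using vnorm_psum_le[of "\<lambda>k. (1 - ?m M k) \<odot> P k" d] by simp
    also have "\<dots> \<le> (\<Sum>k<d. real k / M * vnorm T (P k))"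
    proof (rule sum_mono)
      fix k
      have "cmod (1 - ?m M k) = 1 - real (M - k) / M"
        using M(1) by (subst of_real_1[symmetric], subst of_real_diff[symmetric], subst norm_of_real) (auto simp: field_simps)
      also have "\<dots> \<le> real k / M" using M(1) by (auto simp: field_simps of_nat_diff split: nat_diff_split)
      finally show "vnorm T ((1 - ?m M k) \<odot> P k) \<le> real k / M * vnorm T (P k)"
        unfolding vnorm_smult[OF Pc] by (rule mult_right_mono) simp
    qed
    also have "\<dots> = b / M" by (simp add: b_def sum_divide_distrib)
    finally show ?thesis using M(2) by simp
  qed
  have F_eq: "?F P d = ?F P N"
    by (rule psum_extend[symmetric]) (auto simp: degree_parts_zero[OF P(1)] N_def)
  have 2: "vnorm T (?F P N \<ominus> ?F R N) \<le> vnorm T (p \<ominus> q)"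
  proof -
    have "?F P N \<ominus> ?F R N = ?F (\<lambda>k. P k \<oplus> (-1) \<odot> R k) N"
      by (simp add: minus_eq_scale psum_scale[symmetric] psum_add[symmetric] scale_add_right mult.commute)
    then have "vnorm T (?F P N \<ominus> ?F R N) \<le> vnorm T (psum (\<lambda>k. P k \<oplus> (-1) \<odot> R k) N)"
      using fejer_contractive[OF degree_parts_homog[OF PRN] M(1), of N] by simp
    also have "psum (\<lambda>k. P k \<oplus> (-1) \<odot> R k) N = p \<ominus> q"
      unfolding PN(2) RN(2) by (simp add: minus_eq_scale psum_scale psum_add)
    finally show ?thesis .
  qed
  have 3: "vnorm T (?F R N) \<le> e"
  proof -
    have "vnorm T (?F R N) \<le> (\<Sum>k<N. vnorm T (?m M k \<odot> R k))" by (rule vnorm_psum_le) simp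
    also have "\<dots> = (\<Sum>k<M. vnorm T (?m M k \<odot> R k))"
      by (rule sum.mono_neutral_right) (auto simp: N_def)
    also have "\<dots> \<le> (\<Sum>k<M. sqrt (card (W k)) * \<delta>)"
    proof (rule sum_mono)
      fix k
      have "cmod (?m M k) \<le> 1" unfolding norm_of_real using M(1) by simp
      then have "vnorm T (?m M k \<odot> R k) \<le> 1 * vnorm T (R k)"
        unfolding vnorm_smult[OF Rc] by (rule mult_right_mono) simp
      also have "vnorm T (R k) \<le> sqrt (card (W k)) * \<delta>"
      proof (rule homog_norm_le[OF degree_parts_homog[OF RN(1)]])
        show "cmod (cut k E w x) \<le> \<delta>" if "x \<in> spec" for w x
          using q(4)[OF that, of w] C[OF that, of w] \<delta>(1) by (simp add: cut_def)
      qed (use \<delta> in simp)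
      finally show "vnorm T (?m M k \<odot> R k) \<le> sqrt (card (W k)) * \<delta>" by simp
    qed
    also have "\<dots> = s * \<delta>" by (simp add: s_def sum_distrib_right)
    finally show ?thesis using \<delta>(2) by simp
  qed
  have 4: "vnorm T (p \<ominus> q) \<le> 2 * e"
    using vnorm_minus_triangle[of p c q] vnorm_minus_commute[of p c] p q cT \<delta>(3) by simp
  have FP: "?F P N \<in> carrier T" "?F R N \<in> carrier T" by simp_all
  have "vnorm T (p \<ominus> \<zero>) \<le> vnorm T (p \<ominus> ?F P N) + vnorm T (?F P N \<ominus> \<zero>)"
    using p FP by (intro vnorm_minus_triangle) auto
  also have "vnorm T (?F P N \<ominus> \<zero>) \<le> vnorm T (?F P N \<ominus> ?F R N) + vnorm T (?F R N \<ominus> \<zero>)"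
    using FP by (intro vnorm_minus_triangle) auto
  finally have "vnorm T (p \<ominus> \<zero>) \<le> 4 * e" using 1 2 3 4 FP unfolding F_eq by simp
  then show "vnorm T (c \<ominus> \<zero>) \<le> 5 * e"
    using vnorm_minus_triangle[of c p \<zero>] p cT by simp
qed simp

end

section \<open>Local left multipliers\<close>

text \<open>The constant term is a limit at 0. Excluding 0 itself lets the hypothesis survive
  division by \<open>z\<close>, so the shifted series inherits it.\<close>

lemma powser_zero_imp_coeffs_zero:
  fixes a :: "nat \<Rightarrow> complex"
  assumes "\<And>z. z \<noteq> 0 \<Longrightarrow> cmod z < 1 \<Longrightarrow> (\<lambda>k. a k * z ^ k) sums 0"
  shows "a m = 0"
  using assms
proof (induction m arbitrary: a)
  have a0: "a 0 = 0" if a: "\<And>z. z \<noteq> 0 \<Longrightarrow> cmod z < 1 \<Longrightarrow> (\<lambda>k. a k * z ^ k) sums 0" for a :: "nat \<Rightarrow> complex"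
  proof -
    have "((\<lambda>z::complex. 0::complex) \<longlongrightarrow> a 0) (at 0)" by (rule powser_limit_0_strong[of 1]) (use a in auto)
    then show ?thesis using tendsto_unique[OF _ _ tendsto_const] at_neq_bot by metis
  qed
  case 0 then show ?case by (rule a0)
  case (Suc m)
  have "(\<lambda>k. a (Suc k) * z ^ k) sums 0" if z: "z \<noteq> 0" "cmod z < 1" for z
  proof -
    have "(\<lambda>k. a (Suc k) * z ^ Suc k) sums 0" using Suc.prems[OF z] a0[OF Suc.prems] by (subst sums_Suc_iff) simp
    then have "(\<lambda>k. inverse z * (a (Suc k) * z ^ Suc k)) sums (inverse z * 0)" by (rule sums_mult)
    moreover have "inverse z * (a (Suc k) * z ^ Suc k) = a (Suc k) * z ^ k" for k using z by simp
    ultimately show ?thesis by (simp only: mult_zero_right)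
  qed
  then show ?case by (rule Suc.IH)
qed

text \<open>The elements \<open>c\<close> of \<open>N\<close> with
  \<open>q \<otimes> c \<in> N\<close> for all \<open>q \<in> N\<close> form a closed subalgebra, so
  products have to be checked with a generator on the right only. Coefficients are known for exactly
  such products.\<close>

lemma (in banach_algebra) generated_subset:
  assumes N: "N \<subseteq> carrier B" "\<zero> \<in> N" "\<And>x y. x \<in> N \<Longrightarrow> y \<in> N \<Longrightarrow> x \<oplus> y \<in> N" "\<And>c x. x \<in> N \<Longrightarrow> c \<odot> x \<in> N"
    and N_closed: "\<And>x. x \<in> carrier B \<Longrightarrow> (\<And>e. e > 0 \<Longrightarrow> \<exists>y\<in>N. vnorm B (x \<ominus> y) < e) \<Longrightarrow> x \<in> N"
    and G: "\<And>g. g \<in> G \<Longrightarrow> g \<in> N" "\<And>q g. q \<in> N \<Longrightarrow> g \<in> G \<Longrightarrow> q \<otimes> g \<in> N"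
  shows "closed_subalgebra B hull G \<subseteq> N"
proof -
  define N' where "N' = {c \<in> N. \<forall>q\<in>N. q \<otimes> c \<in> N}"
  have NB: "x \<in> N \<Longrightarrow> x \<in> carrier B" for x using N(1) by auto
  have "closed_subalgebra B N'"
  proof (rule closed_subalgebraI)
    show "x \<otimes> y \<in> N'" if "x \<in> N'" "y \<in> N'" for x y
      using that by (auto simp: N'_def NB mult_assoc[symmetric])
    show "x \<oplus> y \<in> N'" if "x \<in> N'" "y \<in> N'" for x y
      using that by (auto simp: N'_def NB mult_distr_right N(3))
    show "c \<odot> x \<in> N'" if "x \<in> N'" for c x
      using that by (auto simp: N'_def NB smult_mult_right N(4))
    fix x assume x: "x \<in> carrier B" "\<And>e. e > 0 \<Longrightarrow> \<exists>y\<in>N'. vnorm B (x \<ominus> y) < e"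
    have "q \<otimes> x \<in> N" if q: "q \<in> N" for q
    proof (rule N_closed)
      fix e :: real assume e: "e > 0"
      have qn: "0 \<le> vnorm B q" using NB[OF q] by simp
      obtain y where y: "y \<in> N'" "vnorm B (x \<ominus> y) < e / (vnorm B q + 1)"
        using x(2)[of "e / (vnorm B q + 1)"] e qn by auto
      then have yB: "y \<in> carrier B" by (auto simp: N'_def NB)
      have "vnorm B (q \<otimes> x \<ominus> q \<otimes> y) \<le> vnorm B q * vnorm B (x \<ominus> y)"
        using vnorm_mult[of q "x \<ominus> y"] NB[OF q] x(1) yB by (simp add: mult_minus_right)
      also have "\<dots> \<le> (vnorm B q + 1) * vnorm B (x \<ominus> y)" using x(1) yB by (intro mult_right_mono) auto
      also have "\<dots> < e" using y(2) qn by (simp add: pos_less_divide_eq mult.commute)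
      finally show "\<exists>z\<in>N. vnorm B (q \<otimes> x \<ominus> z) < e" using y(1) q by (auto simp: N'_def)
    qed (use NB[OF q] x in auto)
    moreover have "x \<in> N" using x by (intro N_closed) (auto simp: N'_def)
    ultimately show "x \<in> N'" by (simp add: N'_def)
  qed (auto simp: N'_def NB N)
  moreover have "G \<subseteq> N'" using G by (auto simp: N'_def)
  ultimately have "closed_subalgebra B hull G \<subseteq> N'" by (rule hull_minimal[rotated])
  then show ?thesis by (auto simp: N'_def)
qed

context toeplitz_system
begin

abbreviation gens where "gens \<equiv> \<pi> ` C0 \<Omega> \<union> t ` X"

definition TA :: "'b set" where "TA = closed_subalgebra T hull gens"

lemma closed_subalgebra_TA: "closed_subalgebra T TA"
  unfolding TA_def by (rule closed_subalgebra_hull) auto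

lemma TA_sub: "TA \<subseteq> carrier T"
  and TA_zero [simp, intro]: "\<zero> \<in> TA"
  and TA_add [simp, intro]: "x \<in> TA \<Longrightarrow> y \<in> TA \<Longrightarrow> x \<oplus> y \<in> TA"
  and TA_mult [simp, intro]: "x \<in> TA \<Longrightarrow> y \<in> TA \<Longrightarrow> x \<otimes> y \<in> TA"
  and TA_scale [simp, intro]: "x \<in> TA \<Longrightarrow> c \<odot> x \<in> TA"
  and TA_minus [simp, intro]: "x \<in> TA \<Longrightarrow> y \<in> TA \<Longrightarrow> x \<ominus> y \<in> TA"
  using closed_subalgebraD[OF closed_subalgebra_TA] by auto

lemma TA_closed: "x \<in> carrier T \<Longrightarrow> (\<And>e. e > 0 \<Longrightarrow> \<exists>y\<in>TA. vnorm T (x \<ominus> y) < e) \<Longrightarrow> x \<in> TA"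
  using closed_subalgebraD(7)[OF closed_subalgebra_TA] .

lemma TA_carrier [simp, intro]: "x \<in> TA \<Longrightarrow> x \<in> carrier T"
  using TA_sub by auto

lemma TA_pi [simp, intro]: "f \<in> C0 \<Omega> \<Longrightarrow> \<pi> f \<in> TA" and TA_t [simp, intro]: "\<xi> \<in> X \<Longrightarrow> t \<xi> \<in> TA"
  using hull_subset[of gens "closed_subalgebra T"] by (auto simp: TA_def)

lemma TA_subset_Q: "TA \<subseteq> Q"
  unfolding TA_def
proof (rule generated_subset)
  show "Q \<subseteq> carrier T" by (simp add: Q_def vclosure_subset)
  show "\<zero> \<in> Q" using subset_vclosure[OF polys_subset] poly_zero by (auto simp: Q_def)
  show "x \<oplus> y \<in> Q" if "x \<in> Q" "y \<in> Q" for x y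
    using that unfolding Q_def by (intro vclosure_add polys_subset) (auto intro: poly_add)
  show "c \<odot> x \<in> Q" if "x \<in> Q" for x c
    using that unfolding Q_def by (intro vclosure_scale polys_subset) (auto intro: poly_scale)
  show "x \<in> Q" if "x \<in> carrier T" "\<And>e. e > 0 \<Longrightarrow> \<exists>y\<in>Q. vnorm T (x \<ominus> y) < e" for x
    using that unfolding Q_def by (rule vclosure_closed[OF polys_subset])
  show "g \<in> Q" if "g \<in> gens" for g
    using that subset_vclosure[OF polys_subset] homog_imp_poly[OF homog_pi] homog_imp_poly[OF homog_t]
    unfolding Q_def by blast
  show "q \<otimes> g \<in> Q" if q: "q \<in> Q" and g: "g \<in> gens" for q g
    unfolding Q_def
  proof (rule vclosure_bounded_image[OF polys_subset polys_subset _ _ _ q[unfolded Q_def], where f="\<lambda>q. q \<otimes> g" and K="vnorm T g"])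
    have gT: "g \<in> carrier T" using g by auto
    have qT: "q \<in> carrier T" using q by (simp add: Q_def vclosure_carrier)
    show "q \<otimes> g \<in> carrier T" using gT qT by simp
    show "d \<otimes> g \<in> {p. \<exists>C. is_poly p C}" if "d \<in> {p. \<exists>C. is_poly p C}" for d
      using that g poly_mult_pi poly_mult_t by blast
    show "vnorm T (q \<otimes> g \<ominus> d \<otimes> g) \<le> vnorm T g * vnorm T (q \<ominus> d)" if "d \<in> {p. \<exists>C. is_poly p C}" for d
      using vnorm_mult[of "q \<ominus> d" g] qT gT poly_closed that by (auto simp: mult_minus_left mult.commute)
  qed
qed

text \<open>By \<open>has_coeffs_unique\<close> the choice is immaterial on \<open>spec\<close>; off
  it no value is claimed.\<close>

definition cf :: "'b \<Rightarrow> nat list \<Rightarrow> 'a \<Rightarrow> complex" where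
  "cf c = (SOME C. has_coeffs c C)"

lemma cf: "c \<in> TA \<Longrightarrow> has_coeffs c (cf c)"
  unfolding cf_def by (rule someI_ex[OF has_coeffs_exists[OF subsetD[OF TA_subset_Q]]])

context
  fixes x assumes x: "x \<in> spec"
begin

lemma cf_le: "c \<in> TA \<Longrightarrow> cmod (cf c w x) \<le> vnorm T c"
  using has_coeffs_le[OF cf x] .

lemma cf_add: "c \<in> TA \<Longrightarrow> d \<in> TA \<Longrightarrow> cf (c \<oplus> d) w x = cf c w x + cf d w x"
  using has_coeffs_unique[OF cf has_coeffs_add[OF cf cf] x] by simp

lemma cf_scale: "c \<in> TA \<Longrightarrow> cf (a \<odot> c) w x = a * cf c w x"
  using has_coeffs_unique[OF cf has_coeffs_scale[OF cf] x] by simp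

lemma cf_mult_pi: "c \<in> TA \<Longrightarrow> f \<in> C0 \<Omega> \<Longrightarrow> cf (c \<otimes> \<pi> f) w x = cf c w x * f x"
  using has_coeffs_unique[OF cf has_coeffs_mult_pi[OF cf] x] by simp

lemma cf_mult_t: "c \<in> TA \<Longrightarrow> \<xi> \<in> X \<Longrightarrow> cf (c \<otimes> t \<xi>) w x = shift (cf c) \<xi> w x"
  using has_coeffs_unique[OF cf has_coeffs_mult_t[OF cf] x] by simp

end

lemma cf_eqI:
  assumes "c \<in> TA" "d \<in> TA" "\<And>w x. x \<in> spec \<Longrightarrow> cf c w x = cf d w x"
  shows "c = d"
proof -
  have "c \<ominus> d = c \<oplus> (-1) \<odot> d" using assms by (simp add: minus_eq_scale)
  then have "has_coeffs (c \<ominus> d) (\<lambda>w x. cf c w x + (-1) * cf d w x)"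
    using has_coeffs_add[OF cf[OF assms(1)] has_coeffs_scale[OF cf[OF assms(2)], of "-1"]] by simp
  then have "c \<ominus> d = \<zero>" by (rule has_coeffs_zero_imp_zero) (use assms(3) in simp)
  then show ?thesis using minus_eq_zero_iff assms by blast
qed

section \<open>Bounded functionals on the tensor algebra and right approximate units\<close>

definition functional :: "('b \<Rightarrow> complex) \<Rightarrow> bool" where
  "functional \<phi> \<longleftrightarrow> (\<forall>a\<in>TA. \<forall>b\<in>TA. \<phi> (a \<oplus> b) = \<phi> a + \<phi> b) \<and> (\<forall>c. \<forall>a\<in>TA. \<phi> (c \<odot> a) = c * \<phi> a)
     \<and> (\<exists>L. \<forall>a\<in>TA. cmod (\<phi> a) \<le> L * vnorm T a)"

lemma functional_minus: "functional \<phi> \<Longrightarrow> a \<in> TA \<Longrightarrow> b \<in> TA \<Longrightarrow> \<phi> (a \<ominus> b) = \<phi> a - \<phi> b"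
  by (simp add: minus_eq_scale functional_def)

lemma functional_cf: "x \<in> spec \<Longrightarrow> functional (\<lambda>c. cf c w x)"
  unfolding functional_def using cf_add cf_scale cf_le by (auto intro!: exI[of _ 1])

lemma functional_diff:
  assumes "functional \<phi>" "functional \<psi>" shows "functional (\<lambda>a. \<phi> a - s * \<psi> a)"
proof -
  obtain L M where LM: "\<forall>a\<in>TA. cmod (\<phi> a) \<le> L * vnorm T a" "\<forall>a\<in>TA. cmod (\<psi> a) \<le> M * vnorm T a"
    using assms by (auto simp: functional_def)
  have "cmod (\<phi> a - s * \<psi> a) \<le> (L + cmod s * M) * vnorm T a" if "a \<in> TA" for a
  proof -
    have "cmod (\<phi> a - s * \<psi> a) \<le> cmod (\<phi> a) + cmod s * cmod (\<psi> a)"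
      using norm_triangle_ineq4[of "\<phi> a" "s * \<psi> a"] by (simp add: norm_mult)
    also have "\<dots> \<le> L * vnorm T a + cmod s * (M * vnorm T a)" using LM that by (intro add_mono mult_left_mono) auto
    finally show ?thesis by (simp add: algebra_simps)
  qed
  then have "\<exists>L. \<forall>a\<in>TA. cmod (\<phi> a - s * \<psi> a) \<le> L * vnorm T a" by blast
  moreover have "\<phi> (a \<oplus> b) - s * \<psi> (a \<oplus> b) = \<phi> a - s * \<psi> a + (\<phi> b - s * \<psi> b)" if "a \<in> TA" "b \<in> TA" for a b
    using assms that by (simp add: functional_def algebra_simps)
  moreover have "\<phi> (c \<odot> a) - s * \<psi> (c \<odot> a) = c * (\<phi> a - s * \<psi> a)" if "a \<in> TA" for a c
    using assms that by (simp add: functional_def algebra_simps)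
  ultimately show ?thesis unfolding functional_def by blast
qed

lemma functional_compose:
  assumes "functional \<phi>" and R: "\<And>a. a \<in> TA \<Longrightarrow> R a \<in> TA"
    "\<And>a b. a \<in> TA \<Longrightarrow> b \<in> TA \<Longrightarrow> R (a \<oplus> b) = R a \<oplus> R b" "\<And>c a. a \<in> TA \<Longrightarrow> R (c \<odot> a) = c \<odot> R a"
    "\<And>a. a \<in> TA \<Longrightarrow> vnorm T (R a) \<le> K * vnorm T a"
  shows "functional (\<lambda>a. \<phi> (R a))"
proof -
  obtain L where L: "\<forall>a\<in>TA. cmod (\<phi> a) \<le> L * vnorm T a" using assms(1) by (auto simp: functional_def)
  have "cmod (\<phi> (R a)) \<le> \<bar>L\<bar> * K * vnorm T a" if "a \<in> TA" for a
  proof -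
    have "cmod (\<phi> (R a)) \<le> L * vnorm T (R a)" using L R(1)[OF that] by blast
    also have "\<dots> \<le> \<bar>L\<bar> * vnorm T (R a)" using R(1)[OF that] by (intro mult_right_mono) auto
    also have "\<dots> \<le> \<bar>L\<bar> * (K * vnorm T a)" using R(4)[OF that] by (intro mult_left_mono) auto
    finally show ?thesis by (simp add: mult.assoc)
  qed
  then have "\<exists>L. \<forall>a\<in>TA. cmod (\<phi> (R a)) \<le> L * vnorm T a" by blast
  then show ?thesis using assms(1) R(1-3) unfolding functional_def by simp
qed

lemma functional_vanish:
  assumes \<phi>: "functional \<phi>" and a: "a \<in> TA" and v: "\<And>e. e > 0 \<Longrightarrow> \<exists>b\<in>TA. \<phi> b = 0 \<and> vnorm T (a \<ominus> b) < e"
  shows "\<phi> a = 0"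
proof -
  obtain L where L: "\<forall>a\<in>TA. cmod (\<phi> a) \<le> L * vnorm T a" using \<phi> by (auto simp: functional_def)
  have "cmod (\<phi> a) \<le> 0"
  proof (rule field_le_epsilon)
    fix e :: real assume e: "e > 0"
    obtain b where b: "b \<in> TA" "\<phi> b = 0" "vnorm T (a \<ominus> b) < e / (\<bar>L\<bar> + 1)" using v[of "e / (\<bar>L\<bar> + 1)"] e by auto
    have "cmod (\<phi> a) = cmod (\<phi> (a \<ominus> b))" using functional_minus[OF \<phi> a b(1)] b(2) by simp
    also have "\<dots> \<le> L * vnorm T (a \<ominus> b)" using L a b(1) by auto
    also have "\<dots> \<le> (\<bar>L\<bar> + 1) * vnorm T (a \<ominus> b)" using a b(1) by (intro mult_right_mono) auto
    also have "\<dots> \<le> e" using b(3) by (simp add: pos_less_divide_eq mult.commute)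
    finally show "cmod (\<phi> a) \<le> 0 + e" by simp
  qed
  then show ?thesis by simp
qed

text \<open>The error is the modulus of \<open>c\<close> times \<open>d / (g x + d)\<close>,
  uniformly small even where \<open>g\<close> tends to zero. One \<open>u\<close> serves all
  \<open>c\<close> dominated by \<open>g\<close>, in particular the values on all edges at a
  point.\<close>

lemma regularization:
  fixes g :: "'a \<Rightarrow> real"
  assumes gC: "(\<lambda>x. complex_of_real (g x)) \<in> C0 \<Omega>" and g0: "\<And>x. 0 \<le> g x" and d: "d > 0"
    and u_def: "\<And>x. u x = complex_of_real (g x / (g x + d))"
  shows "u \<in> C0 \<Omega>" and "\<And>c x. (cmod c)\<^sup>2 \<le> g x \<Longrightarrow> cmod (c - c * u x) \<le> sqrt d"
proof -
  have eq: "u = (\<lambda>x. complex_of_real (\<bar>Re (complex_of_real (g x))\<bar> / (\<bar>Re (complex_of_real (g x))\<bar> + d)))"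
    using g0 by (auto simp: u_def fun_eq_iff)
  have "continuous_on UNIV (\<lambda>z. complex_of_real (\<bar>Re z\<bar> / (\<bar>Re z\<bar> + d)))"
    using d by (intro continuous_intros) (auto simp: add_nonneg_eq_0_iff)
  from C0_compose[OF gC this] show "u \<in> C0 \<Omega>" unfolding eq by simp
  fix c x assume c: "(cmod c)\<^sup>2 \<le> g x"
  have gd: "g x + d > 0" using g0[of x] d by simp
  have "c - c * u x = c * complex_of_real (1 - g x / (g x + d))" by (simp add: u_def algebra_simps)
  also have "1 - g x / (g x + d) = d / (g x + d)" using gd by (simp add: field_simps)
  finally have "cmod (c - c * u x) = cmod c * (d / (g x + d))"
    using gd d by (simp add: norm_mult norm_divide flip: of_real_add)
  moreover have "(cmod c * (d / (g x + d)))\<^sup>2 \<le> d"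
  proof -
    have "(cmod c)\<^sup>2 * d\<^sup>2 \<le> g x * d\<^sup>2" using c by (intro mult_right_mono) auto
    also have "\<dots> \<le> d * (g x + d)\<^sup>2"
    proof -
      have "d * (g x + d)\<^sup>2 - g x * d\<^sup>2 = d * (g x)\<^sup>2 + g x * d\<^sup>2 + d ^ 3"
        by (simp add: power2_eq_square power3_eq_cube algebra_simps)
      also have "\<dots> \<ge> 0" using d g0[of x] by simp
      finally show ?thesis by simp
    qed
    finally show ?thesis using gd by (simp add: power_mult_distrib power_divide pos_divide_le_eq)
  qed
  ultimately show "cmod (c - c * u x) \<le> sqrt d" by (simp add: real_le_rsqrt)
qed

lemma pi_approx_unit:
  assumes f: "f \<in> C0 \<Omega>" and e: "e > 0"
  shows "\<exists>u\<in>C0 \<Omega>. vnorm T (\<pi> f \<ominus> \<pi> f \<otimes> \<pi> u) < e"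
proof -
  define g where "g x = (cmod (f x))\<^sup>2" for x
  have "(\<lambda>x. complex_of_real (g x)) = (\<lambda>x. cnj (f x) * f x)"
    by (auto simp: g_def mult.commute complex_norm_square simp flip: of_real_power)
  then have gC: "(\<lambda>x. complex_of_real (g x)) \<in> C0 \<Omega>" using f by (simp add: C0_mult C0_cnj)
  define d where "d = (e / 2)\<^sup>2"
  define u where "u x = complex_of_real (g x / (g x + d))" for x
  have d: "d > 0" "sqrt d < e" using e by (auto simp: d_def)
  have g0: "0 \<le> g x" for x by (simp add: g_def)
  note u = regularization[OF gC g0 d(1) u_def]
  have "vnorm T (\<pi> (\<lambda>x. f x - f x * u x)) \<le> sqrt d"
    by (rule pi_norm_le[OF C0_diff[OF f C0_mult[OF f u(1)]]], rule u(2)) (simp add: g_def)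
  then show ?thesis using d u(1) f by (intro bexI[of _ u]) (auto simp: pi_diff C0_mult pi_mult)
qed

lemma t_approx_unit:
  assumes \<xi>: "\<xi> \<in> X" and e: "e > 0"
  shows "\<exists>u\<in>C0 \<Omega>. vnorm T (t \<xi> \<ominus> t \<xi> \<otimes> \<pi> u) < e"
proof -
  define g where "g x = (\<Sum>i=1..n. (cmod (\<xi> (i, x)))\<^sup>2)" for x
  have "(\<lambda>x. complex_of_real (g x)) = (\<lambda>x. \<Sum>i=1..n. cnj (\<xi> (i, x)) * \<xi> (i, x))"
    by (auto simp: g_def mult.commute complex_norm_square simp flip: of_real_power)
  then have gC: "(\<lambda>x. complex_of_real (g x)) \<in> C0 \<Omega>" using inner_X[OF \<xi> \<xi>] by (simp only:)
  have g0: "0 \<le> g x" for x by (auto simp: g_def intro: sum_nonneg)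
  have le_g: "(cmod (\<xi> (i, x)))\<^sup>2 \<le> g x" for i x
  proof (cases "\<xi> (i, x) = 0")
    case False
    then show ?thesis unfolding g_def using member_le_sum[OF X_support[OF \<xi> False], of "\<lambda>i. (cmod (\<xi> (i, x)))\<^sup>2"] by simp
  qed (use g0 in simp)
  \<comment> \<open>Chosen so that \<open>n * d < e\<^sup>2\<close>; the summand 1 covers
    \<open>n = 0\<close>.\<close>
  define d where "d = e\<^sup>2 / (2 * (real n + 1))"
  define u where "u x = complex_of_real (g x / (g x + d))" for x
  have d: "d > 0" using e by (simp add: d_def)
  have nd: "n * d < e\<^sup>2" using e by (simp add: d_def field_simps) (intro add_nonneg_pos, auto)
  note u = regularization[OF gC g0 d(1) u_def]
  have \<eta>: "(\<lambda>(i, x). \<xi> (i, x) * u x) \<in> X" by (rule X_ract[OF \<xi> u(1)])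
  have "(vnorm T (t (\<lambda>p. \<xi> p - (\<lambda>(i, x). \<xi> (i, x) * u x) p)))\<^sup>2 \<le> n * (sqrt d)\<^sup>2"
    by (rule t_norm_sq_le[OF C0_diff[OF \<xi> \<eta>]]) (use u(2)[OF le_g] in \<open>auto split: prod.split\<close>)
  then have "(vnorm T (t \<xi> \<ominus> t \<xi> \<otimes> \<pi> u))\<^sup>2 < e\<^sup>2"
    using nd d unfolding t_diff[OF \<xi> \<eta>] t_pi[OF \<xi> u(1), symmetric] by simp
  then have "vnorm T (t \<xi> \<ominus> t \<xi> \<otimes> \<pi> u) < e" using e by (simp add: power2_less_imp_less)
  then show ?thesis using u(1) by blast
qed

section \<open>Coefficients of \<open>S (a \<otimes> b)\<close> for generators
  \<open>b\<close>\<close>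

context
  fixes S :: "'b \<Rightarrow> 'b"
  assumes S_TA [simp, intro]: "a \<in> TA \<Longrightarrow> S a \<in> TA"
    and S_add: "a \<in> TA \<Longrightarrow> b \<in> TA \<Longrightarrow> S (a \<oplus> b) = S a \<oplus> S b"
    and S_scale: "a \<in> TA \<Longrightarrow> S (c \<odot> a) = c \<odot> S a"
    and S_bdd: "\<exists>K. \<forall>a\<in>TA. vnorm T (S a) \<le> K * vnorm T a"
    and S_local: "a \<in> TA \<Longrightarrow> e > 0 \<Longrightarrow> \<exists>b\<in>TA. vnorm T (S a \<ominus> b \<otimes> a) < e"
begin

lemma S_minus: "a \<in> TA \<Longrightarrow> b \<in> TA \<Longrightarrow> S (a \<ominus> b) = S a \<ominus> S b"
  by (simp add: minus_eq_scale S_add S_scale)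

text \<open>Holds because \<open>S b\<close> lies in the closed left ideal generated by \<open>b\<close>.\<close>

lemma local_vanish:
  assumes \<phi>: "functional \<phi>" and b: "b \<in> TA" and v: "\<And>a. a \<in> TA \<Longrightarrow> \<phi> (a \<otimes> b) = 0"
  shows "\<phi> (S b) = 0"
proof (rule functional_vanish[OF \<phi>])
  fix e :: real assume "e > 0"
  then obtain a where "a \<in> TA" "vnorm T (S b \<ominus> a \<otimes> b) < e" using S_local[OF b] by blast
  then show "\<exists>c\<in>TA. \<phi> c = 0 \<and> vnorm T (S b \<ominus> c) < e" using b v by blast
qed (use b in auto)

lemma functional_S: "functional \<phi> \<Longrightarrow> functional (\<lambda>a. \<phi> (S a))"
  using S_bdd functional_compose[of \<phi> S] S_add S_scale by blast

lemma functional_mult_right: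
  assumes "functional \<phi>" "b \<in> TA" shows "functional (\<lambda>a. \<phi> (a \<otimes> b))"
  by (rule functional_compose[OF assms(1), where K="vnorm T b"])
     (use assms(2) in \<open>auto simp: mult_distr_left smult_mult_left mult.commute intro: order_trans[OF vnorm_mult]\<close>)

text \<open>\<open>\<psi>\<close> measures the failure of the identity. It vanishes at
  \<open>q \<otimes> \<pi> h\<close> because all left multiples of \<open>?b\<close> have
  coefficient zero at \<open>x\<close>. Right approximate units extend this to generators and to
  products with a generator on the right, and boundedness of \<open>\<psi>\<close> extends it to
  limits.\<close>

lemma cf_S_pi:
  assumes a: "a \<in> TA" and f: "f \<in> C0 \<Omega>" and x: "x \<in> spec"
  shows "cf (S (a \<otimes> \<pi> f)) w x = f x * cf (S a) w x"
proof -
  define \<psi> where "\<psi> a = cf (S (a \<otimes> \<pi> f)) w x - f x * cf (S a) w x" for a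
  have \<psi>: "functional \<psi>"
    unfolding \<psi>_def
    by (intro functional_diff functional_S functional_cf x
        functional_mult_right[where \<phi>="\<lambda>a. cf (S a) w x"]) (use f in auto)
  define N where "N = {a \<in> TA. \<psi> a = 0}"
  have 1: "q \<otimes> \<pi> h \<in> N" if q: "q \<in> TA" and h: "h \<in> C0 \<Omega>" for q h
  proof -
    let ?b = "q \<otimes> \<pi> h \<otimes> \<pi> f \<ominus> f x \<odot> (q \<otimes> \<pi> h)"
    have "cf (S ?b) w x = 0"
    proof (rule local_vanish[OF functional_cf[OF x]])
      fix c assume c: "c \<in> TA"
      have "c \<otimes> ?b = (c \<otimes> q) \<otimes> \<pi> h \<otimes> \<pi> f \<ominus> f x \<odot> ((c \<otimes> q) \<otimes> \<pi> h)"
        using c q h f by (simp add: mult_minus_right smult_mult_right mult_assoc)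
      then show "cf (c \<otimes> ?b) w x = 0"
        using c q h f x by (simp add: functional_minus[OF functional_cf] cf_scale cf_mult_pi)
    qed (use q h f in auto)
    then show ?thesis using q h f x
      by (simp add: N_def \<psi>_def S_minus S_scale functional_minus[OF functional_cf] cf_scale)
  qed
  have N_closed: "c \<in> N" if c: "c \<in> carrier T" and ex: "\<And>e. e > 0 \<Longrightarrow> \<exists>y\<in>N. vnorm T (c \<ominus> y) < e" for c
  proof -
    have cTA: "c \<in> TA" by (rule TA_closed[OF c]) (use ex N_def in blast)
    have "\<psi> c = 0" by (rule functional_vanish[OF \<psi> cTA]) (use ex in \<open>auto simp: N_def\<close>)
    then show ?thesis using cTA by (simp add: N_def)
  qed
  have "TA \<subseteq> N"
    unfolding TA_def
  proof (rule generated_subset)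
    show "\<zero> \<in> N" using \<psi> by (simp add: N_def functional_minus[OF \<psi>, of \<zero> \<zero>, simplified])
    show "c \<oplus> d \<in> N" if "c \<in> N" "d \<in> N" for c d using that \<psi> by (simp add: N_def functional_def)
    show "s \<odot> c \<in> N" if "c \<in> N" for s c using that \<psi> by (simp add: N_def functional_def)
    show "g \<in> N" if g: "g \<in> gens" for g
    proof (rule N_closed)
      show "g \<in> carrier T" using g by auto
      fix e :: real assume e: "e > 0"
      show "\<exists>y\<in>N. vnorm T (g \<ominus> y) < e"
        using g pi_approx_unit[OF _ e] t_approx_unit[OF _ e] 1 TA_pi TA_t by blast
    qed
    fix q g assume q: "q \<in> N" and g: "g \<in> gens"
    have qTA: "q \<in> TA" using q by (simp add: N_def)
    show "q \<otimes> g \<in> N"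
    proof (rule N_closed)
      have gT: "g \<in> TA" using g by auto
      then show "q \<otimes> g \<in> carrier T" using qTA by auto
      fix e :: real assume e: "e > 0"
      have qn: "0 \<le> vnorm T q" using qTA by auto
      then have e': "e / (vnorm T q + 1) > 0" using e by simp
      obtain u where u: "u \<in> C0 \<Omega>" "vnorm T (g \<ominus> g \<otimes> \<pi> u) < e / (vnorm T q + 1)"
        using g pi_approx_unit[OF _ e'] t_approx_unit[OF _ e'] by blast
      have gu: "g \<ominus> g \<otimes> \<pi> u \<in> TA" using gT u by auto
      have "vnorm T (q \<otimes> g \<ominus> (q \<otimes> g) \<otimes> \<pi> u) \<le> vnorm T q * vnorm T (g \<ominus> g \<otimes> \<pi> u)"
        using vnorm_mult[of q "g \<ominus> g \<otimes> \<pi> u"] qTA gT u gu by (simp add: mult_minus_right mult_assoc)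
      also have "\<dots> \<le> (vnorm T q + 1) * vnorm T (g \<ominus> g \<otimes> \<pi> u)" using gu by (intro mult_right_mono) auto
      also have "\<dots> < e" using u(2) qn by (simp add: pos_less_divide_eq mult.commute)
      finally show "\<exists>y\<in>N. vnorm T (q \<otimes> g \<ominus> y) < e" using 1[OF TA_mult[OF qTA gT] u(1)] by blast
    qed
  next
    show "c \<in> N" if "c \<in> carrier T" "\<And>e. e > 0 \<Longrightarrow> \<exists>y\<in>N. vnorm T (c \<ominus> y) < e" for c
      using that by (rule N_closed)
  qed (auto simp: N_def)
  then show ?thesis using a by (auto simp: N_def \<psi>_def)
qed

text \<open>Every left multiple of \<open>a \<otimes> t \<xi>\<close> already has coefficient 0
  there, so \<open>local_vanish\<close> applies to the coefficient functional itself.\<close>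

lemma cf_S_t_zero:
  assumes a: "a \<in> TA" and \<xi>: "\<xi> \<in> X" and x: "x \<in> spec" and w: "w = [] \<or> \<xi> (hd w, x) = 0"
  shows "cf (S (a \<otimes> t \<xi>)) w x = 0"
proof (rule local_vanish[OF functional_cf[OF x]])
  fix c assume c: "c \<in> TA"
  have "c \<otimes> (a \<otimes> t \<xi>) = (c \<otimes> a) \<otimes> t \<xi>" using c a \<xi> by (simp add: mult_assoc)
  then show "cf (c \<otimes> (a \<otimes> t \<xi>)) w x = 0"
    using w cf_mult_t[OF x _ \<xi>, of "c \<otimes> a" w] c a by (cases w) auto
qed (use a \<xi> in auto)

text \<open>If \<open>h\<close> is 1 at \<open>x\<close> and 0 at \<open>\<sigma> j x\<close>, and \<open>f\<close> conversely, then \<open>\<psi>\<close> annihilates the left ideal generated by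
  \<open>t \<xi> \<pi> h + \<pi> f\<close>.\<close>

lemma cf_S_t_moved:
  assumes a: "a \<in> TA" and \<xi>: "\<xi> \<in> X" and x: "x \<in> spec" and j: "j \<in> {1..n}" and ne: "\<sigma> j x \<noteq> x"
  shows "cf (S (a \<otimes> t \<xi>)) (j # v) x = cf (S a) v (\<sigma> j x) * \<xi> (j, x)"
proof -
  let ?y = "\<sigma> j x" and ?s = "\<xi> (j, x)"
  have y: "?y \<in> spec" by (rule spec_\<sigma>[OF x j])
  have top: "x \<in> topspace \<Omega>" "?y \<in> topspace \<Omega>" using x y by (auto simp: spec_def)
  obtain h where h: "h \<in> C0 \<Omega>" "h x = 1" "h ?y = 0" using C0_separate[OF lch top(1), of ?y] ne by auto
  obtain f where f: "f \<in> C0 \<Omega>" "f ?y = 1" "f x = 0" using C0_separate[OF lch top(2), of x] ne by auto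
  define \<psi> where "\<psi> c = cf c (j # v) x - ?s * cf c v ?y" for c
  have \<psi>: "functional \<psi>" unfolding \<psi>_def by (intro functional_diff functional_cf x y)
  have "\<psi> (S ((a \<otimes> t \<xi>) \<otimes> \<pi> h \<oplus> a \<otimes> \<pi> f)) = 0"
  proof (rule local_vanish[OF \<psi>])
    fix c assume c: "c \<in> TA"
    have "c \<otimes> ((a \<otimes> t \<xi>) \<otimes> \<pi> h \<oplus> a \<otimes> \<pi> f) = ((c \<otimes> a) \<otimes> t \<xi>) \<otimes> \<pi> h \<oplus> (c \<otimes> a) \<otimes> \<pi> f"
      using c a \<xi> h f by (simp add: mult_distr_right mult_assoc)
    then show "\<psi> (c \<otimes> ((a \<otimes> t \<xi>) \<otimes> \<pi> h \<oplus> a \<otimes> \<pi> f)) = 0"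
      using c a \<xi> h f x y by (simp add: \<psi>_def cf_add cf_mult_pi cf_mult_t)
  qed (use a \<xi> h f in auto)
  \<comment> \<open>By \<open>cf_S_pi\<close>, \<open>h\<close> keeps only the coefficient at
    \<open>x\<close> and \<open>f\<close> only the one at \<open>\<sigma> j x\<close>, so the
    vanishing of \<open>\<psi>\<close> is the claim.\<close>
  then show ?thesis using a \<xi> h f x y by (simp add: \<psi>_def S_add cf_add cf_S_pi)
qed

text \<open>At a loop, \<open>\<phi>\<close> is the evaluation of the power series in the loop variable at \<open>z\<close>; it annihilates
  the left ideal generated by \<open>t \<xi> - z s \<pi> e\<close>, for any \<open>e\<close> with value 1 at \<open>x\<close>.\<close>

lemma cf_S_t_fixed:
  assumes a: "a \<in> TA" and \<xi>: "\<xi> \<in> X" and x: "x \<in> spec" and loop: "\<sigma> j x = x"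
    and supp: "\<And>i. i \<noteq> j \<Longrightarrow> \<xi> (i, x) = 0"
  shows "cf (S (a \<otimes> t \<xi>)) (j # v) x = cf (S a) v x * \<xi> (j, x)"
proof -
  let ?s = "\<xi> (j, x)"
  \<comment> \<open>The word is split as \<open>m\<close> copies of \<open>j\<close> followed by
    \<open>u\<close>, which does not start with \<open>j\<close>; the power series runs over all
    numbers of copies.\<close>
  define u where "u = dropWhile (\<lambda>i. i = j) (j # v)"
  define m where "m = length (takeWhile (\<lambda>i. i = j) (j # v))"
  have "takeWhile (\<lambda>i. i = j) (j # v) = replicate m j"
    unfolding m_def by (rule replicate_length_same[symmetric]) (auto dest: set_takeWhileD)
  then have w: "j # v = replicate m j @ u" unfolding u_def by (metis takeWhile_dropWhile_id)
  have u: "u = [] \<or> hd u \<noteq> j" unfolding u_def using hd_dropWhile[of "\<lambda>i. i = j" "j # v"] by blast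
  define \<phi> where "\<phi> z c = (\<Sum>k. cf c (replicate k j @ u) x * z ^ k)" for z c
  have summable: "summable (\<lambda>k. cf c (replicate k j @ u) x * z ^ k)" if z: "cmod z < 1" and c: "c \<in> TA" for z c
  proof (rule summable_comparison_test'[of "\<lambda>k. vnorm T c * cmod z ^ k" 0])
    show "summable (\<lambda>k. vnorm T c * cmod z ^ k)" using z by (intro summable_mult summable_geometric) simp
    show "norm (cf c (replicate k j @ u) x * z ^ k) \<le> vnorm T c * cmod z ^ k" for k
      using cf_le[OF x c] by (simp add: norm_mult norm_power mult_right_mono)
  qed
  have \<phi>: "functional (\<phi> z)" if z: "cmod z < 1" for z
    unfolding functional_def
  proof (intro conjI ballI allI)
    fix c d assume cd: "c \<in> TA" "d \<in> TA"
    then show "\<phi> z (c \<oplus> d) = \<phi> z c + \<phi> z d"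
      unfolding \<phi>_def using suminf_add[OF summable[OF z cd(1)] summable[OF z cd(2)]]
      by (simp add: cf_add[OF x] distrib_right)
  next
    fix r c assume c: "c \<in> TA"
    then show "\<phi> z (r \<odot> c) = r * \<phi> z c"
      unfolding \<phi>_def using suminf_mult[OF summable[OF z c], of r] by (simp add: cf_scale[OF x] mult.assoc)
  next
    show "\<exists>L. \<forall>c\<in>TA. cmod (\<phi> z c) \<le> L * vnorm T c"
    proof (intro exI ballI)
      fix c assume c: "c \<in> TA"
      have "cmod (\<phi> z c) \<le> (\<Sum>k. vnorm T c * cmod z ^ k)"
        unfolding \<phi>_def
      proof (rule norm_suminf_le)
        show "norm (cf c (replicate k j @ u) x * z ^ k) \<le> vnorm T c * cmod z ^ k" for k
          using cf_le[OF x c] by (simp add: norm_mult norm_power mult_right_mono)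
        show "summable (\<lambda>k. vnorm T c * cmod z ^ k)" using z by (intro summable_mult summable_geometric) simp
      qed
      also have "\<dots> = vnorm T c * (1 / (1 - cmod z))" using z by (subst suminf_mult) (auto simp: suminf_geometric summable_geometric)
      finally show "cmod (\<phi> z c) \<le> 1 / (1 - cmod z) * vnorm T c" by (simp add: mult.commute)
    qed
  qed
  have \<phi>_t: "\<phi> z (c \<otimes> t \<xi>) = z * ?s * \<phi> z c" if z: "cmod z < 1" and c: "c \<in> TA" for z c
  proof -
    have ct: "c \<otimes> t \<xi> \<in> TA" using c \<xi> by auto
    \<comment> \<open>The constant term drops out because \<open>u\<close> is empty or starts with
      an edge on which \<open>\<xi>\<close> vanishes at \<open>x\<close>; the other terms move by
      one place, which produces the factor \<open>z\<close>.\<close>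
    have "cf (c \<otimes> t \<xi>) u x = 0"
      using u supp cf_mult_t[OF x c \<xi>, of u] by (cases u) auto
    then have "\<phi> z (c \<otimes> t \<xi>) = (\<Sum>k. cf (c \<otimes> t \<xi>) (replicate (Suc k) j @ u) x * z ^ k) * z"
      unfolding \<phi>_def using powser_split_head(1)[OF summable[OF z ct]] by simp
    also have "(\<Sum>k. cf (c \<otimes> t \<xi>) (replicate (Suc k) j @ u) x * z ^ k) = (\<Sum>k. ?s * (cf c (replicate k j @ u) x * z ^ k))"
      using cf_mult_t[OF x c \<xi>] loop by (simp add: mult_ac)
    also have "\<dots> = ?s * \<phi> z c" unfolding \<phi>_def by (rule suminf_mult[OF summable[OF z c]])
    finally show ?thesis by (simp add: mult_ac)
  qed
  have "x \<in> topspace \<Omega>" using x by (simp add: spec_def)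
  then obtain e where e: "e \<in> C0 \<Omega>" "e x = 1" using C0_separate[OF lch] by blast
  have \<phi>_e: "\<phi> z (c \<otimes> \<pi> e) = \<phi> z c" and \<phi>_Se: "\<phi> z (S (c \<otimes> \<pi> e)) = \<phi> z (S c)" if "c \<in> TA" for z c
    unfolding \<phi>_def using that e x by (simp_all add: cf_mult_pi cf_S_pi)
  let ?c = "S (a \<otimes> t \<xi>) \<ominus> S a \<otimes> t \<xi>"
  have cTA: "?c \<in> TA" using a \<xi> by auto
  have "\<phi> z ?c = 0" if z: "cmod z < 1" for z
  proof -
    have "\<phi> z (S (a \<otimes> t \<xi> \<ominus> (z * ?s) \<odot> (a \<otimes> \<pi> e))) = 0"
    proof (rule local_vanish[OF \<phi>[OF z]])
      fix c assume c: "c \<in> TA"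
      have "c \<otimes> (a \<otimes> t \<xi> \<ominus> (z * ?s) \<odot> (a \<otimes> \<pi> e)) = (c \<otimes> a) \<otimes> t \<xi> \<ominus> (z * ?s) \<odot> ((c \<otimes> a) \<otimes> \<pi> e)"
        using c a \<xi> e by (simp add: mult_minus_right smult_mult_right mult_assoc)
      then show "\<phi> z (c \<otimes> (a \<otimes> t \<xi> \<ominus> (z * ?s) \<odot> (a \<otimes> \<pi> e))) = 0"
        using c a \<xi> e \<phi>[OF z] by (simp add: functional_minus[OF \<phi>[OF z]] \<phi>_t[OF z] \<phi>_e functional_def)
    qed (use a \<xi> e in auto)
    then have "\<phi> z (S (a \<otimes> t \<xi>)) = z * ?s * \<phi> z (S a)"
      using a \<xi> e \<phi>[OF z] by (simp add: S_minus S_scale functional_minus[OF \<phi>[OF z]] \<phi>_Se functional_def)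
    then show ?thesis using a \<xi> by (simp add: functional_minus[OF \<phi>[OF z]] \<phi>_t[OF z])
  qed
  then have "(\<lambda>k. cf ?c (replicate k j @ u) x * z ^ k) sums 0" if "cmod z < 1" for z
    using summable_sums[OF summable[OF that cTA]] that by (simp add: \<phi>_def)
  then have "cf ?c (replicate m j @ u) x = 0" by (rule powser_zero_imp_coeffs_zero)
  then have "cf (S (a \<otimes> t \<xi>)) (j # v) x = cf (S a \<otimes> t \<xi>) (j # v) x"
    unfolding w[symmetric] using a \<xi> by (simp add: functional_minus[OF functional_cf[OF x]])
  then show ?thesis using cf_mult_t[OF x _ \<xi>, of "S a" "j # v"] a loop by simp
qed

lemma cf_S_t:
  assumes a: "a \<in> TA" and \<xi>: "\<xi> \<in> X" and x: "x \<in> spec"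
  shows "cf (S (a \<otimes> t \<xi>)) w x = shift (cf (S a)) \<xi> w x"
proof (cases w)
  case Nil then show ?thesis using cf_S_t_zero[OF assms, of w] by simp
next
  case (Cons j v)
  consider "\<xi> (j, x) = 0" | "j \<in> {1..n}" "\<sigma> j x \<noteq> x" | "\<sigma> j x = x" using X_support[OF \<xi>] by blast
  then show ?thesis
  proof cases
    case 1 then show ?thesis using cf_S_t_zero[OF assms, of w] Cons by simp
  next
    case 2 then show ?thesis using cf_S_t_moved[OF assms] Cons by simp
  next
    case 3
    \<comment> \<open>Other edges may leave \<open>x\<close> as well; the part of
      \<open>\<xi>\<close> on them contributes nothing at a word starting with
      \<open>j\<close>.\<close>
    define \<eta> where "\<eta> = (\<lambda>(i, x). if i = j then \<xi> (i, x) else 0)"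
    have \<eta>: "\<eta> \<in> X" unfolding \<eta>_def by (rule C0_edge_restrict[OF \<xi>])
    have \<zeta>: "(\<lambda>p. \<xi> p - \<eta> p) \<in> X" by (rule C0_diff[OF \<xi> \<eta>])
    have "t \<xi> = t \<eta> \<oplus> t (\<lambda>p. \<xi> p - \<eta> p)" using t_add[OF \<eta> \<zeta>] by simp
    then have "cf (S (a \<otimes> t \<xi>)) w x = cf (S (a \<otimes> t \<eta>)) w x + cf (S (a \<otimes> t (\<lambda>p. \<xi> p - \<eta> p))) w x"
      using a \<eta> \<zeta> x by (simp add: mult_distr_right S_add cf_add)
    also have "cf (S (a \<otimes> t (\<lambda>p. \<xi> p - \<eta> p))) w x = 0"
      by (rule cf_S_t_zero[OF a \<zeta> x]) (simp add: Cons \<eta>_def)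
    also have "cf (S (a \<otimes> t \<eta>)) w x = cf (S a) v x * \<eta> (j, x)"
      unfolding Cons by (rule cf_S_t_fixed[OF a \<eta> x 3]) (simp add: \<eta>_def)
    finally show ?thesis using Cons 3 by (simp add: \<eta>_def)
  qed
qed

text \<open>Membership of \<open>b\<close> in \<open>N\<close> asks for the identity for all
  \<open>a\<close> at once, so it passes to products: \<open>S (a \<otimes> q \<otimes> g) = S (a
  \<otimes> q) \<otimes> g = S a \<otimes> q \<otimes> g\<close>. Boundedness of \<open>S\<close>
  passes it to limits, and for generators equality is read off from coefficients.\<close>

lemma S_left_multiplier:
  assumes "a \<in> TA" "b \<in> TA" shows "S (a \<otimes> b) = S a \<otimes> b"
proof -
  define N where "N = {b \<in> TA. \<forall>a\<in>TA. S (a \<otimes> b) = S a \<otimes> b}"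
  obtain K0 where K0: "\<forall>a\<in>TA. vnorm T (S a) \<le> K0 * vnorm T a" using S_bdd by blast
  have gen: "g \<in> N" if "g \<in> gens" for g
    using that
  proof (elim UnE imageE)
    fix f assume f: "f \<in> C0 \<Omega>" "g = \<pi> f"
    then show ?thesis unfolding N_def
      by (auto intro!: cf_eqI simp: cf_S_pi cf_mult_pi)
  next
    fix \<xi> assume \<xi>: "\<xi> \<in> X" "g = t \<xi>"
    then show ?thesis unfolding N_def
      by (auto intro!: cf_eqI simp: cf_S_t cf_mult_t)
  qed
  have "TA \<subseteq> N"
    unfolding TA_def
  proof (rule generated_subset)
    show "\<zero> \<in> N" using S_scale[of \<zero> 0] by (auto simp: N_def)
    show "b \<oplus> c \<in> N" if "b \<in> N" "c \<in> N" for b c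
      using that by (auto simp: N_def mult_distr_right S_add)
    show "s \<odot> b \<in> N" if "b \<in> N" for s b
      using that by (auto simp: N_def smult_mult_right S_scale)
    show "g \<in> N" if "g \<in> gens" for g using that by (rule gen)
    show "q \<otimes> g \<in> N" if "q \<in> N" "g \<in> gens" for q g
    proof -
      have "g \<in> N" "q \<in> N" using gen that by auto
      then show ?thesis by (auto simp: N_def mult_assoc[symmetric])
    qed
    fix b assume b: "b \<in> carrier T" "\<And>e. e > 0 \<Longrightarrow> \<exists>c\<in>N. vnorm T (b \<ominus> c) < e"
    have bTA: "b \<in> TA" by (rule TA_closed[OF b(1)]) (use b(2) N_def in blast)
    have "S (a \<otimes> b) = S a \<otimes> b" if a: "a \<in> TA" for a
    proof (rule eq_if_vnorm_minus_le[where K="\<bar>K0\<bar> * vnorm T a + vnorm T (S a)"])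
      fix e :: real assume "e > 0"
      then obtain c where c: "c \<in> N" "vnorm T (b \<ominus> c) < e" using b(2) by blast
      have cTA: "c \<in> TA" and Sc: "S (a \<otimes> c) = S a \<otimes> c" using c(1) a by (auto simp: N_def)
      have "vnorm T (S (a \<otimes> b) \<ominus> S a \<otimes> b) \<le> vnorm T (S (a \<otimes> b) \<ominus> S (a \<otimes> c)) + vnorm T (S a \<otimes> c \<ominus> S a \<otimes> b)"
        unfolding Sc[symmetric] using a bTA cTA by (intro vnorm_minus_triangle) auto
      also have "S (a \<otimes> b) \<ominus> S (a \<otimes> c) = S (a \<otimes> (b \<ominus> c))"
        using a bTA cTA by (simp add: S_minus[symmetric] mult_minus_right)
      also have "vnorm T (S a \<otimes> c \<ominus> S a \<otimes> b) = vnorm T (S a \<otimes> (b \<ominus> c))"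
        using a bTA cTA vnorm_minus_commute[of "S a \<otimes> c" "S a \<otimes> b"] by (simp add: mult_minus_right)
      also have "vnorm T (S (a \<otimes> (b \<ominus> c))) \<le> \<bar>K0\<bar> * (vnorm T a * vnorm T (b \<ominus> c))"
      proof -
        have "vnorm T (S (a \<otimes> (b \<ominus> c))) \<le> K0 * vnorm T (a \<otimes> (b \<ominus> c))" using K0 a bTA cTA by blast
        also have "\<dots> \<le> \<bar>K0\<bar> * vnorm T (a \<otimes> (b \<ominus> c))" using a bTA cTA by (intro mult_right_mono) auto
        also have "\<dots> \<le> \<bar>K0\<bar> * (vnorm T a * vnorm T (b \<ominus> c))"
          using a bTA cTA by (intro mult_left_mono vnorm_mult) auto
        finally show ?thesis .
      qed
      also have "vnorm T (S a \<otimes> (b \<ominus> c)) \<le> vnorm T (S a) * vnorm T (b \<ominus> c)"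
        using a bTA cTA by (intro vnorm_mult) auto
      also have "\<bar>K0\<bar> * (vnorm T a * vnorm T (b \<ominus> c)) + vnorm T (S a) * vnorm T (b \<ominus> c)
          = (\<bar>K0\<bar> * vnorm T a + vnorm T (S a)) * vnorm T (b \<ominus> c)" by (simp add: algebra_simps)
      also have "\<dots> \<le> (\<bar>K0\<bar> * vnorm T a + vnorm T (S a)) * e"
        using c(2) a by (intro mult_left_mono) auto
      finally show "vnorm T (S (a \<otimes> b) \<ominus> S a \<otimes> b) \<le> (\<bar>K0\<bar> * vnorm T a + vnorm T (S a)) * e" by simp
    qed (use a bTA in auto)
    then show "b \<in> N" using bTA by (simp add: N_def)
  qed (auto simp: N_def)
  then show ?thesis using assms by (auto simp: N_def)
qed

end

end

theorem corollary3p5: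
  fixes \<Omega> :: "'a topology" and n :: nat and \<sigma> :: "nat \<Rightarrow> 'a \<Rightarrow> 'a"
    and T :: "'b cstar_algebra"
    and \<pi> :: "('a \<Rightarrow> complex) \<Rightarrow> 'b" and t :: "(nat \<times> 'a \<Rightarrow> complex) \<Rightarrow> 'b"
    and S :: "'b \<Rightarrow> 'b"
  assumes "multivariable_dynamical_system \<Omega> n \<sigma>"
    and "universal_toeplitz_rep (C0_algebra \<Omega>) (dyn_correspondence \<Omega> n \<sigma>) T \<pi> t"
    and "approx_local_left_multiplier
           (tensor_algebra (C0_algebra \<Omega>) (dyn_correspondence \<Omega> n \<sigma>) T \<pi> t) S"
  shows "left_multiplier
           (tensor_algebra (C0_algebra \<Omega>) (dyn_correspondence \<Omega> n \<sigma>) T \<pi> t) S"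
proof -
  interpret cstar_algebra T using assms(2) by (simp add: universal_toeplitz_rep_def)
  interpret toeplitz_system T \<Omega> n \<sigma> \<pi> t by unfold_locales fact+
  let ?A = "tensor_algebra (C0_algebra \<Omega>) (dyn_correspondence \<Omega> n \<sigma>) T \<pi> t"
  have simps [simp]: "carrier ?A = TA" "x \<otimes>\<^bsub>?A\<^esub> y = x \<otimes>\<^bsub>T\<^esub> y" "x \<oplus>\<^bsub>?A\<^esub> y = x \<oplus>\<^bsub>T\<^esub> y" "\<zero>\<^bsub>?A\<^esub> = \<zero>\<^bsub>T\<^esub>"
    "c \<odot>\<^bsub>?A\<^esub> x = c \<odot>\<^bsub>T\<^esub> x" "vnorm ?A x = vnorm T x" for x y c
    by (simp_all add: tensor_algebra_def banach_algebra.truncate_def TA_def)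
  \<comment> \<open>Negation in \<open>?A\<close> is the inverse within the smaller carrier; it has
    to be identified with negation in \<open>T\<close> before differences and distances
    agree.\<close>
  have minus: "x \<ominus>\<^bsub>?A\<^esub> y = x \<ominus>\<^bsub>T\<^esub> y" if "x \<in> TA" "y \<in> TA" for x y
  proof -
    have "\<ominus>\<^bsub>?A\<^esub> y = (THE z. z \<in> TA \<and> y \<oplus>\<^bsub>T\<^esub> z = \<zero>\<^bsub>T\<^esub> \<and> z \<oplus>\<^bsub>T\<^esub> y = \<zero>\<^bsub>T\<^esub>)"
      by (simp add: a_inv_def m_inv_def)
    also have "\<dots> = \<ominus>\<^bsub>T\<^esub> y"
    proof (rule the_equality)
      show "\<ominus>\<^bsub>T\<^esub> y \<in> TA \<and> y \<oplus>\<^bsub>T\<^esub> \<ominus>\<^bsub>T\<^esub> y = \<zero>\<^bsub>T\<^esub> \<and> \<ominus>\<^bsub>T\<^esub> y \<oplus>\<^bsub>T\<^esub> y = \<zero>\<^bsub>T\<^esub>"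
        using that by (auto simp: M.r_neg M.l_neg) (auto simp: uminus_eq_scale)
      show "z = \<ominus>\<^bsub>T\<^esub> y" if "z \<in> TA \<and> y \<oplus>\<^bsub>T\<^esub> z = \<zero>\<^bsub>T\<^esub> \<and> z \<oplus>\<^bsub>T\<^esub> y = \<zero>\<^bsub>T\<^esub>" for z
        using M.minus_equality[of z y] that \<open>y \<in> TA\<close> by auto
    qed
    finally show ?thesis by (simp add: a_minus_def)
  qed
  have vd: "vdist ?A x y = (if x \<in> TA \<and> y \<in> TA then vdist T x y else 0)" for x y
    using minus[of x y] by (auto simp: vdist_def)
  have "Metric_space TA (vdist ?A)"
  proof -
    interpret M: Metric_space "carrier T" "vdist T" by (rule Metric_space_vdist)
    show ?thesis by unfold_locales (auto simp: vd M.commute intro: M.triangle)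
  qed
  then interpret A: Metric_space "carrier ?A" "vdist ?A" by simp
  have bl: "bounded_linear_on ?A S"
    and lim: "\<And>a. a \<in> TA \<Longrightarrow> \<exists>x :: nat \<Rightarrow> 'b. range x \<subseteq> TA \<and> limitin (vtopology ?A) (\<lambda>n. x n \<otimes>\<^bsub>T\<^esub> a) (S a) sequentially"
    using assms(3) by (auto simp: approx_local_left_multiplier_def)
  have lin: "linear_on ?A ?A S" and bd: "\<exists>K. \<forall>a\<in>TA. vnorm T (S a) \<le> K * vnorm T a"
    using bl by (auto simp: bounded_linear_on_def)
  note S = linear_onD[OF lin, simplified]
  \<comment> \<open>Of each approximating sequence a single term per tolerance is kept, which is the
    form of locality that \<open>local_vanish\<close> relies on.\<close>
  have loc: "\<exists>b\<in>TA. vnorm T (S a \<ominus>\<^bsub>T\<^esub> b \<otimes>\<^bsub>T\<^esub> a) < e" if a: "a \<in> TA" and e: "e > 0" for a e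
  proof -
    obtain x :: "nat \<Rightarrow> 'b" where x: "range x \<subseteq> TA" "limitin A.mtopology (\<lambda>n. x n \<otimes>\<^bsub>T\<^esub> a) (S a) sequentially"
      using lim[OF a] by blast
    then obtain k where k: "vdist ?A (x k \<otimes>\<^bsub>T\<^esub> a) (S a) < e" using e unfolding A.limit_metric_sequentially by blast
    have xk: "x k \<in> TA" using x by auto
    then have "vnorm T (x k \<otimes>\<^bsub>T\<^esub> a \<ominus>\<^bsub>T\<^esub> S a) < e" using k a S(1)[OF a] by (simp add: vd vdist_def[of T])
    then have "vnorm T (S a \<ominus>\<^bsub>T\<^esub> x k \<otimes>\<^bsub>T\<^esub> a) < e"
      using vnorm_minus_commute[of "S a" "x k \<otimes>\<^bsub>T\<^esub> a"] xk a S(1)[OF a] by simp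
    then show ?thesis using xk by blast
  qed
  show ?thesis
    using bl S_left_multiplier[of S, OF S bd loc] by (auto simp: left_multiplier_def)
qed

end
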